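(* Let $(a_n)_{n\ge 0}$ be a primary pseudo-polynomial such that there exist real numbers $c>0$ and $1<\delta<e$ with $|a_n|\le c\,\delta^n$ for all $n\ge 0$. Then there exists an effectively computable constant $H(c,\delta)\ge 1$, depending only on $c$ and $\delta$, such that there exist an integer $S\ge 0$ and polynomials $p_0(X),\dots,p_S(X)\in\mathbb{Z}[X]$, not all zero, satisfying $$\sum_{j=0}^S p_j(n)\,a_{n+j}=0\quad\text{for all integers } n\ge 0,$$ and $$\max_j\deg(p_j)\le\max\left(0,\left\lceil\frac{5\log(\delta)-1}{1-\log(\delta)}\right\rceil\right),\qquad \max_j H(p_j)\le H(c,\delta),\qquad S\le\frac{\log\big(H(c,\delta)\big)}{\log(\delta)}.$$ Moreover, the existence of such a recurrence does not necessarily hold if $e$ is replaced by any larger number in the assumption $1<\delta<e$; that is, for every real number $e'>e$ there exist a primary pseudo-polynomial $(a_n)_{n\ge 0}$ and real numbers $c>0$ and $1<\delta<e'$ with $|a_n|\le c\,\delta^n$ for all $n\ge 0$, such that there are no integer $S\ge 0$ and polynomials $p_0(X),\dots,p_S(X)\in\mathbb{Z}[X]$, not all zero, with $\sum_{j=0}^S p_j(n)a_{n+j}=0$ for all $n\ge 0$.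
   Context: A sequence $(a_n)_{n\ge 0}$ of integers is a primary pseudo-polynomial if for every integer $n\ge 0$ and every prime number $p$, $a_{n+p}\equiv a_n \pmod p$. For a polynomial $Q(X)=\sum_j q_jX^j\in\mathbb{C}[X]$, $H(Q):=\max_j|q_j|$. Here $e$ is the base of the natural logarithm and $\log$ is the natural logarithm. *)

theory Defs
  imports
    Complex_Main
    "HOL-Computational_Algebra.Polynomial"
    "HOL-Computational_Algebra.Primes"
    "HOL-Number_Theory.Cong"
begin

definition primary_pseudo_polynomial :: "(nat \<Rightarrow> int) \<Rightarrow> bool" where
  "primary_pseudo_polynomial a \<longleftrightarrow>
     (\<forall>(n::nat) (p::nat). prime p \<longrightarrow> [a (n + p) = a n] (mod int p))"

definition poly_height :: "complex poly \<Rightarrow> real" where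
  "poly_height Q = Max ((\<lambda>j. cmod (coeff Q j)) ` {..degree Q})"

definition satisfies_recurrence ::
    "(nat \<Rightarrow> int) \<Rightarrow> nat \<Rightarrow> (nat \<Rightarrow> int poly) \<Rightarrow> bool" where
  "satisfies_recurrence a S p \<longleftrightarrow>
     (\<exists>j\<le>S. p j \<noteq> 0) \<and> (\<forall>n. (\<Sum>j\<le>S. poly (p j) (int n) * a (n + j)) = 0)"

text \<open>
  Effectively computable real functions in the sense of computable analysis
  (Grzegorczyk, Ko, Weihrauch). Programs are descriptions of partial recursive functions
  that may query two oracles \<open>\<phi>\<close> and \<open>\<psi>\<close>. A real number is given by an oracle
  returning dyadic approximations of it, and a function of two real numbers is computable if
  one fixed program transforms any such descriptions of the arguments into dyadic
  approximations of the value.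
\<close>

datatype prog =
    Zero_fun
  | Succ_fun
  | Proj_fun nat
  | Query1
  | Query2
  | Comp_fun prog "prog list"
  | Prim_rec prog prog
  | Mu prog

inductive runs :: "(nat \<Rightarrow> nat) \<Rightarrow> (nat \<Rightarrow> nat) \<Rightarrow> prog \<Rightarrow> nat list \<Rightarrow> nat \<Rightarrow> bool"
  for \<phi> \<psi> :: "nat \<Rightarrow> nat" where
  runs_Zero: "runs \<phi> \<psi> Zero_fun xs 0"
| runs_Succ: "runs \<phi> \<psi> Succ_fun [x] (Suc x)"
| runs_Proj: "i < length xs \<Longrightarrow> runs \<phi> \<psi> (Proj_fun i) xs (xs ! i)"
| runs_Query1: "runs \<phi> \<psi> Query1 [x] (\<phi> x)"
| runs_Query2: "runs \<phi> \<psi> Query2 [x] (\<psi> x)"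
| runs_Comp: "list_all2 (\<lambda>g y. runs \<phi> \<psi> g xs y) gs ys \<Longrightarrow> runs \<phi> \<psi> f ys z \<Longrightarrow>
    runs \<phi> \<psi> (Comp_fun f gs) xs z"
| runs_Prim_0: "runs \<phi> \<psi> f xs y \<Longrightarrow> runs \<phi> \<psi> (Prim_rec f g) (0 # xs) y"
| runs_Prim_Suc: "runs \<phi> \<psi> (Prim_rec f g) (n # xs) r \<Longrightarrow> runs \<phi> \<psi> g (n # r # xs) y \<Longrightarrow>
    runs \<phi> \<psi> (Prim_rec f g) (Suc n # xs) y"
| runs_Mu: "runs \<phi> \<psi> f (n # xs) 0 \<Longrightarrow> (\<forall>m<n. \<exists>k. runs \<phi> \<psi> f (m # xs) (Suc k)) \<Longrightarrow>
    runs \<phi> \<psi> (Mu f) xs n"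

lemma runs_deterministic:
  "runs \<phi> \<psi> P xs y \<Longrightarrow> runs \<phi> \<psi> P xs z \<Longrightarrow> y = z"
proof (induction arbitrary: z rule: runs.induct)
  case (runs_Comp xs gs ys f w)
  from runs_Comp.prems obtain ys' where
    a: "list_all2 (\<lambda>g y. runs \<phi> \<psi> g xs y) gs ys'" and b: "runs \<phi> \<psi> f ys' z"
    by (cases rule: runs.cases) auto
  have "ys = ys'"
    using runs_Comp.IH(1) a by (auto simp: list_all2_conv_all_nth intro!: nth_equalityI)
  then show ?case using runs_Comp.IH b by simp
next
  case (runs_Prim_Suc f g n xs r y)
  from runs_Prim_Suc.prems obtain r' where
    "runs \<phi> \<psi> (Prim_rec f g) (n # xs) r'" "runs \<phi> \<psi> g (n # r' # xs) z"
    by (cases rule: runs.cases) auto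
  then show ?case using runs_Prim_Suc.IH by metis
next
  case (runs_Mu f n xs)
  from runs_Mu.prems have a: "runs \<phi> \<psi> f (z # xs) 0"
    and b: "\<forall>m<z. \<exists>k. runs \<phi> \<psi> f (m # xs) (Suc k)"
    by (cases rule: runs.cases; auto)+
  have "\<not> n < z" using b runs_Mu.IH by fastforce
  moreover have "\<not> z < n" using a runs_Mu.IH by fastforce
  ultimately show ?case by simp
qed (erule runs.cases; fastforce)+

text \<open>
  \<open>\<phi> k / 2 ^ k\<close> approximates \<open>x\<close> with error at most \<open>1 / 2 ^ k\<close>. As the
  approximations are natural numbers, exactly the nonnegative real numbers have such a name.
\<close>

definition dyadic_name :: "(nat \<Rightarrow> nat) \<Rightarrow> real \<Rightarrow> bool" where
  "dyadic_name \<phi> x \<longleftrightarrow> (\<forall>k. \<bar>real (\<phi> k) / 2 ^ k - x\<bar> \<le> 1 / 2 ^ k)"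

lemma dyadic_name_exists:
  assumes "0 \<le> x"
  shows "dyadic_name (\<lambda>k. nat \<lfloor>2 ^ k * x\<rfloor>) x"
  unfolding dyadic_name_def
proof
  fix k :: nat
  have e: "real (nat \<lfloor>2 ^ k * x\<rfloor>) = of_int \<lfloor>2 ^ k * x\<rfloor>"
    using assms by simp
  have "\<bar>real (nat \<lfloor>2 ^ k * x\<rfloor>) - 2 ^ k * x\<bar> \<le> 1"
    unfolding e by linarith
  then have "\<bar>real (nat \<lfloor>2 ^ k * x\<rfloor>) - 2 ^ k * x\<bar> / 2 ^ k \<le> 1 / 2 ^ k"
    by (intro divide_right_mono) auto
  moreover have "\<bar>real (nat \<lfloor>2 ^ k * x\<rfloor>) - 2 ^ k * x\<bar> / 2 ^ k
      = \<bar>(real (nat \<lfloor>2 ^ k * x\<rfloor>) - 2 ^ k * x) / 2 ^ k\<bar>"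
    by simp
  ultimately show "\<bar>real (nat \<lfloor>2 ^ k * x\<rfloor>) / 2 ^ k - x\<bar> \<le> 1 / 2 ^ k"
    by (simp add: diff_divide_distrib)
qed

lemma dyadic_name_unique:
  assumes "dyadic_name \<phi> x" "dyadic_name \<phi> y"
  shows "x = y"
proof (rule ccontr)
  assume "x \<noteq> y"
  then obtain k :: nat where k: "(1 / 2) ^ k < \<bar>x - y\<bar> / 2"
    using real_arch_pow_inv[of "\<bar>x - y\<bar> / 2" "1 / 2"] by auto
  have "\<bar>x - y\<bar> \<le> 1 / 2 ^ k + 1 / 2 ^ k"
    using assms[unfolded dyadic_name_def, rule_format, of k] by linarith
  with k show False by (simp add: power_one_over)
qed

definition computable_real_fun2 :: "(real \<times> real) set \<Rightarrow> (real \<Rightarrow> real \<Rightarrow> real) \<Rightarrow> bool" where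
  "computable_real_fun2 D F \<longleftrightarrow>
     (\<exists>P. \<forall>(x, y) \<in> D. \<forall>\<phi> \<psi>. dyadic_name \<phi> x \<longrightarrow> dyadic_name \<psi> y \<longrightarrow>
        (\<exists>\<chi>. (\<forall>k. runs \<phi> \<psi> P [k] (\<chi> k)) \<and> dyadic_name \<chi> (F x y)))"

end

theory Submission
  imports
    Defs
    "HOL-Complex_Analysis.Complex_Analysis"
    "HOL-Number_Theory.Prime_Powers"
begin

text \<open>
  Write \<open>u = ln \<delta> < 1\<close>. Fix \<open>d\<close> and \<open>S\<close>, and consider the linear forms
  \<open>L(n) = \<Sum>j\<le>S. \<Sum>i<d. q j i * n ^ i * a (n + j)\<close> with integer coefficients \<open>q j i\<close>.
  Every such form is again a primary pseudo-polynomial. So if \<open>L\<close> vanishes below \<open>n\<close>, then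
  \<open>L(n)\<close> is divisible by every prime \<open>p \<le> n\<close>, hence by their product \<open>P n\<close>, which has
  size \<open>e\<close> to the power \<open>n + o(n)\<close> by the prime number theorem. As \<open>L(n)\<close> itself grows like
  \<open>\<delta> ^ n\<close> with \<open>\<delta> < e\<close>, vanishing on a long enough initial segment forces \<open>L = 0\<close>, which is
  the wanted recurrence.

  Vanishing on an initial segment comes from the pigeonhole principle, applied to the coefficient
  vectors with entries between \<open>0\<close> and \<open>X\<close>, where \<open>X\<close> is about \<open>exp (u * S)\<close>. The same
  divisibility is used a second time here: two forms that agree below \<open>n\<close> have values at \<open>n\<close>
  that are congruent modulo \<open>P n\<close>, so only about \<open>1 + 2 * X * A n / P n\<close> values are possible
  at \<open>n\<close> (\<open>A n\<close> bounds a form with coefficients at most \<open>1\<close>). The logarithm of the number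
  of possible value vectors is thus about \<open>(2 * u * S)\<^sup>2 / (2 * (1 - u))\<close>, while the logarithm of
  the number of coefficient vectors is about \<open>d * u * S\<^sup>2\<close>. When \<open>d - 1\<close> is
  the degree bound of the theorem, \<open>d * (1 - u) \<ge> 4 * u\<close>, so the second number is at least
  twice the first, and this surplus absorbs all error terms
  (lemma \<open>recurrence_exists\<close>). The height is at most \<open>X \<le> exp S\<close>, so everything is
  controlled by \<open>S\<close>, and \<open>S\<close> by the point from which on \<open>ln (P n) \<ge> (1 - \<eta>) * n\<close>,
  where \<open>\<eta> = 1 / (2 * (d + 4))\<close>.

  For a computable bound that point must be bounded by a computable function of \<open>\<eta>\<close>, so the
  prime number theorem is needed with a rate (lemma \<open>theta_rate\<close>: the threshold is
  \<open>exp (C / \<eta> ^ 26)\<close>). It is proved by Newman's contour integral for the series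
  \<open>\<Sum>n. (\<psi>(n) - n) / n * n powr (-s)\<close>, keeping track of the radius \<open>R\<close> of the contour: the
  inequality \<open>3 + 4 * cos x + cos (2 * x) \<ge> 0\<close> gives a zero-free region whose width is a negative
  power of \<open>R\<close>, and a polynomial bound for the series in it (lemmas \<open>excess_series_bound\<close>
  and \<open>newman_bound\<close>). The value of \<open>C\<close> is not determined; a program that computes the bound
  exists whatever \<open>C\<close> is.

  The bound \<open>H c \<delta>\<close> has to be a computable function of two real numbers, hence continuous and
  independent of the names by which its arguments are given. The integer bounds valid for
  \<open>c \<le> m + 1\<close> and \<open>\<delta> \<le> (\<Sum>k\<le>m+1. 1 / k!)\<close> are therefore combined into a sum of
  multiples of \<open>max 0 (m! * \<delta> - R m) + max 0 (c - m)\<close>, where \<open>R m / m!\<close> is the \<open>m\<close>-th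
  partial sum of the series of \<open>e\<close> (lemmas \<open>height_fun_ge\<close> and \<open>computable_height_fun\<close>). Only
  finitely many terms are nonzero because \<open>\<delta> < e\<close>.

  For the converse, the Chinese remainder theorem allows two choices below \<open>2 * P n\<close> for each
  value \<open>a n\<close>. This gives uncountably many primary pseudo-polynomials of growth
  \<open>exp ((1 + \<eta>) * n)\<close>, whereas only countably many sequences satisfy a recurrence, since a
  recurrence and finitely many initial values determine the sequence.
\<close>

section \<open>Chebyshev functions\<close>

definition psi :: "nat \<Rightarrow> real" where "psi n = (\<Sum>k\<le>n. mangoldt k)"
definition theta :: "nat \<Rightarrow> real" where "theta n = (\<Sum>p | prime p \<and> p \<le> n. ln (real p))"

lemma psi_Suc: "psi (Suc n) = psi n + mangoldt (Suc n)" by (simp add: psi_def)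
lemma psi_0 [simp]: "psi 0 = 0" by (simp add: psi_def)
lemma psi_nonneg: "psi n \<ge> 0" by (auto simp: psi_def intro!: sum_nonneg mangoldt_nonneg)
lemma psi_mono: "m \<le> n \<Longrightarrow> psi m \<le> psi n"
  unfolding psi_def by (rule sum_mono2) (auto simp: mangoldt_nonneg)

text \<open>
  Summing \<open>ln k = (\<Sum>d | d dvd k. mangoldt d)\<close> over \<open>k \<le> n\<close> counts \<open>d\<close> once for each of
  its \<open>n div d\<close> multiples. The upper summation limit is free so that two such sums can be
  subtracted termwise.
\<close>

lemma ln_fact_eq_sum_mangoldt:
  "n \<le> N \<Longrightarrow> ln (fact n) = (\<Sum>d=1..N. mangoldt d * real (n div d))"
proof (induction n)
  case (Suc n)
  have "ln (fact (Suc n)) = ln (real (Suc n)) + (ln (fact n) :: real)"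
    by (simp add: ln_mult del: of_nat_Suc)
  also have "ln (real (Suc n)) = (\<Sum>d | d dvd Suc n. mangoldt d)"
    using mangoldt_sum[of "Suc n", where ?'a = real] by simp
  also have "\<dots> = (\<Sum>d=1..N. mangoldt d * of_bool (d dvd Suc n))"
    using Suc.prems dvd_pos_nat[of "Suc n"]
    by (intro sum.mono_neutral_cong_left)
       (use dvd_imp_le[of _ "Suc n"] in \<open>force simp: Suc_le_eq\<close>)+
  also have "ln (fact n) = (\<Sum>d=1..N. mangoldt d * real (n div d))"
    using Suc by simp
  also have "(\<Sum>d=1..N. mangoldt d * of_bool (d dvd Suc n)) + \<dots>
     = (\<Sum>d=1..N. mangoldt d * real (Suc n div d))"
    unfolding sum.distrib[symmetric]
    by (rule sum.cong) (auto simp: div_Suc dvd_eq_mod_eq_0 algebra_simps)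
  finally show ?case .
qed (simp)

text \<open>
  Chebyshev's argument: in \<open>ln ((2 * n)!) - 2 * ln (n!)\<close>, the logarithm of a central binomial
  coefficient, every prime power between \<open>n\<close> and \<open>2 * n\<close> has weight \<open>1\<close> and no weight is
  negative.
\<close>

lemma psi_double: "psi (2 * n) \<le> psi n + 2 * real n * ln 2"
proof -
  have "psi (2 * n) - psi n = (\<Sum>d\<in>{n<..2*n}. mangoldt d)"
    unfolding psi_def by (subst sum_diff[symmetric]) (auto intro!: sum.cong)
  also have "\<dots> \<le> (\<Sum>d\<in>{n<..2*n}. mangoldt d * (real (2 * n div d) - 2 * real (n div d)))"
  proof (rule sum_mono)
    fix d assume d: "d \<in> {n<..2*n}"
    have "n div d = 0" using d by auto
    moreover have "2 * n div d \<ge> 1" using d by (auto simp: Suc_le_eq div_greater_zero_iff)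
    ultimately have "real (2 * n div d) - 2 * real (n div d) \<ge> 1" by simp
    from mult_left_mono[OF this mangoldt_nonneg[of d]]
    show "mangoldt d \<le> mangoldt d * (real (2 * n div d) - 2 * real (n div d))" by simp
  qed
  also have "\<dots> \<le> (\<Sum>d=1..2*n. mangoldt d * (real (2 * n div d) - 2 * real (n div d)))"
  proof (rule sum_mono2)
    fix d assume "d \<in> {1..2*n} - {n<..2*n}"
    have "2 * (n div d) * d \<le> 2 * n" using div_times_less_eq_dividend[of n d] by linarith
    hence "2 * (n div d) \<le> 2 * n div d"
      by (metis div_le_mono div_mult_self_is_m gr0I div_by_0 mult_0_right le0)
    hence "real (2 * n div d) - 2 * real (n div d) \<ge> 0"
      by (metis diff_ge_0_iff_ge of_nat_le_iff of_nat_mult of_nat_numeral)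
    thus "mangoldt d * (real (2 * n div d) - 2 * real (n div d)) \<ge> 0"
      by (intro mult_nonneg_nonneg mangoldt_nonneg)
  qed auto
  also have "\<dots> = ln (fact (2 * n)) - 2 * ln (fact n)"
    by (subst (1 2) ln_fact_eq_sum_mangoldt[where N="2*n"])
       (auto simp: algebra_simps sum_subtractf sum_distrib_left)
  also have "\<dots> = ln (real ((2 * n) choose n))"
    using binomial_fact[of n "2*n", where ?'a = real]
    by (simp add: ln_div ln_mult)
  also have "\<dots> \<le> ln (2 ^ (2 * n))"
  proof -
    have "real ((2 * n) choose n) \<le> real (2 ^ (2 * n))"
      unfolding of_nat_le_iff by (rule binomial_le_pow2)
    thus ?thesis by (subst ln_le_cancel_iff) (auto simp: zero_less_binomial)
  qed
  also have "\<dots> = 2 * real n * ln 2" by (simp add: ln_realpow)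
  finally show ?thesis by simp
qed

lemma psi_le: "psi n \<le> 4 * real n"
proof (induction n rule: less_induct)
  case (less n)
  show ?case
  proof (cases "n = 0")
    case False
    define m where "m = n div 2"
    have m: "m < n" "n = 2 * m \<or> n = Suc (2 * m)" using False by (auto simp: m_def)
    have "2 * real m * ln 2 \<le> 2 * real m * 1" using ln2_le_25_over_36 by (intro mult_left_mono) auto
    with psi_double[of m] less[OF m(1)] have A: "psi (2 * m) \<le> 6 * real m" by simp
    show ?thesis using m(2)
    proof
      assume "n = 2 * m" thus ?thesis using A by simp
    next
      assume n: "n = Suc (2 * m)"
      have "mangoldt (Suc (2 * m)) \<le> ln (real (Suc (2 * m)))" by (rule mangoldt_le) simp
      also have "\<dots> \<le> 2 * real m" using ln_add_one_self_le_self[of "2 * real m"] by (simp add: add.commute)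
      finally show ?thesis using A n by (simp add: psi_Suc)
    qed
  qed simp
qed

lemma theta_le_psi: "theta n \<le> psi n"
proof -
  have "theta n = (\<Sum>p | prime p \<and> p \<le> n. mangoldt p)"
    unfolding theta_def by (rule sum.cong) auto
  also have "\<dots> \<le> psi n"
    unfolding psi_def by (rule sum_mono2) (auto simp: mangoldt_nonneg)
  finally show ?thesis .
qed

text \<open>
  The difference comes from the proper prime powers. If \<open>p ^ k \<le> n\<close> with \<open>k \<ge> 2\<close>, then
  \<open>p \<le> sqrt n\<close> and \<open>k \<le> ln n / ln 2\<close>, so there are few of them, and each contributes at most
  \<open>ln n\<close>.
\<close>

lemma psi_minus_theta_le:
  assumes n: "n \<ge> 1"
  shows "psi n - theta n \<le> 512 * real n powr (3/4)"
proof -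
  define A where "A = {k. k \<le> n \<and> primepow k \<and> \<not> prime k}"
  have fin: "finite A" by (rule finite_subset[of _ "{..n}"]) (auto simp: A_def)
  have th: "theta n = (\<Sum>p | prime p \<and> p \<le> n. mangoldt p)"
    unfolding theta_def by (rule sum.cong) auto
  have "psi n = (\<Sum>k\<in>{p. prime p \<and> p \<le> n} \<union> A. mangoldt k)"
    unfolding psi_def by (rule sum.mono_neutral_right) (auto simp: A_def mangoldt_def)
  also have "\<dots> = theta n + (\<Sum>k\<in>A. mangoldt k)"
    unfolding th by (rule sum.union_disjoint) (use fin in \<open>auto simp: A_def\<close>)
  finally have "psi n - theta n = (\<Sum>k\<in>A. mangoldt k)" by simp
  also have "\<dots> \<le> (\<Sum>k\<in>A. ln (real n))"
  proof (rule sum_mono)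
    fix k assume k: "k \<in> A"
    hence "k > 0" by (auto simp: A_def intro!: Nat.gr0I)
    hence "mangoldt k \<le> ln (real k)" by (rule mangoldt_le)
    also have "\<dots> \<le> ln (real n)" using k \<open>k > 0\<close> by (auto simp: A_def)
    finally show "mangoldt k \<le> ln (real n)" .
  qed
  also have "\<dots> = real (card A) * ln (real n)" by simp
  finally have 1: "psi n - theta n \<le> real (card A) * ln (real n)" .
  define r l where "r = nat \<lfloor>sqrt (real n)\<rfloor>" and "l = nat \<lfloor>ln (real n) / ln 2\<rfloor>"
  have "A \<subseteq> (\<lambda>(p,k). p ^ k) ` ({..r} \<times> {..l})"
  proof
    fix q assume q: "q \<in> A"
    then obtain p k where pk: "prime p" "k > 0" "q = p ^ k" by (auto simp: A_def primepow_def)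
    have p2: "p \<ge> 2" using pk(1) by (rule prime_ge_2_nat)
    have k2: "k \<ge> 2"
    proof (rule ccontr)
      assume "\<not> k \<ge> 2"
      hence "k = 1" using pk by simp
      thus False using q pk by (simp add: A_def)
    qed
    have le: "p ^ k \<le> n" using q pk by (simp add: A_def)
    have "p ^ 2 \<le> p ^ k" using k2 p2 by (intro power_increasing) auto
    with le have "p ^ 2 \<le> n" by simp
    hence "real p ^ 2 \<le> real n" by (metis of_nat_le_iff of_nat_power)
    hence "real p \<le> sqrt (real n)" by (rule real_le_rsqrt)
    hence "p \<le> r" unfolding r_def by linarith
    moreover have "k \<le> l"
    proof -
      have "2 ^ k \<le> p ^ k" using p2 by (intro power_mono) auto
      with le have "2 ^ k \<le> n" by linarith
      hence "(2::real) ^ k \<le> real n" by (metis of_nat_le_iff of_nat_power of_nat_numeral)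
      hence "ln ((2::real) ^ k) \<le> ln (real n)" using n by (subst ln_le_cancel_iff) auto
      hence "real k \<le> ln (real n) / ln 2" by (simp add: ln_realpow field_simps)
      thus ?thesis unfolding l_def by linarith
    qed
    ultimately show "q \<in> (\<lambda>(p,k). p ^ k) ` ({..r} \<times> {..l})" using pk by force
  qed
  hence "card A \<le> card ({..r} \<times> {..l})" by (intro surj_card_le) auto
  hence 2: "real (card A) \<le> (real r + 1) * (real l + 1)"
    by (simp add: card_cartesian_product algebra_simps flip: of_nat_le_iff[where ?'a=real])
  define y where "y = real n powr (1/8)"
  have y1: "y \<ge> 1" using n by (simp add: y_def ge_one_powr_ge_zero)
  have ln0: "ln (real n) \<ge> 0" using n by simp
  have lny: "ln (real n) \<le> 8 * y" using ln_powr_bound[of "real n" "1/8"] n by (simp add: y_def)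
  have sq: "sqrt (real n) = y ^ 4" using n
    by (simp add: y_def powr_half_sqrt[symmetric] powr_powr flip: powr_realpow)
  have "real r \<le> y ^ 4" unfolding r_def sq[symmetric] by simp
  hence 3: "real r + 1 \<le> 2 * y ^ 4" using one_le_power[OF y1, of 4] by simp
  have "real l \<le> ln (real n) / ln 2" unfolding l_def using ln0 by simp
  also have "\<dots> \<le> ln (real n) / (1/2)" using ln2_ge_two_thirds ln0 by (intro divide_left_mono) auto
  finally have 4: "real l + 1 \<le> 17 * y" using lny y1 by simp
  have "real (card A) * ln (real n) \<le> (2 * y ^ 4 * (17 * y)) * (8 * y)"
    using 2 3 4 lny ln0 y1 by (intro mult_mono order.trans[OF 2] mult_mono 3 4) auto
  also have "\<dots> = 272 * y ^ 6" by (simp add: power_numeral_reduce)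
  also have "y ^ 6 = real n powr (3/4)" using n by (simp add: y_def powr_powr flip: powr_realpow)
  finally show ?thesis using 1 powr_ge_zero[of "real n" "3/4"] by linarith
qed

section \<open>Dirichlet series in the half-plane of absolute convergence\<close>

text \<open>
  Weierstrass: a series of holomorphic functions with a summable majorant near each point can be
  differentiated term by term.
\<close>

lemma holomorphic_suminf:
  fixes f :: "nat \<Rightarrow> complex \<Rightarrow> complex"
  assumes S: "open S" and hol: "\<And>n. f n holomorphic_on S"
    and bd: "\<And>z. z \<in> S \<Longrightarrow> \<exists>d>0. \<exists>M. summable M \<and> (\<forall>n. \<forall>w\<in>ball z d \<inter> S. norm (f n w) \<le> M n)"
  shows "(\<lambda>z. \<Sum>n. f n z) holomorphic_on S"
    and "z \<in> S \<Longrightarrow> (\<lambda>n. f n z) sums (\<Sum>n. f n z)"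
    and "z \<in> S \<Longrightarrow> ((\<lambda>z. \<Sum>n. f n z) has_field_derivative (\<Sum>n. deriv (f n) z)) (at z)"
proof -
  have "\<exists>g g'. \<forall>x \<in> S. ((\<lambda>n. f n x) sums g x) \<and> ((\<lambda>n. deriv (f n) x) sums g' x) \<and>
          (g has_field_derivative g' x) (at x)"
  proof (rule series_and_derivative_comparison_local[OF S])
    show "\<And>n x. x \<in> S \<Longrightarrow> (f n has_field_derivative deriv (f n) x) (at x)"
      using hol S by (meson holomorphic_derivI)
    show "\<exists>d h. 0 < d \<and> summable h \<and> (\<forall>\<^sub>F n in sequentially. \<forall>y\<in>ball x d \<inter> S. norm (f n y) \<le> h n)"
      if "x \<in> S" for x
    proof -
      from bd[OF that] obtain d M where "d > 0" "summable M" "\<forall>n. \<forall>w\<in>ball x d \<inter> S. norm (f n w) \<le> M n"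
        by blast
      thus ?thesis by (intro exI[of _ d] exI[of _ M]) auto
    qed
  qed
  then obtain g g' where g: "\<And>x. x \<in> S \<Longrightarrow> (\<lambda>n. f n x) sums g x"
    "\<And>x. x \<in> S \<Longrightarrow> (\<lambda>n. deriv (f n) x) sums g' x"
    "\<And>x. x \<in> S \<Longrightarrow> (g has_field_derivative g' x) (at x)" by metis
  have eq: "(\<Sum>n. f n x) = g x" "(\<Sum>n. deriv (f n) x) = g' x" if "x \<in> S" for x
    using g that by (simp_all add: sums_iff)
  have D: "((\<lambda>z. \<Sum>n. f n z) has_field_derivative (\<Sum>n. deriv (f n) z)) (at z)" if "z \<in> S" for z
    unfolding eq[OF that]
    by (rule has_field_derivative_transform_within_open[OF g(3)[OF that] S that]) (simp add: eq)
  show "(\<lambda>z. \<Sum>n. f n z) holomorphic_on S"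
    using D S by (auto simp: holomorphic_on_open)
  show "z \<in> S \<Longrightarrow> (\<lambda>n. f n z) sums (\<Sum>n. f n z)" using g eq by metis
  show "z \<in> S \<Longrightarrow> ((\<lambda>z. \<Sum>n. f n z) has_field_derivative (\<Sum>n. deriv (f n) z)) (at z)"
    by (rule D)
qed

text \<open>
  The monomial \<open>n\<close> to the power \<open>-s\<close>, which is entire in \<open>s\<close>. As \<open>ln 0 = 0\<close>, it equals
  \<open>1\<close> for \<open>n = 0\<close>; coefficient sequences of Dirichlet series therefore vanish at \<open>0\<close>.
\<close>

definition npow :: "nat \<Rightarrow> complex \<Rightarrow> complex" where
  "npow n s = exp (- s * of_real (ln (real n)))"

lemma norm_npow: "n > 0 \<Longrightarrow> norm (npow n s) = real n powr (- Re s)"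
  by (simp add: npow_def powr_def)

lemma npow_add: "npow n (s + t) = npow n s * npow n t"
  by (simp add: npow_def exp_add [symmetric] algebra_simps)

lemma npow_mult: "m > 0 \<Longrightarrow> n > 0 \<Longrightarrow> npow (m * n) s = npow m s * npow n s"
  by (simp add: npow_def exp_add [symmetric] ln_mult algebra_simps)

lemma npow_1 [simp]: "npow (Suc 0) s = 1" by (simp add: npow_def)

lemma npow_of_real: "n > 0 \<Longrightarrow> npow n (of_real x) = of_real (real n powr (- x))"
  by (simp add: npow_def powr_def exp_of_real [symmetric])

lemma npow_neg_1: "n > 0 \<Longrightarrow> npow n (-1) = of_nat n"
  using npow_of_real[of n "-1"] by simp

lemma has_field_derivative_npow:
  "(npow n has_field_derivative (- of_real (ln (real n)) * npow n s)) (at s)"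
  unfolding npow_def by (auto intro!: derivative_eq_intros)

lemma holomorphic_on_npow [holomorphic_intros]:
  "f holomorphic_on A \<Longrightarrow> (\<lambda>s. npow n (f s)) holomorphic_on A"
  unfolding npow_def by (intro holomorphic_intros)

definition dirichlet :: "(nat \<Rightarrow> real) \<Rightarrow> complex \<Rightarrow> complex" where
  "dirichlet c s = (\<Sum>n. of_real (c n) * npow n s)"

definition dirichlet_summable :: "(nat \<Rightarrow> real) \<Rightarrow> bool" where
  "dirichlet_summable c \<longleftrightarrow> c 0 = 0 \<and> (\<forall>\<sigma>>1. summable (\<lambda>n. \<bar>c n\<bar> * real n powr - \<sigma>))"

lemma dirichlet_summableD: "dirichlet_summable c \<Longrightarrow> \<sigma> > 1 \<Longrightarrow> summable (\<lambda>n. \<bar>c n\<bar> * real n powr - \<sigma>)"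
  by (simp add: dirichlet_summable_def)

lemma dirichlet_summable_norm_summable:
  assumes "dirichlet_summable c" "Re s > 1"
  shows "summable (\<lambda>n. norm (of_real (c n) * npow n s))"
proof -
  have "norm (of_real (c n) * npow n s) = \<bar>c n\<bar> * real n powr - Re s" for n
    using assms(1) by (cases "n = 0") (auto simp: dirichlet_summable_def norm_mult norm_npow)
  thus ?thesis using assms by (simp add: dirichlet_summable_def)
qed

lemma dirichlet_sums:
  assumes "dirichlet_summable c" "Re s > 1"
  shows "(\<lambda>n. of_real (c n) * npow n s) sums dirichlet c s"
  unfolding dirichlet_def by (rule summable_sums, rule summable_norm_cancel, rule dirichlet_summable_norm_summable[OF assms])

lemma dirichlet_summable_comparison:
  assumes "dirichlet_summable d" "\<And>n. \<bar>c n\<bar> \<le> \<bar>d n\<bar>"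
  shows "dirichlet_summable c"
proof -
  have "summable (\<lambda>n. \<bar>c n\<bar> * real n powr - \<sigma>)" if "\<sigma> > 1" for \<sigma>
    by (rule summable_comparison_test'[where N=0 and g="\<lambda>n. \<bar>d n\<bar> * real n powr - \<sigma>"])
       (use assms that in \<open>auto simp: dirichlet_summable_def abs_mult intro!: mult_right_mono\<close>)
  thus ?thesis using assms(1) assms(2)[of 0] by (auto simp: dirichlet_summable_def)
qed

lemma dirichlet_summable_mult_ln:
  assumes "dirichlet_summable c" shows "dirichlet_summable (\<lambda>n. c n * ln (real n))"
proof -
  have "summable (\<lambda>n. \<bar>c n * ln (real n)\<bar> * real n powr - \<sigma>)" if "\<sigma> > 1" for \<sigma>
  proof (rule summable_comparison_test'[where N=0])
    define e where "e = (\<sigma> - 1) / 2"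
    have e: "e > 0" using that by (simp add: e_def)
    show "summable (\<lambda>n. inverse e * (\<bar>c n\<bar> * real n powr - (1 + e)))"
      by (intro summable_mult dirichlet_summableD assms) (use e in simp)
    fix n :: nat
    show "norm (\<bar>c n * ln (real n)\<bar> * real n powr - \<sigma>) \<le> inverse e * (\<bar>c n\<bar> * real n powr - (1 + e))"
    proof (cases "n = 0")
      case False
      have "ln (real n) \<le> real n powr e / e" using ln_powr_bound[of "real n" e] e False by simp
      moreover have "ln (real n) \<ge> 0" using False by simp
      ultimately have "\<bar>c n * ln (real n)\<bar> * real n powr - \<sigma> \<le> \<bar>c n\<bar> * (real n powr e / e) * real n powr - \<sigma>"
        unfolding abs_mult by (intro mult_right_mono mult_left_mono) auto
      also have "\<dots> = inverse e * (\<bar>c n\<bar> * (real n powr e * real n powr - \<sigma>))"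
        by (simp add: field_simps)
      also have "real n powr e * real n powr - \<sigma> = real n powr (- (1 + e))"
        unfolding powr_add[symmetric]
        by (rule arg_cong[where f="\<lambda>t. real n powr t"]) (simp add: e_def field_simps)
      finally show ?thesis by (simp add: abs_mult)
    qed (use assms in \<open>simp add: dirichlet_summable_def\<close>)
  qed
  thus ?thesis using assms by (simp add: dirichlet_summable_def)
qed

lemma dirichlet_deriv:
  assumes c: "dirichlet_summable c" and s: "Re s > 1"
  shows "(dirichlet c has_field_derivative - dirichlet (\<lambda>n. c n * ln (real n)) s) (at s)"
proof -
  define S where "S = {s. Re s > 1}"
  have op: "open S" unfolding S_def by (rule open_halfspace_Re_gt)
  have "((\<lambda>z. \<Sum>n. of_real (c n) * npow n z) has_field_derivative
      (\<Sum>n. deriv (\<lambda>z. of_real (c n) * npow n z) s)) (at s)"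
  proof (rule holomorphic_suminf(3)[OF op])
    show "(\<lambda>z. of_real (c n) * npow n z) holomorphic_on S" for n by (intro holomorphic_intros)
    show "s \<in> S" using s by (simp add: S_def)
    fix z assume "z \<in> S"
    define d where "d = (Re z - 1) / 2"
    have d: "d > 0" using \<open>z \<in> S\<close> by (simp add: d_def S_def)
    have "norm (of_real (c n) * npow n w) \<le> \<bar>c n\<bar> * real n powr - (1 + d)" if "w \<in> ball z d" for n w
    proof (cases "n = 0")
      case False
      have "\<bar>Re (z - w)\<bar> \<le> norm (z - w)" by (rule abs_Re_le_cmod)
      hence "Re w \<ge> 1 + d" using that by (auto simp: dist_norm d_def field_simps)
      hence "real n powr - Re w \<le> real n powr - (1 + d)" using False by (intro powr_mono) auto
      thus ?thesis using False by (simp add: norm_mult norm_npow mult_left_mono)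
    qed (use c in \<open>simp add: dirichlet_summable_def\<close>)
    moreover have "summable (\<lambda>n. \<bar>c n\<bar> * real n powr - (1 + d))" by (rule dirichlet_summableD[OF c]) (use d in simp)
    ultimately show "\<exists>d>0. \<exists>M. summable M \<and> (\<forall>n. \<forall>w\<in>ball z d \<inter> S. norm (of_real (c n) * npow n w) \<le> M n)"
      using d by blast
  qed
  moreover have "(\<Sum>n. deriv (\<lambda>z. of_real (c n) * npow n z) s) = - dirichlet (\<lambda>n. c n * ln (real n)) s"
  proof -
    have "deriv (\<lambda>z. of_real (c n) * npow n z) s = - (of_real (c n * ln (real n)) * npow n s)" for n
      by (rule DERIV_imp_deriv, rule DERIV_cong[OF DERIV_cmult[OF has_field_derivative_npow]]) simp
    moreover have "(\<lambda>n. of_real (c n * ln (real n)) * npow n s) sums dirichlet (\<lambda>n. c n * ln (real n)) s"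
      by (rule dirichlet_sums[OF dirichlet_summable_mult_ln[OF c] s])
    ultimately show ?thesis using sums_minus[of "\<lambda>n. of_real (c n * ln (real n)) * npow n s"]
      by (simp add: sums_iff)
  qed
  ultimately show ?thesis unfolding dirichlet_def by simp
qed

text \<open>
  The double series of the product is absolutely summable, and collecting the pairs \<open>(a, b)\<close> with
  \<open>a * b = n\<close> gives the coefficient of the \<open>n\<close>-th monomial.
\<close>

lemma dirichlet_mult:
  assumes f: "dirichlet_summable f" and g: "dirichlet_summable g" and h: "dirichlet_summable h" and s: "Re s > 1"
    and conv: "\<And>n. n > 0 \<Longrightarrow> (\<Sum>d | d dvd n. f d * g (n div d)) = h n"
  shows "dirichlet f s * dirichlet g s = dirichlet h s"
proof -
  define P where "P = {0::nat<..}"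
  define F where "F = (\<lambda>n. of_real (f n) * npow n s)"
  define G where "G = (\<lambda>n. of_real (g n) * npow n s)"
  have hs: "((\<lambda>n. of_real (c n) * npow n s) has_sum dirichlet c s) P" if "dirichlet_summable c" for c
  proof -
    have "((\<lambda>n. of_real (c n) * npow n s) has_sum dirichlet c s) UNIV"
      by (rule norm_summable_imp_has_sum[OF dirichlet_summable_norm_summable[OF that s] dirichlet_sums[OF that s]])
    thus ?thesis
      by (subst has_sum_cong_neutral[where T=UNIV]) (use that in \<open>auto simp: P_def dirichlet_summable_def\<close>)
  qed
  have ns: "(\<lambda>n. norm (of_real (c n) * npow n s)) summable_on P" if "dirichlet_summable c" for c
    using norm_summable_imp_summable_on[of "\<lambda>n. norm (of_real (c n) * npow n s)"]
      dirichlet_summable_norm_summable[OF that s]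
    by (auto intro: summable_on_subset_banach)
  have F: "(F has_sum dirichlet f s) P" "(\<lambda>n. norm (F n)) summable_on P"
    unfolding F_def using hs ns f by blast+
  have G: "(G has_sum dirichlet g s) P" "(\<lambda>n. norm (G n)) summable_on P"
    unfolding G_def using hs ns g by blast+
  have "(\<lambda>x. norm ((\<lambda>(a,b). F a * G b) x)) summable_on P \<times> P"
  proof (rule summable_on_SigmaI)
    fix a assume "a \<in> P"
    show "((\<lambda>b. norm ((\<lambda>(a,b). F a * G b) (a,b))) has_sum (norm (F a) * infsum (\<lambda>b. norm (G b)) P)) P"
      by (simp add: norm_mult) (intro has_sum_cmult_right has_sum_infsum G)
  next
    show "(\<lambda>a. norm (F a) * infsum (\<lambda>b. norm (G b)) P) summable_on P"
      by (intro summable_on_cmult_left F)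
  qed auto
  hence "(\<lambda>(a,b). F a * G b) summable_on P \<times> P" by (rule abs_summable_summable)
  then obtain T where T: "((\<lambda>(a,b). F a * G b) has_sum T) (P \<times> P)"
    by (auto simp: summable_on_def)
  have "((\<lambda>a. F a * dirichlet g s) has_sum T) P"
    by (rule has_sum_SigmaD[OF T]) (auto intro!: has_sum_cmult_right G)
  moreover have "((\<lambda>a. F a * dirichlet g s) has_sum dirichlet f s * dirichlet g s) P"
    by (intro has_sum_cmult_left F)
  ultimately have TT: "T = dirichlet f s * dirichlet g s" by (rule has_sum_unique)
  have "((\<lambda>(n,d). F d * G (n div d)) has_sum T) (SIGMA n:P. {d. d dvd n})
     \<longleftrightarrow> ((\<lambda>(a,b). F a * G b) has_sum T) (P \<times> P)"
    by (rule has_sum_reindex_bij_witness[where i="\<lambda>(a,b). (a * b, a)" and j="\<lambda>(n,d). (d, n div d)"])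
       (auto simp: P_def intro!: Nat.gr0I elim!: dvdE)
  with T have "((\<lambda>(n,d). F d * G (n div d)) has_sum T) (SIGMA n:P. {d. d dvd n})" by simp
  hence "((\<lambda>n. of_real (h n) * npow n s) has_sum T) P"
  proof (rule has_sum_SigmaD)
    fix n assume n: "n \<in> P"
    hence fin: "finite {d. d dvd n}" by (simp add: P_def)
    have "(\<Sum>d | d dvd n. F d * G (n div d)) = (\<Sum>d | d dvd n. of_real (f d * g (n div d)) * npow n s)"
    proof (rule sum.cong[OF refl])
      fix d assume "d \<in> {d. d dvd n}"
      then obtain k where k: "n = d * k" "d > 0" "k > 0" using n by (auto simp: P_def elim!: dvdE)
      thus "F d * G (n div d) = of_real (f d * g (n div d)) * npow n s"
        by (simp add: F_def G_def npow_mult)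
    qed
    also have "\<dots> = of_real (h n) * npow n s"
      using conv[of n] n by (simp add: P_def sum_distrib_right [symmetric] flip: of_real_sum of_real_mult)
    finally show "((\<lambda>y. case (n, y) of (n, d) \<Rightarrow> F d * G (n div d)) has_sum of_real (h n) * npow n s) {d. d dvd n}"
      using has_sum_finite[OF fin, of "\<lambda>d. F d * G (n div d)"] by simp
  qed
  with hs[OF h] TT show ?thesis by (metis has_sum_unique)
qed

definition zeta_coeff :: "nat \<Rightarrow> real" where "zeta_coeff n = of_bool (n > 0)"

lemma dirichlet_summable_zeta_coeff: "dirichlet_summable zeta_coeff"
proof -
  have "summable (\<lambda>n. \<bar>zeta_coeff n\<bar> * real n powr - \<sigma>)" if "\<sigma> > 1" for \<sigma>
  proof (rule summable_comparison_test'[where N=0])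
    show "summable (\<lambda>n. real n powr - \<sigma>)" using that by (simp add: summable_real_powr_iff)
  qed (auto simp: zeta_coeff_def)
  thus ?thesis by (simp add: dirichlet_summable_def zeta_coeff_def)
qed

lemma dirichlet_summable_ln: "dirichlet_summable (\<lambda>n. ln (real n))"
  by (rule dirichlet_summable_comparison[OF dirichlet_summable_mult_ln[OF dirichlet_summable_zeta_coeff]]) (auto simp: zeta_coeff_def)

lemma dirichlet_summable_mangoldt: "dirichlet_summable mangoldt"
proof (rule dirichlet_summable_comparison[OF dirichlet_summable_ln])
  show "\<bar>mangoldt n\<bar> \<le> \<bar>ln (real n)\<bar>" for n
    using mangoldt_le[of n] mangoldt_nonneg[of n] by (cases "n = 0") auto
qed

text \<open>
  The coefficients of \<open>ln \<zeta>\<close>. For \<open>n = 1\<close> the quotient is \<open>0 / 0 = 0\<close>, as it should be.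
\<close>

definition log_zeta_coeff :: "nat \<Rightarrow> real" where "log_zeta_coeff n = mangoldt n / ln (real n)"

lemma log_zeta_coeff_nonneg: "log_zeta_coeff n \<ge> 0"
  by (cases "n = 0") (auto simp: log_zeta_coeff_def mangoldt_nonneg)

lemma dirichlet_summable_log_zeta_coeff: "dirichlet_summable log_zeta_coeff"
proof (rule dirichlet_summable_comparison[OF dirichlet_summable_zeta_coeff])
  show "\<bar>log_zeta_coeff n\<bar> \<le> \<bar>zeta_coeff n\<bar>" for n
    using mangoldt_le[of n] mangoldt_nonneg[of n]
    by (cases "n = 0") (auto simp: log_zeta_coeff_def zeta_coeff_def divide_le_eq)
qed

lemma log_zeta_coeff_ln: "log_zeta_coeff n * ln (real n) = mangoldt n"
  by (cases "n \<le> 1") (auto simp: log_zeta_coeff_def le_Suc_eq)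

definition zeta :: "complex \<Rightarrow> complex" where "zeta = dirichlet zeta_coeff"

text \<open>
  The identity \<open>- \<zeta>' = \<zeta> * (\<Sum>n. mangoldt n * npow n s)\<close>, which restates
  \<open>(\<Sum>d | d dvd n. mangoldt d) = ln n\<close> for Dirichlet series.
\<close>

lemma zeta_has_derivative:
  assumes s: "Re s > 1"
  shows "(zeta has_field_derivative - (dirichlet mangoldt s * zeta s)) (at s)"
proof -
  have "dirichlet mangoldt s * dirichlet zeta_coeff s = dirichlet (\<lambda>n. ln (real n)) s"
  proof (rule dirichlet_mult[OF dirichlet_summable_mangoldt dirichlet_summable_zeta_coeff dirichlet_summable_ln s])
    fix n :: nat assume n: "n > 0"
    have "(\<Sum>d | d dvd n. mangoldt d * zeta_coeff (n div d)) = (\<Sum>d | d dvd n. mangoldt d)"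
      by (rule sum.cong) (use n in \<open>auto simp: zeta_coeff_def elim!: dvdE\<close>)
    thus "(\<Sum>d | d dvd n. mangoldt d * zeta_coeff (n div d)) = ln (real n)"
      using mangoldt_sum[of n, where ?'a = real] n by simp
  qed
  moreover have "(\<lambda>n. zeta_coeff n * ln (real n)) = (\<lambda>n. ln (real n))"
    by (auto simp: zeta_coeff_def fun_eq_iff)
  ultimately show ?thesis using dirichlet_deriv[OF dirichlet_summable_zeta_coeff s] by (simp add: zeta_def)
qed

text \<open>
  Both sides solve the differential equation \<open>f' = - dirichlet mangoldt * f\<close> on a half-plane, so
  they differ by a constant factor. This makes the zeta function nonzero there and gives its
  logarithm nonnegative coefficients, the two facts otherwise read off from the Euler product.
\<close>

lemma zeta_eq_exp:
  obtains C where "C \<noteq> 0" "\<And>s. Re s > 1 \<Longrightarrow> zeta s = C * exp (dirichlet log_zeta_coeff s)"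
proof -
  define S where "S = {s. Re s > 1}"
  have op: "open S" "convex S" unfolding S_def by (auto simp: open_halfspace_Re_gt convex_halfspace_Re_gt)
  have D: "(dirichlet log_zeta_coeff has_field_derivative - dirichlet mangoldt s) (at s)" if "Re s > 1" for s
    using dirichlet_deriv[OF dirichlet_summable_log_zeta_coeff that] by (simp add: log_zeta_coeff_ln)
  have "\<exists>c. \<forall>s\<in>S. zeta s * exp (- dirichlet log_zeta_coeff s) = c"
  proof (rule has_field_derivative_zero_constant[OF op(2)])
    fix s assume s: "s \<in> S"
    have "((\<lambda>s. zeta s * exp (- dirichlet log_zeta_coeff s)) has_field_derivative 0) (at s)"
      using s by (auto intro!: derivative_eq_intros zeta_has_derivative D simp: S_def algebra_simps)
    thus "((\<lambda>s. zeta s * exp (- dirichlet log_zeta_coeff s)) has_field_derivative 0) (at s within S)"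
      by (rule has_field_derivative_at_within)
  qed
  then obtain C where C: "\<And>s. Re s > 1 \<Longrightarrow> zeta s * exp (- dirichlet log_zeta_coeff s) = C" by (auto simp: S_def)
  have eq: "zeta s = C * exp (dirichlet log_zeta_coeff s)" if "Re s > 1" for s
    using C[OF that] by (simp add: exp_minus field_simps)
  have "Re (zeta 2) \<ge> 1"
  proof -
    have s: "(\<lambda>n. Re (of_real (zeta_coeff n) * npow n 2)) sums Re (zeta 2)"
      unfolding zeta_def by (rule sums_Re, rule dirichlet_sums[OF dirichlet_summable_zeta_coeff]) simp
    have e: "Re (of_real (zeta_coeff n) * npow n 2) = zeta_coeff n * real n powr - 2" for n
      using npow_of_real[of n 2] by (cases "n = 0") (auto simp: zeta_coeff_def)
    have "(\<Sum>n\<in>{1}. zeta_coeff n * real n powr - 2) \<le> Re (zeta 2)"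
      using s sum_le_suminf[of "\<lambda>n. zeta_coeff n * real n powr - 2" "{1}"]
      unfolding e sums_iff by (auto simp: zeta_coeff_def)
    thus ?thesis by (simp add: zeta_coeff_def)
  qed
  hence "C \<noteq> 0" using eq[of 2] by auto
  thus ?thesis using that eq by blast
qed

section \<open>Continuation of the zeta function\<close>

text \<open>
  The error of the first order Taylor expansion of \<open>x \<mapsto> x powr (-w)\<close> at \<open>n\<close>, evaluated at
  \<open>n + 1\<close>. It is smaller than the terms of the series by two powers of \<open>n\<close>, which is how series
  are continued across the line \<open>Re s = 1\<close> below.
\<close>

definition taylor_gap :: "nat \<Rightarrow> complex \<Rightarrow> complex" where
  "taylor_gap n w = w * npow n (w + 1) - npow n w + npow (Suc n) w"

lemma holomorphic_on_taylor_gap [holomorphic_intros]: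
  "f holomorphic_on A \<Longrightarrow> (\<lambda>s. taylor_gap n (f s)) holomorphic_on A"
  unfolding taylor_gap_def by (intro holomorphic_intros)

lemma norm_taylor_gap_le:
  assumes n: "n > 0" and w: "Re w \<ge> -2"
  shows "norm (taylor_gap n w) \<le> norm w * norm (w + 1) * real n powr - (Re w + 2)"
proof -
  define S where "S = complex_of_real ` {real n..real (Suc n)}"
  define f where "f = (\<lambda>i::nat. \<lambda>x. if i = 0 then exp (- w * Ln x) else if i = 1 then - w * exp (- (w + 1) * Ln x)
      else w * (w + 1) * exp (- (w + 2) * Ln x))"
  define B where "B = norm w * norm (w + 1) * real n powr - (Re w + 2)"
  have npf: "npow k v = exp (- v * Ln (of_nat k))" if "k > 0" for k v
    using that by (simp add: npow_def Ln_of_nat)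
  have "cmod (f 0 (of_nat (Suc n)) - (\<Sum>i\<le>1. f i (of_nat n) * (of_nat (Suc n) - of_nat n)^i / fact i))
     \<le> B * cmod (of_nat (Suc n) - of_nat n) ^ (Suc 1) / fact 1"
  proof (rule complex_Taylor[where S=S])
    show "convex S" unfolding S_def
      by (intro convex_linear_image bounded_linear.linear[OF bounded_linear_of_real]) simp
    show "complex_of_nat n \<in> S" unfolding S_def by (rule image_eqI[where x="real n"]) auto
    show "complex_of_nat (Suc n) \<in> S" unfolding S_def by (rule image_eqI[where x="real (Suc n)"]) auto
  next
    fix i :: nat and x assume x: "x \<in> S" and i: "i \<le> 1"
    from x obtain t where t: "x = of_real t" "t \<ge> n" unfolding S_def by auto
    have t0: "t > 0" using t n by linarith
    have xn: "x \<notin> \<real>\<^sub>\<le>\<^sub>0" using t t0 by simp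
    have x0: "x \<noteq> 0" using t t0 by simp
    have inv: "exp (- Ln x) = inverse x" using x0 by (simp add: exp_minus)
    have D: "((\<lambda>x. exp (- v * Ln x)) has_field_derivative - v * exp (- (v + 1) * Ln x)) (at x within S)" for v
    proof -
      have "((\<lambda>x. exp (- v * Ln x)) has_field_derivative exp (- v * Ln x) * (- v * inverse x)) (at x within S)"
        using xn by (auto intro!: derivative_eq_intros simp: field_simps)
      also have "exp (- v * Ln x) * (- v * inverse x) = - v * exp (- (v + 1) * Ln x)"
        unfolding inv[symmetric] by (simp add: exp_add[symmetric] algebra_simps)
      finally show ?thesis .
    qed
    consider "i = 0" | "i = 1" using i by linarith
    thus "(f i has_field_derivative f (Suc i) x) (at x within S)"
    proof cases
      case 1 thus ?thesis using D[of w] by (simp add: f_def)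
    next
      case 2
      have "((\<lambda>x. - w * exp (- (w + 1) * Ln x)) has_field_derivative
        - w * (- (w + 1) * exp (- (w + 1 + 1) * Ln x))) (at x within S)"
        by (rule DERIV_cmult[OF D])
      also have "- w * (- (w + 1) * exp (- (w + 1 + 1) * Ln x)) = w * (w + 1) * exp (- (w + 2) * Ln x)"
        by (simp add: algebra_simps)
      finally show ?thesis using 2 by (simp add: f_def)
    qed
  next
    fix x assume x: "x \<in> S"
    from x obtain t where t: "x = of_real t" "t \<ge> n" unfolding S_def by auto
    have t0: "t > 0" using t n by linarith
    have "norm (exp (- (w + 2) * Ln x)) = t powr - (Re w + 2)"
      using t t0 by (simp add: Ln_of_real powr_def)
    also have "\<dots> \<le> real n powr - (Re w + 2)"
      using t n w by (intro powr_mono2') auto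
    finally show "cmod (f (Suc 1) x) \<le> B"
      by (simp add: f_def B_def norm_mult mult_left_mono)
  qed
  also have "f 0 (of_nat (Suc n)) - (\<Sum>i\<le>1. f i (of_nat n) * (of_nat (Suc n) - of_nat n)^i / fact i) = taylor_gap n w"
    using n by (simp add: f_def taylor_gap_def npf del: of_nat_Suc) (simp add: algebra_simps)
  finally show ?thesis by (simp add: B_def)
qed

definition gap_sum :: "(nat \<Rightarrow> real) \<Rightarrow> complex \<Rightarrow> complex" where
  "gap_sum b w = (\<Sum>n. of_real (b (Suc n)) * taylor_gap (Suc n) w)"

definition zeta32 :: real where "zeta32 = (\<Sum>n. real (Suc n) powr - (3/2))"

lemma zeta32_summable: "summable (\<lambda>n. real (Suc n) powr - (3/2))"
  using summable_real_powr_iff[of "-3/2"] by (subst summable_Suc_iff[of "\<lambda>n. real n powr - (3/2)"]) simp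

lemma zeta32_nonneg: "zeta32 \<ge> 0" unfolding zeta32_def by (intro suminf_nonneg zeta32_summable) auto

text \<open>
  By the bound for the Taylor error, the series has the majorant
  \<open>B * \<bar>w\<bar> * \<bar>w + 1\<bar> * n powr (-3/2)\<close> in the stated half-plane.
\<close>

lemma gap_sum_props:
  assumes b: "\<And>n. n > 0 \<Longrightarrow> \<bar>b n\<bar> \<le> B * real n powr k" and k: "k \<ge> 0"
  shows "gap_sum b holomorphic_on {w. Re w > k - 1/2}"
    and "Re w > k - 1/2 \<Longrightarrow> (\<lambda>n. of_real (b (Suc n)) * taylor_gap (Suc n) w) sums gap_sum b w"
    and "Re w > k - 1/2 \<Longrightarrow> norm (gap_sum b w) \<le> B * zeta32 * norm w * norm (w + 1)"
proof -
  have B: "B \<ge> 0" using b[of 1] by (auto intro: order_trans[OF abs_ge_zero])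
  define S where "S = {w. Re w > k - 1/2}"
  have op: "open S" unfolding S_def by (rule open_halfspace_Re_gt)
  have bd: "norm (of_real (b (Suc n)) * taylor_gap (Suc n) w) \<le> B * norm w * norm (w + 1) * real (Suc n) powr - (3/2)"
    if "w \<in> S" for w n
  proof -
    have "norm (of_real (b (Suc n)) * taylor_gap (Suc n) w) \<le> (B * real (Suc n) powr k) *
        (norm w * norm (w + 1) * real (Suc n) powr - (Re w + 2))"
      unfolding norm_mult using that k B
      by (intro mult_mono norm_taylor_gap_le) (use b[of "Suc n"] in \<open>auto simp: S_def simp del: of_nat_Suc\<close>)
    also have "\<dots> = B * norm w * norm (w + 1) * (real (Suc n) powr k * real (Suc n) powr - (Re w + 2))"
      by (simp only: mult_ac)
    also have "real (Suc n) powr k * real (Suc n) powr - (Re w + 2) = real (Suc n) powr (k - (Re w + 2))"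
      unfolding powr_add[symmetric] by (rule arg_cong[where f="\<lambda>t. real (Suc n) powr t"]) simp
    also have "real (Suc n) powr (k - (Re w + 2)) \<le> real (Suc n) powr - (3/2)"
      using that by (intro powr_mono) (auto simp: S_def)
    finally show ?thesis using B by (simp add: mult_left_mono)
  qed
  have L: "\<exists>d>0. \<exists>M. summable M \<and> (\<forall>n. \<forall>w\<in>ball z d \<inter> S. norm (of_real (b (Suc n)) * taylor_gap (Suc n) w) \<le> M n)" for z
  proof (intro exI[of _ 1] exI[of _ "\<lambda>n. B * (norm z + 1) * (norm z + 2) * real (Suc n) powr - (3/2)"] conjI allI ballI)
    fix n w assume w: "w \<in> ball z 1 \<inter> S"
    have 1: "norm w \<le> norm z + 1" using w norm_triangle_ineq2[of w z] by (auto simp: dist_norm norm_minus_commute)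
    moreover have "norm (w + 1) \<le> norm z + 2" using 1 norm_triangle_ineq[of w 1] by simp
    ultimately have "B * norm w * norm (w + 1) \<le> B * (norm z + 1) * (norm z + 2)"
      using B by (intro mult_mono) auto
    thus "norm (of_real (b (Suc n)) * taylor_gap (Suc n) w) \<le> B * (norm z + 1) * (norm z + 2) * real (Suc n) powr - (3/2)"
      using bd[of w n] w by (meson IntD2 order_trans mult_right_mono powr_ge_zero)
  qed (auto intro!: summable_mult zeta32_summable simp del: of_nat_Suc)
  have hol: "\<And>n. (\<lambda>w. of_real (b (Suc n)) * taylor_gap (Suc n) w) holomorphic_on S"
    by (intro holomorphic_intros)
  show "gap_sum b holomorphic_on {w. Re w > k - 1/2}"
    using holomorphic_suminf(1)[OF op hol L] unfolding gap_sum_def S_def .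
  show "Re w > k - 1/2 \<Longrightarrow> (\<lambda>n. of_real (b (Suc n)) * taylor_gap (Suc n) w) sums gap_sum b w"
    using holomorphic_suminf(2)[OF op hol L] unfolding gap_sum_def S_def by simp
  assume w: "Re w > k - 1/2"
  have "norm (gap_sum b w) \<le> (\<Sum>n. B * norm w * norm (w + 1) * real (Suc n) powr - (3/2))"
    unfolding gap_sum_def
    by (rule norm_suminf_le[OF bd]) (use w in \<open>auto simp: S_def simp del: of_nat_Suc intro!: summable_mult zeta32_summable\<close>)
  also have "\<dots> = B * norm w * norm (w + 1) * zeta32"
    unfolding zeta32_def by (rule suminf_mult[OF zeta32_summable])
  finally show "norm (gap_sum b w) \<le> B * zeta32 * norm w * norm (w + 1)" by (simp add: mult_ac)
qed

lemma npow_tendsto_0: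
  assumes "Re w > 0" shows "(\<lambda>n. npow (Suc n) w) \<longlonglongrightarrow> 0"
proof (rule tendsto_norm_zero_cancel)
  have "(\<lambda>n. real (Suc n) powr - Re w) \<longlonglongrightarrow> 0"
    using assms by (intro tendsto_neg_powr filterlim_compose[OF filterlim_real_sequentially filterlim_Suc]) auto
  thus "(\<lambda>n. norm (npow (Suc n) w)) \<longlonglongrightarrow> 0" by (simp add: norm_npow)
qed

text \<open>
  The function \<open>(s - 1) * \<zeta>(s)\<close>, in a form that makes sense for \<open>Re s > 0\<close>.
\<close>

definition zeta_reg :: "complex \<Rightarrow> complex" where "zeta_reg s = 1 + gap_sum (\<lambda>_. 1) (s - 1)"

lemma zeta_sums: "Re s > 1 \<Longrightarrow> (\<lambda>n. npow (Suc n) s) sums zeta s"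
  using dirichlet_sums[OF dirichlet_summable_zeta_coeff, of s] sums_Suc_iff[of "\<lambda>n. of_real (zeta_coeff n) * npow n s" "zeta s"]
  by (simp add: zeta_def zeta_coeff_def)

text \<open>
  In \<open>(s - 1) * \<zeta>(s)\<close> the \<open>n\<close>-th term is the Taylor error at \<open>w = s - 1\<close> plus the
  telescoping term \<open>npow n w - npow (n + 1) w\<close>.
\<close>

lemma zeta_reg_eq: assumes s: "Re s > 1" shows "zeta_reg s = (s - 1) * zeta s"
proof -
  have "(\<lambda>n. npow (Suc n) (s-1) - npow (Suc (Suc n)) (s-1)) sums (npow (Suc 0) (s-1) - 0)"
    by (rule telescope_sums') (use s in \<open>auto intro!: npow_tendsto_0\<close>)
  moreover have "(\<lambda>n. (s - 1) * npow (Suc n) s) sums ((s - 1) * zeta s)"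
    by (intro sums_mult zeta_sums s)
  ultimately have "(\<lambda>n. (s - 1) * npow (Suc n) s - (npow (Suc n) (s-1) - npow (Suc (Suc n)) (s-1)))
     sums ((s - 1) * zeta s - (npow (Suc 0) (s-1) - 0))" by (rule sums_diff[rotated])
  moreover have "(\<lambda>n. of_real 1 * taylor_gap (Suc n) (s - 1)) sums gap_sum (\<lambda>_. 1) (s - 1)"
    by (rule gap_sum_props(2)[where B=1 and k=0]) (use s in auto)
  moreover have "(\<lambda>n. of_real 1 * taylor_gap (Suc n) (s - 1)) = (\<lambda>n. (s - 1) * npow (Suc n) s - (npow (Suc n) (s-1) - npow (Suc (Suc n)) (s-1)))"
    by (auto simp: taylor_gap_def fun_eq_iff)
  ultimately have "gap_sum (\<lambda>_. 1) (s - 1) = (s - 1) * zeta s - 1"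
    using sums_unique2 by fastforce
  thus ?thesis by (simp add: zeta_reg_def)
qed

lemma zeta_reg_holo: "zeta_reg holomorphic_on {s. Re s > 1/2}"
proof -
  have "gap_sum (\<lambda>_. 1) holomorphic_on {w. Re w > 0 - 1/2}"
    by (rule gap_sum_props(1)[where B=1]) auto
  hence "(gap_sum (\<lambda>_. 1) \<circ> (\<lambda>s. s - 1)) holomorphic_on {s. Re s > 1/2}"
    by (intro holomorphic_on_compose_gen[where t="{w. Re w > 0 - 1/2}"]) (auto intro!: holomorphic_intros)
  thus ?thesis unfolding zeta_reg_def[abs_def] by (intro holomorphic_intros) (simp add: o_def)
qed

lemma zeta_reg_1: "zeta_reg 1 = 1" by (simp add: zeta_reg_def gap_sum_def taylor_gap_def npow_def)

lemma norm_zeta_reg_le: "Re s > 1/2 \<Longrightarrow> norm (zeta_reg s) \<le> 1 + zeta32 * norm (s - 1) * norm s"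
  using gap_sum_props(3)[of "\<lambda>_. 1" 1 0 "s - 1"] norm_triangle_ineq[of 1 "gap_sum (\<lambda>_. 1) (s - 1)"]
  by (auto simp: zeta_reg_def)

definition psi_gap_sum :: "complex \<Rightarrow> complex" where "psi_gap_sum = gap_sum psi"

lemma psi_abs_le: "n > 0 \<Longrightarrow> \<bar>psi n\<bar> \<le> 4 * real n powr 1"
  using psi_le[of n] psi_nonneg[of n] by simp

lemma psi_gap_sum_holo: "psi_gap_sum holomorphic_on {s. Re s > 1/2}"
  unfolding psi_gap_sum_def using gap_sum_props(1)[of psi 4 1, OF psi_abs_le] by simp

lemma norm_psi_gap_sum_le: "Re s > 1/2 \<Longrightarrow> norm (psi_gap_sum s) \<le> 4 * zeta32 * norm s * norm (s + 1)"
  unfolding psi_gap_sum_def using gap_sum_props(3)[of psi 4 1, OF psi_abs_le] by simp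

text \<open>
  The coefficients to which Newman's argument is applied. They are bounded by Chebyshev's estimate.
\<close>

definition psi_excess :: "nat \<Rightarrow> real" where "psi_excess n = (psi n - real n) / real n"

lemma psi_excess_bound: "\<bar>psi_excess n\<bar> \<le> 4"
proof (cases "n = 0")
  case False
  thus ?thesis using psi_le[of n] psi_nonneg[of n]
    by (auto simp: psi_excess_def abs_le_iff field_simps)
qed (simp add: psi_excess_def)

text \<open>
  Summation by parts; the boundary term \<open>psi N * npow (N + 1) s\<close> tends to \<open>0\<close> because
  \<open>psi N = O(N)\<close>.
\<close>

lemma mangoldt_abel:
  assumes s: "Re s > 1"
  shows "(\<lambda>n. of_real (psi (Suc n)) * (npow (Suc n) s - npow (Suc (Suc n)) s)) sums dirichlet mangoldt s"
proof -
  have 1: "(\<lambda>n. of_real (mangoldt n) * npow n s) sums dirichlet mangoldt s"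
    by (rule dirichlet_sums[OF dirichlet_summable_mangoldt s])
  have eq: "(\<Sum>n<N. of_real (psi (Suc n)) * (npow (Suc n) s - npow (Suc (Suc n)) s)) =
     (\<Sum>n<Suc N. of_real (mangoldt n) * npow n s) - of_real (psi N) * npow (Suc N) s" for N
    by (induction N) (simp_all add: psi_Suc algebra_simps)
  have "(\<lambda>N. of_real (psi N) * npow (Suc N) s) \<longlonglongrightarrow> 0"
  proof (rule Lim_null_comparison)
    have "(\<lambda>N. 4 * norm (npow (Suc N) (s - 1))) \<longlonglongrightarrow> 4 * norm (0::complex)"
      by (intro tendsto_intros npow_tendsto_0) (use s in simp)
    thus "(\<lambda>N. 4 * norm (npow (Suc N) (s - 1))) \<longlonglongrightarrow> 0" by simp
    show "\<forall>\<^sub>F N in sequentially. norm (of_real (psi N) * npow (Suc N) s) \<le> 4 * norm (npow (Suc N) (s - 1))"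
    proof (rule always_eventually, rule allI)
      fix N
      have "npow (Suc N) (s - 1) = npow (Suc N) s * npow (Suc N) (-1)"
        using npow_add[of "Suc N" s "-1"] by simp
      hence e: "norm (npow (Suc N) (s - 1)) = real (Suc N) * norm (npow (Suc N) s)"
        by (simp add: npow_neg_1 norm_mult del: of_nat_Suc)
      have "psi N \<le> 4 * real (Suc N)" using psi_le[of N] by simp
      hence "psi N * norm (npow (Suc N) s) \<le> 4 * real (Suc N) * norm (npow (Suc N) s)"
        by (intro mult_right_mono) auto
      thus "norm (of_real (psi N) * npow (Suc N) s) \<le> 4 * norm (npow (Suc N) (s - 1))"
        unfolding e by (simp add: norm_mult psi_nonneg algebra_simps)
    qed
  qed
  moreover have "(\<lambda>N. \<Sum>n<Suc N. of_real (mangoldt n) * npow n s) \<longlonglongrightarrow> dirichlet mangoldt s"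
    using 1 unfolding sums_def by (rule LIMSEQ_Suc)
  ultimately show ?thesis unfolding sums_def eq by (auto intro: tendsto_eq_intros)
qed

lemma zeta_nonzero: "Re s > 1 \<Longrightarrow> zeta s \<noteq> 0"
  by (rule zeta_eq_exp) auto

text \<open>
  The difference quotient of \<open>(s - 1) * \<zeta>(s)\<close> at \<open>1\<close>, with its removable singularity filled.
\<close>

definition zeta_quot :: "complex \<Rightarrow> complex" where
  "zeta_quot s = (if s = 1 then deriv zeta_reg 1 else (zeta_reg s - 1) / (s - 1))"

text \<open>
  The continuation of the Dirichlet series with coefficients \<open>psi_excess\<close>. Formally the series is
  \<open>(- \<zeta>' / \<zeta> + psi_gap_sum) / s - \<zeta>\<close>; here \<open>\<zeta>\<close> is expressed by \<open>zeta_reg\<close> and the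
  poles at \<open>1\<close> have been cancelled.
\<close>

definition excess_series :: "complex \<Rightarrow> complex" where
  "excess_series s = - (deriv zeta_reg s / (zeta_reg s * s)) - 1 / s + psi_gap_sum s / s - zeta_quot s"

lemma zeta_quot_holo: "zeta_quot holomorphic_on {s. Re s > 1/2}"
proof -
  have "(\<lambda>z. if z = 1 then deriv zeta_reg 1 else (zeta_reg z - zeta_reg 1) / (z - 1)) holomorphic_on {s. Re s > 1/2}"
    by (rule pole_lemma[OF zeta_reg_holo])
       (simp only: interior_open[OF open_halfspace_Re_gt], simp)
  moreover have "zeta_quot = (\<lambda>z. if z = 1 then deriv zeta_reg 1 else (zeta_reg z - zeta_reg 1) / (z - 1))"
    unfolding zeta_reg_1 by (rule ext) (rule zeta_quot_def)
  ultimately show ?thesis by simp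
qed

lemma excess_series_holo:
  assumes "open U" "\<And>s. s \<in> U \<Longrightarrow> Re s > 1/2 \<and> zeta_reg s \<noteq> 0"
  shows "excess_series holomorphic_on U"
proof -
  have sub: "U \<subseteq> {s. Re s > 1/2}" using assms by auto
  have nz: "s \<noteq> 0" if "s \<in> U" for s using assms(2)[OF that] by auto
  show ?thesis unfolding excess_series_def[abs_def]
    by (intro holomorphic_intros holomorphic_on_subset[OF zeta_reg_holo sub]
      holomorphic_on_subset[OF zeta_quot_holo sub] holomorphic_on_subset[OF psi_gap_sum_holo sub] assms(1))
      (use nz assms in auto)
qed

text \<open>
  Multiplying \<open>\<Sum>n. psi n * npow n (s + 1)\<close> by \<open>s\<close> and subtracting the Taylor errors leaves
  the differences \<open>npow n s - npow (n + 1) s\<close>, which summation by parts turns into the Dirichlet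
  series of \<open>mangoldt\<close>, that is, into \<open>- \<zeta>' / \<zeta>\<close>.
\<close>

lemma excess_series_sums:
  assumes s: "Re s > 1"
  shows "(\<lambda>n. of_real (psi_excess (Suc n)) * npow (Suc n) s) sums excess_series s"
proof -
  define L where "L = dirichlet mangoldt s"
  have s0: "s \<noteq> 0" "s \<noteq> 1" using s by auto
  have "(\<lambda>n. of_real (psi (Suc n)) * taylor_gap (Suc n) s) sums psi_gap_sum s"
    unfolding psi_gap_sum_def using gap_sum_props(2)[of psi 4 1, OF psi_abs_le] s by simp
  from sums_add[OF this mangoldt_abel[OF s]]
  have "(\<lambda>n. s * (of_real (psi (Suc n)) * npow (Suc n) (s + 1))) sums (psi_gap_sum s + L)"
    by (simp add: taylor_gap_def L_def algebra_simps)
  from sums_mult[OF this, of "1/s"] s0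
  have "(\<lambda>n. of_real (psi (Suc n)) * npow (Suc n) (s + 1)) sums ((psi_gap_sum s + L) / s)" by simp
  from sums_diff[OF this zeta_sums[OF s]]
  have "(\<lambda>n. of_real (psi (Suc n)) * npow (Suc n) (s + 1) - npow (Suc n) s) sums ((psi_gap_sum s + L) / s - zeta s)" .
  moreover have "of_real (psi (Suc n)) * npow (Suc n) (s + 1) - npow (Suc n) s = of_real (psi_excess (Suc n)) * npow (Suc n) s" for n
  proof -
    have "npow (Suc n) s = npow (Suc n) (s + 1) * npow (Suc n) (-1)"
      using npow_add[of "Suc n" "s+1" "-1"] by simp
    hence "npow (Suc n) s = npow (Suc n) (s + 1) * of_nat (Suc n)"
      by (simp add: npow_neg_1 del: of_nat_Suc)
    thus ?thesis by (simp add: psi_excess_def field_simps del: of_nat_Suc)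
  qed
  moreover have "(psi_gap_sum s + L) / s - zeta s = excess_series s"
  proof -
    have op: "open {s. Re s > 1}" by (rule open_halfspace_Re_gt)
    have "((\<lambda>s. (s - 1) * zeta s) has_field_derivative (zeta s + (s - 1) * (- (L * zeta s)))) (at s)"
      unfolding L_def by (auto intro!: derivative_eq_intros zeta_has_derivative[OF s])
    hence "(zeta_reg has_field_derivative (zeta s + (s - 1) * (- (L * zeta s)))) (at s)"
      by (rule has_field_derivative_transform_within_open[OF _ op]) (use s in \<open>auto simp: zeta_reg_eq\<close>)
    hence d: "deriv zeta_reg s = zeta s + (s - 1) * (- (L * zeta s))" by (rule DERIV_imp_deriv)
    show ?thesis unfolding excess_series_def d zeta_reg_eq[OF s] zeta_quot_def using s0 zeta_nonzero[OF s]
      by (simp add: divide_simps) (simp add: algebra_simps)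
  qed
  ultimately show ?thesis by simp
qed

section \<open>A quantitative zero-free region\<close>

text \<open>
  In the logarithm of the product each coefficient of \<open>ln \<zeta>\<close> is multiplied by
  \<open>3 + 4 * cos x + cos (2 * x) = 2 * (1 + cos x)\<^sup>2\<close> with \<open>x = t * ln n\<close>.
\<close>

lemma three_four_one:
  obtains C where "C > 0" "\<And>\<sigma> t. \<sigma> > 1 \<Longrightarrow> C \<le> norm (zeta (Complex \<sigma> 0)) ^ 3 * norm (zeta (Complex \<sigma> t)) ^ 4 * norm (zeta (Complex \<sigma> (2 * t)))"
proof -
  obtain C where C: "C \<noteq> 0" "\<And>s. Re s > 1 \<Longrightarrow> zeta s = C * exp (dirichlet log_zeta_coeff s)" using zeta_eq_exp by metis
  have nz: "norm (zeta (Complex \<sigma> t)) = norm C * exp (Re (dirichlet log_zeta_coeff (Complex \<sigma> t)))" if "\<sigma> > 1" for \<sigma> t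
    using C(2)[of "Complex \<sigma> t"] that by (simp add: norm_mult)
  have pos: "3 * Re (dirichlet log_zeta_coeff (Complex \<sigma> 0)) + 4 * Re (dirichlet log_zeta_coeff (Complex \<sigma> t)) + Re (dirichlet log_zeta_coeff (Complex \<sigma> (2 * t))) \<ge> 0"
    if s: "\<sigma> > 1" for \<sigma> t
  proof -
    have S: "(\<lambda>n. log_zeta_coeff n * (exp (- \<sigma> * ln (real n)) * cos (u * ln (real n)))) sums Re (dirichlet log_zeta_coeff (Complex \<sigma> u))" for u
    proof -
      have "(\<lambda>n. Re (of_real (log_zeta_coeff n) * npow n (Complex \<sigma> u))) sums Re (dirichlet log_zeta_coeff (Complex \<sigma> u))"
        by (rule sums_Re, rule dirichlet_sums[OF dirichlet_summable_log_zeta_coeff]) (use s in simp)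
      moreover have "Re (of_real (log_zeta_coeff n) * npow n (Complex \<sigma> u)) = log_zeta_coeff n * (exp (- \<sigma> * ln (real n)) * cos (u * ln (real n)))" for n
        by (simp add: npow_def Re_exp)
      ultimately show ?thesis by (simp only:)
    qed
    have "(\<lambda>n. 3 * (log_zeta_coeff n * (exp (- \<sigma> * ln (real n)) * cos (0 * ln (real n)))) +
        4 * (log_zeta_coeff n * (exp (- \<sigma> * ln (real n)) * cos (t * ln (real n)))) +
        log_zeta_coeff n * (exp (- \<sigma> * ln (real n)) * cos (2 * t * ln (real n)))) sums
        (3 * Re (dirichlet log_zeta_coeff (Complex \<sigma> 0)) + 4 * Re (dirichlet log_zeta_coeff (Complex \<sigma> t)) + Re (dirichlet log_zeta_coeff (Complex \<sigma> (2 * t))))"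
      by (intro sums_add sums_mult S)
    moreover have "3 * (log_zeta_coeff n * (exp (- \<sigma> * ln (real n)) * cos (0 * ln (real n)))) +
        4 * (log_zeta_coeff n * (exp (- \<sigma> * ln (real n)) * cos (t * ln (real n)))) +
        log_zeta_coeff n * (exp (- \<sigma> * ln (real n)) * cos (2 * t * ln (real n))) \<ge> 0" for n
    proof -
      have "cos (2 * t * ln (real n)) = 2 * (cos (t * ln (real n)))\<^sup>2 - 1"
        using cos_double_cos[of "t * ln (real n)"] by (simp add: mult.assoc)
      hence e: "3 * (log_zeta_coeff n * (exp (- \<sigma> * ln (real n)) * cos (0 * ln (real n)))) +
        4 * (log_zeta_coeff n * (exp (- \<sigma> * ln (real n)) * cos (t * ln (real n)))) +
        log_zeta_coeff n * (exp (- \<sigma> * ln (real n)) * cos (2 * t * ln (real n))) =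
        log_zeta_coeff n * exp (- \<sigma> * ln (real n)) * (2 * (1 + cos (t * ln (real n)))\<^sup>2)"
        by (simp only: mult_zero_left cos_zero power2_sum) (simp add: ring_distribs power2_eq_square)
      show ?thesis unfolding e using log_zeta_coeff_nonneg[of n] by simp
    qed
    ultimately show ?thesis by (rule sums_le[OF _ sums_zero, rotated])
  qed
  show ?thesis
  proof
    show "norm C ^ 8 > 0" using C by simp
    fix \<sigma> t :: real assume s: "\<sigma> > 1"
    have "norm (zeta (Complex \<sigma> 0)) ^ 3 * norm (zeta (Complex \<sigma> t)) ^ 4 * norm (zeta (Complex \<sigma> (2 * t)))
      = norm C ^ 8 * exp (3 * Re (dirichlet log_zeta_coeff (Complex \<sigma> 0)) + 4 * Re (dirichlet log_zeta_coeff (Complex \<sigma> t)) + Re (dirichlet log_zeta_coeff (Complex \<sigma> (2 * t))))"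
      unfolding nz[OF s] by (simp add: power_mult_distrib exp_add exp_of_nat_mult[symmetric] power_numeral_reduce flip: exp_of_nat_mult)
        (simp add: power3_eq_cube power4_eq_xxxx exp_add[symmetric])
    also have "\<dots> \<ge> norm C ^ 8 * 1"
      using pos[OF s, of t] by (intro mult_left_mono) auto
    finally show "norm C ^ 8 \<le> norm (zeta (Complex \<sigma> 0)) ^ 3 * norm (zeta (Complex \<sigma> t)) ^ 4 * norm (zeta (Complex \<sigma> (2 * t)))" by simp
  qed
qed

text \<open>
  A common constant for the upper bounds of this section, which are all quadratic in the height
  \<open>R\<close> of the region.
\<close>

definition zeta_reg_const :: real where "zeta_reg_const = 8 * (1 + 288 * zeta32)"

lemma zeta_reg_const_ge_1: "zeta_reg_const \<ge> 1" using zeta32_nonneg by (simp add: zeta_reg_const_def)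

lemma zeta_reg_gap_bounds:
  assumes "R \<ge> 1" "1/2 < Re s" "Re s \<le> 4" "\<bar>Im s\<bar> \<le> 4 * R"
  shows "norm (zeta_reg s) \<le> zeta_reg_const / 8 * R\<^sup>2" "norm (psi_gap_sum s) \<le> zeta_reg_const / 8 * R\<^sup>2"
proof -
  have "norm s \<le> \<bar>Re s\<bar> + \<bar>Im s\<bar>" by (rule cmod_le)
  moreover have "norm (s - 1) \<le> \<bar>Re (s - 1)\<bar> + \<bar>Im (s - 1)\<bar>" by (rule cmod_le)
  moreover have "norm (s + 1) \<le> \<bar>Re (s + 1)\<bar> + \<bar>Im (s + 1)\<bar>" by (rule cmod_le)
  ultimately have ns: "norm s \<le> 8 * R" "norm (s - 1) \<le> 8 * R" "norm (s + 1) \<le> 9 * R"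
    using assms by (auto simp: abs_le_iff)
  have "norm (zeta_reg s) \<le> 1 + zeta32 * norm (s - 1) * norm s" using assms by (intro norm_zeta_reg_le) auto
  also have "\<dots> \<le> R\<^sup>2 + zeta32 * (8 * R) * (8 * R)"
    using ns assms zeta32_nonneg by (intro add_mono mult_mono one_le_power) auto
  also have "\<dots> = (1 + 64 * zeta32) * R\<^sup>2" by (simp add: algebra_simps power2_eq_square)
  also have "\<dots> \<le> zeta_reg_const / 8 * R\<^sup>2" using zeta32_nonneg by (intro mult_right_mono) (auto simp: zeta_reg_const_def)
  finally show "norm (zeta_reg s) \<le> zeta_reg_const / 8 * R\<^sup>2" .
  have "norm (psi_gap_sum s) \<le> 4 * zeta32 * norm s * norm (s + 1)" using assms by (intro norm_psi_gap_sum_le) auto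
  also have "\<dots> \<le> 4 * zeta32 * (8 * R) * (9 * R)"
    using ns assms zeta32_nonneg by (intro mult_mono) auto
  also have "\<dots> = (288 * zeta32) * R\<^sup>2" by (simp add: algebra_simps power2_eq_square)
  also have "\<dots> \<le> zeta_reg_const / 8 * R\<^sup>2" using zeta32_nonneg by (intro mult_right_mono) (auto simp: zeta_reg_const_def)
  finally show "norm (psi_gap_sum s) \<le> zeta_reg_const / 8 * R\<^sup>2" .
qed

lemma zeta_reg_bound:
  assumes "R \<ge> 1" "1/2 < Re s" "Re s \<le> 4" "\<bar>Im s\<bar> \<le> 4 * R"
  shows "norm (zeta_reg s) \<le> zeta_reg_const * R\<^sup>2"
proof -
  have "zeta_reg_const / 8 * R\<^sup>2 \<le> zeta_reg_const * R\<^sup>2" using zeta_reg_const_ge_1 by (intro mult_right_mono) auto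
  with zeta_reg_gap_bounds(1)[OF assms] show ?thesis by linarith
qed

lemma psi_gap_sum_bound:
  assumes "R \<ge> 1" "1/2 < Re s" "Re s \<le> 4" "\<bar>Im s\<bar> \<le> 4 * R"
  shows "norm (psi_gap_sum s) \<le> zeta_reg_const * R\<^sup>2"
proof -
  have "zeta_reg_const / 8 * R\<^sup>2 \<le> zeta_reg_const * R\<^sup>2" using zeta_reg_const_ge_1 by (intro mult_right_mono) auto
  with zeta_reg_gap_bounds(2)[OF assms] show ?thesis by linarith
qed

text \<open>
  Cauchy's inequality on circles of radius \<open>1 / 8\<close>; hence the factor \<open>1 / 8\<close> in the bound for
  the function itself.
\<close>

lemma deriv_zeta_reg_bound:
  assumes that: "R \<ge> 1" "3/4 \<le> Re s" "Re s \<le> 3" "\<bar>Im s\<bar> \<le> 3 * R"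
  shows "norm (deriv zeta_reg s) \<le> zeta_reg_const * R\<^sup>2"
proof -
  have sub: "cball s (1/8) \<subseteq> {s. Re s > 1/2}"
  proof
    fix w assume "w \<in> cball s (1/8)"
    thus "w \<in> {s. Re s > 1/2}" using abs_Re_le_cmod[of "s - w"] that by (auto simp: dist_norm)
  qed
  have "norm ((deriv ^^ 1) zeta_reg s) \<le> fact 1 * (zeta_reg_const / 8 * R\<^sup>2) / (1/8) ^ 1"
  proof (rule Cauchy_inequality)
    show "zeta_reg holomorphic_on ball s (1/8)" using sub by (intro holomorphic_on_subset[OF zeta_reg_holo]) force
    show "continuous_on (cball s (1/8)) zeta_reg"
      using sub by (intro holomorphic_on_imp_continuous_on holomorphic_on_subset[OF zeta_reg_holo])
    fix w assume w: "norm (s - w) = 1/8"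
    have "\<bar>Re (s - w)\<bar> \<le> 1/8" "\<bar>Im (s - w)\<bar> \<le> 1/8" using abs_Re_le_cmod[of "s-w"] abs_Im_le_cmod[of "s-w"] w by auto
    hence b: "\<bar>Re s - Re w\<bar> \<le> 1/8" "\<bar>Im s - Im w\<bar> \<le> 1/8" by simp_all
    show "norm (zeta_reg w) \<le> zeta_reg_const / 8 * R\<^sup>2"
    proof (rule zeta_reg_gap_bounds(1))
      show "1/2 < Re w" "Re w \<le> 4" "\<bar>Im w\<bar> \<le> 4 * R" using b that by linarith+
    qed (fact that)
  qed auto
  thus ?thesis by simp
qed

lemma zeta_reg_lipschitz:
  assumes R: "R \<ge> 1" and s: "3/4 \<le> Re s" "Re s \<le> 3" "\<bar>Im s\<bar> \<le> 3 * R"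
       "3/4 \<le> Re s'" "Re s' \<le> 3" "\<bar>Im s'\<bar> \<le> 3 * R"
  shows "norm (zeta_reg s - zeta_reg s') \<le> zeta_reg_const * R\<^sup>2 * norm (s - s')"
proof (rule field_differentiable_bound[where S="{s. 3/4 \<le> Re s} \<inter> {s. Re s \<le> 3} \<inter> {s. Im s \<le> 3 * R} \<inter> {s. Im s \<ge> - (3 * R)}" and f'="deriv zeta_reg"])
  show "convex ({s. 3/4 \<le> Re s} \<inter> {s. Re s \<le> 3} \<inter> {s. Im s \<le> 3 * R} \<inter> {s. Im s \<ge> - (3 * R)})"
    by (intro convex_Int convex_halfspace_Re_ge convex_halfspace_Re_le convex_halfspace_Im_ge convex_halfspace_Im_le)
  fix z assume z: "z \<in> {s. 3/4 \<le> Re s} \<inter> {s. Re s \<le> 3} \<inter> {s. Im s \<le> 3 * R} \<inter> {s. Im s \<ge> - (3 * R)}"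
  have "(zeta_reg has_field_derivative deriv zeta_reg z) (at z)"
    using z by (intro holomorphic_derivI[OF zeta_reg_holo open_halfspace_Re_gt]) auto
  thus "(zeta_reg has_field_derivative deriv zeta_reg z) (at z within {s. 3/4 \<le> Re s} \<inter> {s. Re s \<le> 3} \<inter> {s. Im s \<le> 3 * R} \<inter> {s. Im s \<ge> - (3 * R)})"
    by (rule has_field_derivative_at_within)
  show "norm (deriv zeta_reg z) \<le> zeta_reg_const * R\<^sup>2" using z R by (intro deriv_zeta_reg_bound) auto
qed (use s in auto)

lemma zeta_reg_nonzero_right: "Re s > 1 \<Longrightarrow> zeta_reg s \<noteq> 0"
  using zeta_nonzero[of s] by (auto simp: zeta_reg_eq)

text \<open>
  At distance \<open>x\<close> to the right of the line, the inequality of \<open>three_four_one\<close> bounds the function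
  below by a multiple of \<open>x powr (3/4)\<close>, while moving back to the line changes it by at most a
  multiple of \<open>x\<close>; a suitable power of \<open>R\<close> for \<open>x\<close> makes the first term dominate. Near the
  real axis the pole of \<open>\<zeta>\<close> spoils the first bound, but there the function is close to \<open>1\<close>.
\<close>

lemma zeta_reg_line_lower:
  obtains c where "0 < c" "c \<le> 1" "\<And>R t. R \<ge> 1 \<Longrightarrow> \<bar>t\<bar> \<le> R \<Longrightarrow> c / R ^ 10 \<le> norm (zeta_reg (Complex 1 t))"
proof -
  define D where "D = zeta_reg_const"
  have D1: "D \<ge> 1" using zeta_reg_const_ge_1 by (simp add: D_def)
  note E = zeta_reg_bound[folded D_def] and Q = psi_gap_sum_bound[folded D_def] and E' = deriv_zeta_reg_bound[folded D_def] and L = zeta_reg_lipschitz[folded D_def]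
  obtain C0 where C0: "C0 > 0" "\<And>\<sigma> t. \<sigma> > 1 \<Longrightarrow> C0 \<le> norm (zeta (Complex \<sigma> 0)) ^ 3 * norm (zeta (Complex \<sigma> t)) ^ 4 * norm (zeta (Complex \<sigma> (2 * t)))"
    by (rule three_four_one) blast
  define t0 where "t0 = 1 / (2 * D)"
  have t0: "0 < t0" "t0 \<le> 1" using D1 by (auto simp: t0_def divide_simps)
  define c2 where "c2 = min 1 (C0 * t0 ^ 5 / D ^ 4)"
  have c2: "0 < c2" "c2 \<le> 1" using C0 t0 D1 by (auto simp: c2_def)
  define c3 where "c3 = min 1 (c2 / (2 * D))"
  have c3: "0 < c3" "c3 \<le> 1" "c3 * D \<le> c2 / 2" using c2 D1 by (auto simp: c3_def min_def field_simps)
  define c4 where "c4 = min (1/2) (c2 * c3 ^ 3 / 2)"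
  have c4: "0 < c4" "c4 \<le> 1" "c4 \<le> 1/2" "c4 \<le> c2 * c3 ^ 3 / 2" using c2 c3 by (auto simp: c4_def)
  have "c4 / R ^ 10 \<le> norm (zeta_reg (Complex 1 t))" if R: "R \<ge> 1" and t: "\<bar>t\<bar> \<le> R" for R t
  proof (cases "\<bar>t\<bar> \<le> t0")
    case True
    have "norm (zeta_reg (Complex 1 t) - zeta_reg 1) \<le> D * 1\<^sup>2 * norm (Complex 1 t - 1)"
      using True t0 by (intro L) auto
    also have "norm (Complex 1 t - 1) = \<bar>t\<bar>" by (simp add: cmod_def)
    also have "D * 1\<^sup>2 * \<bar>t\<bar> \<le> D * 1\<^sup>2 * t0" using True D1 by (intro mult_left_mono) auto
    also have "\<dots> = 1/2" using D1 by (simp add: t0_def)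
    finally have "norm (zeta_reg (Complex 1 t)) \<ge> 1/2"
      using norm_triangle_ineq2[of 1 "zeta_reg (Complex 1 t)"] by (simp add: zeta_reg_1 norm_minus_commute)
    moreover have "c4 / R ^ 10 \<le> c4 / 1" using c4 R by (intro divide_left_mono one_le_power) auto
    ultimately show ?thesis using c4 by linarith
  next
    case False
    (* the distance from the line is y ^ 4, which avoids fractional powers *)
    define y where "y = c3 / R ^ 3"
    have y: "0 < y" "y \<le> 1"
    proof -
      show "0 < y" using c3 R by (simp add: y_def)
      have "c3 \<le> 1 * R ^ 3" using c3 one_le_power[OF R, of 3] by linarith
      thus "y \<le> 1" using R by (simp add: y_def field_simps)
    qed
    define x where "x = y ^ 4"
    have x: "0 < x" "x \<le> 1" using y by (auto simp: x_def power_le_one)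
    have ez: "norm (zeta_reg (Complex (1 + x) u)) = norm (Complex x u) * norm (zeta (Complex (1 + x) u))" for u
    proof -
      have "Complex (1 + x) u - 1 = Complex x u" by (simp add: complex_eq_iff)
      thus ?thesis using zeta_reg_eq[of "Complex (1 + x) u"] x by (simp add: norm_mult)
    qed
    define e1 e2 e3 where "e1 = norm (zeta_reg (Complex (1 + x) 0))" and "e2 = norm (zeta_reg (Complex (1 + x) t))"
      and "e3 = norm (zeta_reg (Complex (1 + x) (2 * t)))"
    have "C0 * (x ^ 3 * t0 ^ 4 * t0) \<le>
      (norm (zeta (Complex (1 + x) 0)) ^ 3 * norm (zeta (Complex (1 + x) t)) ^ 4 * norm (zeta (Complex (1 + x) (2 * t))))
       * (norm (Complex x 0) ^ 3 * norm (Complex x t) ^ 4 * norm (Complex x (2 * t)))"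
    proof (intro mult_mono C0 power_mono)
      show "x \<le> norm (Complex x 0)" using abs_Re_le_cmod[of "Complex x 0"] by simp
      show "t0 \<le> norm (Complex x t)" using abs_Im_le_cmod[of "Complex x t"] False by simp
      show "t0 \<le> norm (Complex x (2 * t))" using abs_Im_le_cmod[of "Complex x (2 * t)"] False t0 by simp
    qed (use x t0 C0 in auto)
    also have "\<dots> = e1 ^ 3 * e2 ^ 4 * e3" unfolding e1_def e2_def e3_def ez by (simp add: power_mult_distrib)
    also have "\<dots> \<le> D ^ 3 * e2 ^ 4 * (D * R\<^sup>2)"
    proof (intro mult_mono power_mono)
      show "e1 \<le> D" unfolding e1_def using E[of 1 "Complex (1 + x) 0"] x by simp
      show "e3 \<le> D * R\<^sup>2" unfolding e3_def using x t R by (intro E) auto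
    qed (use D1 in \<open>auto simp: e1_def e2_def e3_def\<close>)
    finally have "C0 * t0 ^ 5 * x ^ 3 \<le> D ^ 4 * R\<^sup>2 * e2 ^ 4"
      by (simp add: power_numeral_reduce algebra_simps)
    hence 1: "C0 * t0 ^ 5 / D ^ 4 * x ^ 3 / R\<^sup>2 \<le> e2 ^ 4" using D1 R by (simp add: field_simps)
    have "(c2 * y ^ 3 / R) ^ 4 = c2 ^ 4 * x ^ 3 / R ^ 4" by (simp add: x_def power_mult_distrib power_divide flip: power_mult)
    also have "\<dots> \<le> C0 * t0 ^ 5 / D ^ 4 * x ^ 3 / R\<^sup>2"
    proof (intro frac_le mult_right_mono)
      have "c2 ^ 4 \<le> c2 ^ 1" using c2 by (intro power_decreasing) auto
      thus "c2 ^ 4 \<le> C0 * t0 ^ 5 / D ^ 4" by (simp add: c2_def)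
      show "R\<^sup>2 \<le> R ^ 4" using R by (intro power_increasing) auto
    qed (use x R C0 t0 D1 in auto)
    finally have "(c2 * y ^ 3 / R) ^ 4 \<le> e2 ^ 4" using 1 by simp
    hence 2: "c2 * y ^ 3 / R \<le> e2" by (rule power_le_imp_le_base[of _ 3, simplified]) (simp add: e2_def)
    have "norm (zeta_reg (Complex (1 + x) t) - zeta_reg (Complex 1 t)) \<le> D * R\<^sup>2 * norm (Complex (1 + x) t - Complex 1 t)"
      using x t R by (intro L) auto
    also have "norm (Complex (1 + x) t - Complex 1 t) = x" using x by (simp add: cmod_def)
    also have "D * R\<^sup>2 * x = y ^ 3 * (D * R\<^sup>2 * y)" by (simp add: x_def power_numeral_reduce)
    also have "D * R\<^sup>2 * y = (c3 * D) * R\<^sup>2 / R ^ 3" by (simp add: y_def)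
    also have "y ^ 3 * ((c3 * D) * R\<^sup>2 / R ^ 3) \<le> y ^ 3 * ((c2 / 2) * R\<^sup>2 / R ^ 3)"
      using y c3 R by (intro mult_left_mono divide_right_mono mult_right_mono) auto
    also have "\<dots> = c2 * y ^ 3 / R / 2" using R by (simp add: field_simps power_numeral_reduce)
    finally have "norm (zeta_reg (Complex 1 t)) \<ge> e2 - c2 * y ^ 3 / R / 2"
      using norm_triangle_ineq2[of "zeta_reg (Complex (1 + x) t)" "zeta_reg (Complex 1 t)"] by (simp add: e2_def)
    moreover have "q - r / 2 \<ge> r / 2" if "r \<le> q" for q r :: real using that by simp
    ultimately have "norm (zeta_reg (Complex 1 t)) \<ge> c2 * y ^ 3 / R / 2" using 2 by (meson order_trans)
    also have "c2 * y ^ 3 / R / 2 = (c2 * c3 ^ 3 / 2) / R ^ 10"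
    proof -
      have "R * R ^ 9 = R ^ 10" by (simp add: power_numeral_reduce)
      thus ?thesis using R by (simp add: y_def power_divide field_simps flip: power_mult)
    qed
    finally have "(c2 * c3 ^ 3 / 2) / R ^ 10 \<le> norm (zeta_reg (Complex 1 t))" by simp
    moreover have "c4 / R ^ 10 \<le> (c2 * c3 ^ 3 / 2) / R ^ 10" using c4 R by (intro divide_right_mono) auto
    ultimately show ?thesis by linarith
  qed
  thus ?thesis using that c4 by blast
qed

text \<open>
  The Lipschitz bound carries the lower bound from the line \<open>Re s = 1\<close> a distance \<open>c / R ^ 12\<close> to
  the left; all terms of the series are then bounded polynomially in \<open>R\<close>.
\<close>

lemma excess_series_bound:
  obtains c M where "0 < c" "c \<le> 1/4" "M > 0"
    "\<And>R s. R \<ge> 1 \<Longrightarrow> 1 - c / R ^ 12 \<le> Re s \<Longrightarrow> Re s \<le> 1 \<Longrightarrow> \<bar>Im s\<bar> \<le> R \<Longrightarrow> zeta_reg s \<noteq> 0"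
    "\<And>R s. R \<ge> 1 \<Longrightarrow> 1 - c / R ^ 12 \<le> Re s \<Longrightarrow> Re s \<le> 1 \<Longrightarrow> \<bar>Im s\<bar> \<le> R \<Longrightarrow> norm (excess_series s) \<le> M * R ^ 12"
proof -
  define D where "D = zeta_reg_const"
  have D1: "D \<ge> 1" using zeta_reg_const_ge_1 by (simp add: D_def)
  note E = zeta_reg_bound[folded D_def] and Q = psi_gap_sum_bound[folded D_def] and E' = deriv_zeta_reg_bound[folded D_def] and L = zeta_reg_lipschitz[folded D_def]
  obtain k where k: "0 < k" "k \<le> 1" "\<And>R t. R \<ge> 1 \<Longrightarrow> \<bar>t\<bar> \<le> R \<Longrightarrow> k / R ^ 10 \<le> norm (zeta_reg (Complex 1 t))"
    by (rule zeta_reg_line_lower) blast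
  define c where "c = min (1/4) (k / (2 * D))"
  have c: "0 < c" "c \<le> 1/4" "D * c \<le> k / 2" using k D1 by (auto simp: c_def min_def field_simps)
  define M where "M = 4 * D / k + 2 + 2 * D + D"
  have M: "M > 0" using D1 k by (simp add: M_def add_pos_pos)
  have low: "k / 2 / R ^ 10 \<le> norm (zeta_reg s) \<and> Re s \<ge> 3/4" if R: "R \<ge> 1" and s: "1 - c / R ^ 12 \<le> Re s" "Re s \<le> 1" "\<bar>Im s\<bar> \<le> R" for R s
  proof -
    have "c / R ^ 12 \<le> c / 1" using c R by (intro divide_left_mono one_le_power) auto
    hence re: "Re s \<ge> 3/4" using s c by simp
    have "norm (zeta_reg (Complex 1 (Im s)) - zeta_reg s) \<le> D * R\<^sup>2 * norm (Complex 1 (Im s) - s)"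
      using s re R by (intro L) auto
    also have "norm (Complex 1 (Im s) - s) = 1 - Re s" using s by (simp add: cmod_def)
    also have "D * R\<^sup>2 * (1 - Re s) \<le> D * R\<^sup>2 * (c / R ^ 12)" using s D1 by (intro mult_left_mono) auto
    also have "\<dots> = (D * c) / R ^ 10" using R by (simp add: field_simps power_numeral_reduce)
    also have "\<dots> \<le> (k / 2) / R ^ 10" using c R by (intro divide_right_mono) auto
    finally have "norm (zeta_reg s) \<ge> k / R ^ 10 - k / 2 / R ^ 10"
      using k(3)[OF R s(3)] norm_triangle_ineq2[of "zeta_reg (Complex 1 (Im s))" "zeta_reg s"] by linarith
    moreover have "k / R ^ 10 - k / 2 / R ^ 10 = k / 2 / R ^ 10" by (simp add: field_simps)
    ultimately show ?thesis using re by simp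
  qed
  show ?thesis
  proof (rule that[OF c(1,2) M])
    fix R s assume as: "R \<ge> (1::real)" "1 - c / R ^ 12 \<le> Re s" "Re s \<le> 1" "\<bar>Im s\<bar> \<le> R"
    have kp: "k / 2 / R ^ 10 > 0" using k as by simp
    have l: "k / 2 / R ^ 10 \<le> norm (zeta_reg s)" and re: "Re s \<ge> 3/4" using low[OF as] by auto
    show "zeta_reg s \<noteq> 0" using l kp by auto
    have ns: "norm s \<ge> 1/2" using abs_Re_le_cmod[of s] re by linarith
    have R2: "R\<^sup>2 \<le> R ^ 12" "1 \<le> R ^ 12" using as by (auto intro!: power_increasing one_le_power)
    have "norm (deriv zeta_reg s / (zeta_reg s * s)) \<le> (D * R\<^sup>2) / (k / 2 / R ^ 10 * (1/2))"
      unfolding norm_divide norm_mult using as re l ns kp D1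
      by (intro frac_le E' mult_mono) auto
    also have "\<dots> = 4 * D / k * R ^ 12" using as k by (simp add: field_simps power_numeral_reduce)
    finally have 1: "norm (deriv zeta_reg s / (zeta_reg s * s)) \<le> 4 * D / k * R ^ 12" .
    have "norm (1 / s) \<le> 1 / (1/2)" unfolding norm_divide using ns by (intro frac_le) auto
    also have "\<dots> \<le> 2 * R ^ 12" using R2 by simp
    finally have 2: "norm (1 / s) \<le> 2 * R ^ 12" .
    have "norm (psi_gap_sum s / s) \<le> (D * R\<^sup>2) / (1/2)"
      unfolding norm_divide using as re ns D1 by (intro frac_le Q) auto
    also have "\<dots> \<le> 2 * D * R ^ 12" using R2 D1 by simp
    finally have 3: "norm (psi_gap_sum s / s) \<le> 2 * D * R ^ 12" .
    have "norm (zeta_quot s) \<le> D * R\<^sup>2"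
    proof (cases "s = 1")
      case True
      thus ?thesis using E'[of R 1] as by (simp add: zeta_quot_def)
    next
      case False
      have "norm (zeta_reg s - zeta_reg 1) \<le> D * R\<^sup>2 * norm (s - 1)" using as re by (intro L) auto
      thus ?thesis using False by (simp add: zeta_quot_def zeta_reg_1 norm_divide divide_le_eq)
    qed
    also have "\<dots> \<le> D * R ^ 12" using R2 D1 by simp
    finally have 4: "norm (zeta_quot s) \<le> D * R ^ 12" .
    have "norm (excess_series s) \<le> norm (deriv zeta_reg s / (zeta_reg s * s)) + norm (1 / s) + norm (psi_gap_sum s / s) + norm (zeta_quot s)"
      unfolding excess_series_def
      by (intro order_trans[OF norm_triangle_ineq4] add_mono order_trans[OF norm_triangle_ineq])
         (auto simp: norm_minus_cancel intro: order_trans[OF norm_triangle_ineq4])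
    also have "\<dots> \<le> M * R ^ 12" using 1 2 3 4 by (simp add: M_def algebra_simps)
    finally show "norm (excess_series s) \<le> M * R ^ 12" .
  qed
qed

section \<open>Newman's contour argument\<close>

text \<open>
  The mean value theorem, as a substitute for comparing a sum with an integral.
\<close>

lemma powr_diff_ge_neg:
  assumes "x > 0" "m \<ge> (1::nat)"
  shows "x * real (Suc m) powr - (1 + x) \<le> real m powr - x - real (Suc m) powr - x"
proof -
  have "\<exists>z>real m. z < real (Suc m) \<and> real (Suc m) powr - x - real m powr - x = (real (Suc m) - real m) * (- x * z powr (- x - 1))"
    by (rule MVT2) (use assms in \<open>auto intro!: derivative_eq_intros simp: powr_diff field_simps\<close>)
  then obtain z where z: "z > real m" "z < real (Suc m)"
    "real (Suc m) powr - x - real m powr - x = - x * z powr (- x - 1)" by auto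
  have "real (Suc m) powr (- x - 1) \<le> z powr (- x - 1)"
    using z assms by (intro powr_mono2') auto
  hence "x * real (Suc m) powr (- x - 1) \<le> x * z powr (- x - 1)" using assms by simp
  moreover have e: "real (Suc m) powr - (1 + x) = real (Suc m) powr (- x - 1)"
    by (rule arg_cong[where f="\<lambda>t. real (Suc m) powr t"]) simp
  ultimately show ?thesis unfolding e using z(3) by linarith
qed

lemma powr_diff_pos:
  assumes "y > 0" "m \<ge> (1::nat)"
  shows "\<exists>z>real m. z < real (Suc m) \<and> real (Suc m) powr y - real m powr y = y * z powr (y - 1)"
proof -
  have "\<exists>z>real m. z < real (Suc m) \<and> real (Suc m) powr y - real m powr y = (real (Suc m) - real m) * (y * z powr (y - 1))"
    by (rule MVT2) (use assms in \<open>auto intro!: derivative_eq_intros simp: powr_diff field_simps\<close>)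
  thus ?thesis by auto
qed

text \<open>
  Comparison with an integral. For \<open>y \<ge> 1\<close> the summands increase, and the last one has to be added
  separately.
\<close>

lemma sum_powr_le:
  assumes y: "y > 0"
  shows "N \<ge> 1 \<Longrightarrow> (\<Sum>n=1..N. real n powr (y - 1)) \<le> real N powr y / y + real N powr (y - 1)"
proof (cases "y \<ge> 1")
  case True
  assume "N \<ge> 1"
  thus ?thesis
  proof (induction N rule: dec_induct)
    case (step n)
    from powr_diff_pos[OF y, of n] step obtain z where z: "z > real n"
      "real (Suc n) powr y - real n powr y = y * z powr (y - 1)" by auto
    have "real n powr (y - 1) \<le> z powr (y - 1)" using z True by (intro powr_mono2) auto
    hence "y * real n powr (y - 1) \<le> real (Suc n) powr y - real n powr y" using y z by simp
    hence "(real n powr y + y * real n powr (y - 1)) / y \<le> real (Suc n) powr y / y"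
      using y by (intro divide_right_mono) auto
    hence "real n powr y / y + real n powr (y - 1) \<le> real (Suc n) powr y / y" using y by (simp add: add_divide_distrib)
    thus ?case using step by simp
  qed (use y in simp)
next
  case False
  assume "N \<ge> 1"
  hence "(\<Sum>n=1..N. real n powr (y - 1)) \<le> real N powr y / y"
  proof (induction N rule: dec_induct)
    case (step n)
    from powr_diff_pos[OF y, of n] step obtain z where z: "z > real n" "z < real (Suc n)"
      "real (Suc n) powr y - real n powr y = y * z powr (y - 1)" by auto
    have "real (Suc n) powr (y - 1) \<le> z powr (y - 1)" using z False step by (intro powr_mono2') auto
    hence "y * real (Suc n) powr (y - 1) \<le> real (Suc n) powr y - real n powr y" using y z by simp
    hence "(real n powr y + y * real (Suc n) powr (y - 1)) / y \<le> real (Suc n) powr y / y"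
      using y by (intro divide_right_mono) auto
    hence "real n powr y / y + real (Suc n) powr (y - 1) \<le> real (Suc n) powr y / y" using y by (simp add: add_divide_distrib)
    thus ?case using step by simp
  qed (use y False in simp)
  thus ?thesis using powr_ge_zero[of "real N" "y-1"] by linarith
qed

lemma tail_sum_bound:
  fixes f :: "nat \<Rightarrow> complex"
  assumes x: "x > 0" and N: "N \<ge> 1" and B: "B \<ge> 0"
    and f: "\<And>n. n > 0 \<Longrightarrow> norm (f n) \<le> B * real n powr - (1 + x)"
    and sums: "(\<lambda>n. f (Suc n)) sums g"
  shows "norm (g - (\<Sum>n=1..N. f n)) \<le> B * real N powr - x / x"
proof -
  have "(\<lambda>n. f (Suc (n + N))) sums (g - (\<Sum>n<N. f (Suc n)))"
    using sums_split_initial_segment[OF sums, of N] by simp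
  also have "(\<Sum>n<N. f (Suc n)) = (\<Sum>n=1..N. f n)"
    by (rule sum.reindex_bij_witness[of _ "\<lambda>n. n - 1" Suc]) auto
  finally have s: "(\<lambda>n. f (Suc (n + N))) sums (g - (\<Sum>n=1..N. f n))" .
  define h where "h = (\<lambda>n. real (n + N) powr - x)"
  have "h \<longlonglongrightarrow> 0" unfolding h_def
    by (rule tendsto_neg_powr[OF _ filterlim_compose[OF filterlim_real_sequentially filterlim_add_const_nat_at_top]])
       (use x in simp)
  hence "(\<lambda>n. h n - h (Suc n)) sums (h 0 - 0)" by (rule telescope_sums')
  hence t: "(\<lambda>n. B / x * (h n - h (Suc n))) sums (B / x * h 0)" using sums_mult by fastforce
  have "norm (g - (\<Sum>n=1..N. f n)) \<le> (\<Sum>n. B / x * (h n - h (Suc n)))"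
    unfolding sums_unique[OF s]
  proof (rule norm_suminf_le)
    fix n
    have "norm (f (Suc (n + N))) \<le> B * real (Suc (n + N)) powr - (1 + x)" by (rule f) simp
    also have "real (Suc (n + N)) powr - (1 + x) \<le> (h n - h (Suc n)) / x"
      using powr_diff_ge_neg[OF x, of "n + N"] N x by (simp add: h_def field_simps)
    finally show "norm (f (Suc (n + N))) \<le> B / x * (h n - h (Suc n))"
      using B by (simp add: mult_left_mono)
  qed (use t in \<open>simp add: sums_iff\<close>)
  also have "\<dots> = B * real N powr - x / x" using t by (simp add: sums_iff h_def)
  finally show ?thesis .
qed

lemma Re_part_circle_right:
  assumes "R > 0" "z \<in> path_image (part_circlepath 0 R (-(pi/2)) (pi/2))"
  shows "Re z \<ge> 0 \<and> norm z = R"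
  using assms by (auto simp: path_image_part_circlepath norm_mult Re_exp intro!: mult_nonneg_nonneg cos_ge_zero)

lemma Re_part_circle_left:
  assumes "R > 0" "z \<in> path_image (part_circlepath 0 R (pi/2) (3*pi/2))"
  shows "Re z \<le> 0 \<and> norm z = R"
proof -
  have "cos x \<le> 0" if "pi/2 \<le> x" "x \<le> 3*pi/2" for x
  proof -
    have "cos (x - pi) \<ge> 0" using that by (intro cos_ge_zero) auto
    thus ?thesis by (simp add: cos_diff)
  qed
  thus ?thesis
    using assms by (auto simp: path_image_part_circlepath norm_mult Re_exp intro!: mult_nonneg_nonpos)
qed

lemma ends_part_circle:
  "pathstart (part_circlepath 0 R (-(pi/2)) (pi/2)) = - (\<i> * of_real R)"
  "pathfinish (part_circlepath 0 R (-(pi/2)) (pi/2)) = \<i> * of_real R"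
  "pathstart (part_circlepath 0 R (pi/2) (3*pi/2)) = \<i> * of_real R"
  "pathfinish (part_circlepath 0 R (pi/2) (3*pi/2)) = - (\<i> * of_real R)"
proof -
  have e: "exp (\<i> * of_real t) = Complex (cos t) (sin t)" for t
    by (simp add: complex_eq_iff Re_exp Im_exp)
  have c: "cos (3*pi/2) = 0" "sin (3*pi/2) = -1"
    using cos_periodic_pi[of "pi/2"] sin_periodic_pi[of "pi/2"] by (simp_all add: field_simps)
  show "pathstart (part_circlepath 0 R (-(pi/2)) (pi/2)) = - (\<i> * of_real R)"
  "pathfinish (part_circlepath 0 R (-(pi/2)) (pi/2)) = \<i> * of_real R"
  "pathstart (part_circlepath 0 R (pi/2) (3*pi/2)) = \<i> * of_real R"
  "pathfinish (part_circlepath 0 R (pi/2) (3*pi/2)) = - (\<i> * of_real R)"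
    by (simp_all only: pathstart_part_circlepath pathfinish_part_circlepath e)
       (auto simp: complex_eq_iff c)
qed

text \<open>
  Cauchy's formula for a closed contour through \<open>- \<i> * R\<close> and \<open>\<i> * R\<close>, whose left part is
  arbitrary. Instead of computing a winding number, the pole is split off: \<open>(h z - h 0) / z\<close> extends
  holomorphically, and \<open>1 / z\<close> has a logarithm as primitive on each of the two half-planes.
\<close>

lemma cauchy_two_arcs:
  assumes U: "open U" "convex U" "0 \<in> U" and h: "h holomorphic_on U" and R: "R > 0"
    and cU: "path_image (part_circlepath 0 R (-(pi/2)) (pi/2)) \<subseteq> U"
    and p: "valid_path p" "pathstart p = \<i> * of_real R" "pathfinish p = - (\<i> * of_real R)"
    and pU: "path_image p \<subseteq> U" and pl: "\<And>z. z \<in> path_image p \<Longrightarrow> Re z \<le> 0 \<and> z \<noteq> 0"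
  shows "contour_integral (part_circlepath 0 R (-(pi/2)) (pi/2)) (\<lambda>z. h z / z) + contour_integral p (\<lambda>z. h z / z)
     = 2 * of_real pi * \<i> * h 0"
proof -
  define c where "c = part_circlepath 0 R (-(pi/2)) (pi/2)"
  have c: "valid_path c" "pathstart c = - (\<i> * of_real R)" "pathfinish c = \<i> * of_real R"
    by (simp_all only: c_def ends_part_circle valid_path_part_circlepath)
  have cr: "Re z \<ge> 0 \<and> z \<noteq> 0" if "z \<in> path_image c" for z
    using Re_part_circle_right[OF R] that R unfolding c_def by force
  define q where "q = (\<lambda>z. if z = 0 then deriv h 0 else (h z - h 0) / (z - 0))"
  have qh: "q holomorphic_on U" unfolding q_def
    by (rule pole_lemma[OF h]) (use U in \<open>simp add: interior_open\<close>)
  have "(q has_contour_integral 0) (c +++ p)"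
    by (rule Cauchy_theorem_convex_simple[OF qh U(2)])
       (use c p cU pU in \<open>auto simp: path_image_join c_def valid_path_imp_path\<close>)
  moreover have qi: "q contour_integrable_on c" "q contour_integrable_on p"
    using contour_integrable_holomorphic_simple[OF qh U(1)] c p cU pU by (auto simp: c_def)
  ultimately have q0: "contour_integral c q + contour_integral p q = 0"
    using c p by (metis contour_integral_join contour_integral_unique)
  have lnI: "Ln (\<i> * of_real R) = of_real (ln R) + \<i> * of_real pi / 2"
            "Ln (- (\<i> * of_real R)) = of_real (ln R) - \<i> * of_real pi / 2"
    using Ln_times_of_real[of R \<i>] Ln_times_of_real[of R "-\<i>"] R by (simp_all add: mult.commute Ln_of_real)
  have "((\<lambda>z. 1 / z) has_contour_integral (Ln (pathfinish c) - Ln (pathstart c))) c"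
  proof (rule contour_integral_primitive[where S="{z. Re z \<ge> 0 \<and> z \<noteq> 0}"])
    fix z assume "z \<in> {z. Re z \<ge> 0 \<and> z \<noteq> 0}"
    hence "z \<notin> \<real>\<^sub>\<le>\<^sub>0" by (auto simp: complex_nonpos_Reals_iff complex_eq_iff)
    thus "(Ln has_field_derivative 1 / z) (at z within {z. Re z \<ge> 0 \<and> z \<noteq> 0})"
      by (auto intro!: derivative_eq_intros simp: field_simps)
  qed (use c cr in auto)
  hence I1: "((\<lambda>z. 1 / z) has_contour_integral (\<i> * of_real pi)) c"
    unfolding c(2,3) lnI by simp
  have "((\<lambda>z. 1 / z) has_contour_integral (Ln (- pathfinish p) - Ln (- pathstart p))) p"
  proof (rule contour_integral_primitive[where S="{z. Re z \<le> 0 \<and> z \<noteq> 0}" and f="\<lambda>z. Ln (- z)"])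
    fix z :: complex assume z: "z \<in> {z. Re z \<le> 0 \<and> z \<noteq> 0}"
    hence "- z \<notin> \<real>\<^sub>\<le>\<^sub>0" by (auto simp: complex_nonpos_Reals_iff complex_eq_iff)
    thus "((\<lambda>z. Ln (- z)) has_field_derivative 1 / z) (at z within {z. Re z \<le> 0 \<and> z \<noteq> 0})"
      using z by (auto intro!: derivative_eq_intros simp: field_simps)
  qed (use p pl in auto)
  hence I2: "((\<lambda>z. 1 / z) has_contour_integral (\<i> * of_real pi)) p"
    unfolding p(2,3) minus_minus lnI by simp
  have J: "contour_integral r (\<lambda>z. h z / z) = contour_integral r q + h 0 * (\<i> * of_real pi)"
    if r: "((\<lambda>z. 1 / z) has_contour_integral (\<i> * of_real pi)) r" "q contour_integrable_on r" "\<And>z. z \<in> path_image r \<Longrightarrow> z \<noteq> 0" for r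
  proof (rule contour_integral_unique)
    have "((\<lambda>z. q z + h 0 * (1 / z)) has_contour_integral (contour_integral r q + h 0 * (\<i> * of_real pi))) r"
      by (intro has_contour_integral_add has_contour_integral_integral has_contour_integral_lmul r)
    thus "((\<lambda>z. h z / z) has_contour_integral (contour_integral r q + h 0 * (\<i> * of_real pi))) r"
      by (rule has_contour_integral_eq) (use r(3) in \<open>auto simp: q_def field_simps\<close>)
  qed
  show ?thesis unfolding c_def[symmetric]
    using q0 J[OF I1 qi(1)] J[OF I2 qi(2)] cr pl by (simp add: algebra_simps)
qed

text \<open>
  Newman's kernel: the factor \<open>1 + z\<^sup>2 / R\<^sup>2\<close> is small near the points \<open>\<plusminus> \<i> * R\<close>, where
  the estimates of the series blow up.
\<close>

definition newman_kernel :: "nat \<Rightarrow> real \<Rightarrow> complex \<Rightarrow> complex" where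
  "newman_kernel N R z = npow N (- z) * (1 + z\<^sup>2 / of_real (R\<^sup>2))"

text \<open>
  On the circle \<open>z * cnj z = R\<^sup>2\<close>, so \<open>1 + z\<^sup>2 / R\<^sup>2 = z * (z + cnj z) / R\<^sup>2\<close>.
\<close>

lemma norm_newman_kernel_circle:
  assumes "norm z = R" "R > 0" "N > 0"
  shows "norm (newman_kernel N R z / z) = real N powr Re z * (2 * \<bar>Re z\<bar> / R\<^sup>2)"
proof -
  have z0: "z \<noteq> 0" using assms by auto
  have "of_real (R\<^sup>2) = z * cnj z" unfolding assms(1)[symmetric] by (rule complex_norm_square)
  hence "1 + z\<^sup>2 / of_real (R\<^sup>2) = z * of_real (2 * Re z) / of_real (R\<^sup>2)"
    using assms z0 by (simp add: field_simps power2_eq_square complex_add_cnj)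
  thus ?thesis using assms z0
    by (simp add: newman_kernel_def norm_mult norm_divide norm_npow norm_power power2_eq_square)
qed

text \<open>
  The difference \<open>g 0 - gN 0\<close>, where \<open>gN\<close> is a partial sum of the series of \<open>g\<close>, is an integral
  over the right half of the circle of radius \<open>R\<close>, on which \<open>g - gN\<close> is a small tail. On the left,
  \<open>gN\<close> is entire and is integrated over the other half of the circle, while \<open>g\<close> is only
  defined slightly beyond the imaginary axis and is integrated over the sides of a rectangle of width
  \<open>d\<close>. The two arcs contribute the terms with \<open>B\<close>, the horizontal sides the third term, and
  the vertical side the last one.
\<close>

theorem newman_bound:
  fixes a :: "nat \<Rightarrow> real" and g :: "complex \<Rightarrow> complex"
  assumes a: "\<And>n. \<bar>a n\<bar> \<le> B" and R: "R > 0" "R < R'" and d: "0 < d" "d < d'" "d \<le> R"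
    and U: "U = {z. Re z > - d' \<and> \<bar>Im z\<bar> < R'}"
    and g: "g holomorphic_on U"
    and sums: "\<And>z. Re z > 0 \<Longrightarrow> (\<lambda>n. of_real (a (Suc n)) * npow (Suc n) (1 + z)) sums g z"
    and M: "\<And>z. - d \<le> Re z \<Longrightarrow> Re z \<le> 0 \<Longrightarrow> \<bar>Im z\<bar> \<le> R \<Longrightarrow> norm (g z) \<le> M"
    and N: "N \<ge> 1"
  shows "norm (g 0 - of_real (\<Sum>n=1..N. a n / real n)) \<le>
    2 * B / R + B / real N + M * d\<^sup>2 / R\<^sup>2 + M * R * real N powr - d / d"
proof -
  have B: "B \<ge> 0" using a[of 0] by linarith
  have Npos: "N > 0" using N by simp
  have M0: "M \<ge> 0" using M[of 0] R d norm_ge_zero[of "g 0"] by (auto intro: order_trans[OF norm_ge_zero])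
  define gN where "gN = (\<lambda>z. \<Sum>n=1..N. of_real (a n) * npow n (1 + z))"
  define c where "c = part_circlepath 0 R (-(pi/2)) (pi/2)"
  define l where "l = part_circlepath 0 R (pi/2) (3*pi/2)"
  define p1 p2 p3 p4 where "p1 = \<i> * of_real R" and "p2 = Complex (- d) R" and "p3 = Complex (- d) (-R)"
    and "p4 = - (\<i> * of_real R)"
  define p where "p = linepath p1 p2 +++ linepath p2 p3 +++ linepath p3 p4"
  have Uo: "open U" "convex U" "0 \<in> U"
  proof -
    have e: "U = {z. Re z > - d'} \<inter> {z. Im z < R'} \<inter> {z. Im z > - R'}" using U by auto
    show "open U" unfolding e by (intro open_Int open_halfspace_Re_gt open_halfspace_Im_lt open_halfspace_Im_gt)
    show "convex U" unfolding e by (intro convex_Int convex_halfspace_Re_gt convex_halfspace_Im_lt convex_halfspace_Im_gt)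
    show "0 \<in> U" using R d by (auto simp: U)
  qed
  have seg1: "Im z = R \<and> - d \<le> Re z \<and> Re z \<le> 0" if "z \<in> closed_segment p1 p2" for z
  proof -
    from that obtain u where u: "0 \<le> u" "u \<le> 1" "z = (1 - u) *\<^sub>R p1 + u *\<^sub>R p2" by (auto simp: closed_segment_def)
    have "Re z = - (u * d)" "Im z = R" by (auto simp: u p1_def p2_def algebra_simps)
    moreover have "u * d \<le> d" "u * d \<ge> 0" using u d by (auto simp: mult_left_le_one_le)
    ultimately show ?thesis by simp
  qed
  have seg3: "Im z = - R \<and> - d \<le> Re z \<and> Re z \<le> 0" if "z \<in> closed_segment p3 p4" for z
  proof -
    from that obtain u where u: "0 \<le> u" "u \<le> 1" "z = (1 - u) *\<^sub>R p3 + u *\<^sub>R p4" by (auto simp: closed_segment_def)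
    have "Re z = - ((1 - u) * d)" "Im z = - R" by (auto simp: u p3_def p4_def algebra_simps)
    moreover have "(1 - u) * d \<le> d" "(1 - u) * d \<ge> 0" using u d by (auto simp: mult_left_le_one_le)
    ultimately show ?thesis by simp
  qed
  have seg2: "Re z = - d \<and> \<bar>Im z\<bar> \<le> R" if z: "z \<in> closed_segment p2 p3" for z
  proof -
    from z obtain u where u: "0 \<le> u" "u \<le> 1" "z = (1 - u) *\<^sub>R p2 + u *\<^sub>R p3" by (auto simp: closed_segment_def)
    have "Re z = - d" "Im z = R * (1 - 2 * u)" by (auto simp: u p2_def p3_def algebra_simps)
    moreover have "\<bar>R * (1 - 2 * u)\<bar> \<le> R * 1" unfolding abs_mult using R u by (intro mult_mono) auto
    ultimately show ?thesis by simp
  qed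
  have pim: "path_image p = closed_segment p1 p2 \<union> closed_segment p2 p3 \<union> closed_segment p3 p4"
    by (auto simp: p_def path_image_join)
  have pbox: "- d \<le> Re z \<and> Re z \<le> 0 \<and> \<bar>Im z\<bar> \<le> R \<and> z \<noteq> 0" if "z \<in> path_image p" for z
  proof -
    from that consider "z \<in> closed_segment p1 p2" | "z \<in> closed_segment p2 p3" | "z \<in> closed_segment p3 p4"
      unfolding pim by auto
    thus ?thesis
    proof cases
      case 1 with seg1[OF this] R show ?thesis by auto
    next
      case 2 with seg2[OF this] d show ?thesis by auto
    next
      case 3 with seg3[OF this] R show ?thesis by auto
    qed
  qed
  have pU: "path_image p \<subseteq> U" using pbox R d by (force simp: U)
  have p: "valid_path p" "pathstart p = \<i> * of_real R" "pathfinish p = - (\<i> * of_real R)"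
    by (simp_all add: p_def p1_def p4_def)
  have cU: "path_image c \<subseteq> U"
  proof
    fix z assume "z \<in> path_image c"
    hence "Re z \<ge> 0" "norm z = R" using Re_part_circle_right[OF R(1)] by (auto simp: c_def)
    thus "z \<in> U" using abs_Im_le_cmod[of z] R d by (auto simp: U)
  qed
  have gNh: "gN holomorphic_on A" for A unfolding gN_def by (intro holomorphic_intros)
  have kh: "newman_kernel N R holomorphic_on A" for A unfolding newman_kernel_def[abs_def]
    by (intro holomorphic_intros) (use R in auto)
  have k0: "newman_kernel N R 0 = 1" by (simp add: newman_kernel_def npow_def)
  define G where "G = (\<lambda>z. g z * newman_kernel N R z / z)"
  define H where "H = (\<lambda>z. gN z * newman_kernel N R z / z)"
  have I1: "contour_integral c G + contour_integral p G = 2 * of_real pi * \<i> * g 0"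
    using cauchy_two_arcs[OF Uo holomorphic_on_mult[OF g kh[of U]] R(1) _ p pU] pbox cU k0
    by (simp add: c_def G_def)
  have I2: "contour_integral c H + contour_integral l H = 2 * of_real pi * \<i> * gN 0"
  proof -
    have "contour_integral c (\<lambda>z. (gN z * newman_kernel N R z) / z) + contour_integral l (\<lambda>z. (gN z * newman_kernel N R z) / z)
        = 2 * of_real pi * \<i> * (gN 0 * newman_kernel N R 0)"
      unfolding c_def
    proof (rule cauchy_two_arcs[of UNIV])
      show "valid_path l" "pathstart l = \<i> * of_real R" "pathfinish l = - (\<i> * of_real R)"
        by (simp_all only: l_def ends_part_circle valid_path_part_circlepath)
      show "Re z \<le> 0 \<and> z \<noteq> 0" if "z \<in> path_image l" for z
        using Re_part_circle_left[OF R(1)] that R unfolding l_def by force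
    qed (use R in \<open>auto intro!: holomorphic_intros gNh kh\<close>)
    thus ?thesis by (simp add: H_def k0)
  qed
  have cint: "G contour_integrable_on c" "H contour_integrable_on c" "G contour_integrable_on p" "H contour_integrable_on l"
  proof -
    have op: "open (U - {0})" "open (UNIV - {0::complex})" using Uo by auto
    have Gh: "G holomorphic_on U - {0}" unfolding G_def
      by (intro holomorphic_intros kh holomorphic_on_subset[OF g]) auto
    have Hh: "H holomorphic_on UNIV - {0}" unfolding H_def by (intro holomorphic_intros kh gNh) auto
    have c0: "0 \<notin> path_image c" using Re_part_circle_right[OF R(1), of 0] R by (auto simp: c_def)
    have l0: "0 \<notin> path_image l" using Re_part_circle_left[OF R(1), of 0] R by (auto simp: l_def)
    show "G contour_integrable_on c"
      by (rule contour_integrable_holomorphic_simple[OF Gh op(1)]) (use cU c0 in \<open>auto simp: c_def\<close>)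
    show "G contour_integrable_on p"
      by (rule contour_integrable_holomorphic_simple[OF Gh op(1) p(1)]) (use pU pbox in auto)
    show "H contour_integrable_on c"
      by (rule contour_integrable_holomorphic_simple[OF Hh op(2)]) (use c0 in \<open>auto simp: c_def\<close>)
    show "H contour_integrable_on l"
      by (rule contour_integrable_holomorphic_simple[OF Hh op(2)]) (use l0 in \<open>auto simp: l_def\<close>)
  qed
  (* the estimates on the arcs fail at these two points, which do not affect the integrals *)
  define X where "X = {\<i> * of_real R, - (\<i> * of_real R)}"
  have onax: "Re z \<noteq> 0" if "norm z = R" "z \<notin> X" for z
  proof
    assume 0: "Re z = 0"
    hence "\<bar>Im z\<bar> = R" using that by (simp add: cmod_def)
    hence "Im z = R \<or> Im z = - R" by linarith
    thus False using that 0 by (auto simp: X_def complex_eq_iff)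
  qed
  have b1: "norm (contour_integral c G - contour_integral c H) \<le> (2 * B / R\<^sup>2) * R * (pi/2 - (-(pi/2)))"
    unfolding contour_integral_diff[OF cint(1,2), symmetric]
  proof (rule has_contour_integral_bound_part_circlepath_strong[where k=X])
    show "((\<lambda>x. G x - H x) has_contour_integral contour_integral c (\<lambda>x. G x - H x)) (part_circlepath 0 R (-(pi/2)) (pi/2))"
      using cint contour_integrable_diff has_contour_integral_integral unfolding c_def by blast
    fix z assume z: "z \<in> path_image (part_circlepath 0 R (-(pi/2)) (pi/2)) - X"
    hence zz: "Re z > 0" "norm z = R" using Re_part_circle_right[OF R(1), of z] onax[of z] by auto
    have "norm (g z - gN z) \<le> B * real N powr - Re z / Re z"
      unfolding gN_def
    proof (rule tail_sum_bound[OF zz(1) N B _ sums[OF zz(1)]])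
      show "norm (of_real (a n) * npow n (1 + z)) \<le> B * real n powr - (1 + Re z)" if "n > 0" for n
        using that a[of n] by (simp add: norm_mult norm_npow mult_right_mono)
    qed
    hence "norm (g z - gN z) * norm (newman_kernel N R z / z) \<le>
        (B * real N powr - Re z / Re z) * (real N powr Re z * (2 * \<bar>Re z\<bar> / R\<^sup>2))"
      unfolding norm_newman_kernel_circle[OF zz(2) R(1) Npos] by (intro mult_right_mono) auto
    also have "\<dots> = 2 * B / R\<^sup>2 * (real N powr - Re z * real N powr Re z)" using zz by (simp add: field_simps)
    also have "\<dots> = 2 * B / R\<^sup>2" using N by (simp add: powr_add[symmetric])
    also have "norm (g z - gN z) * norm (newman_kernel N R z / z) = norm (G z - H z)"
      unfolding norm_mult[symmetric] G_def H_def by (simp add: algebra_simps diff_divide_distrib)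
    finally show "norm (G z - H z) \<le> 2 * B / R\<^sup>2" .
  qed (use R B in \<open>auto simp: X_def\<close>)
  have b2: "norm (contour_integral l H) \<le> (2 * B / R\<^sup>2 + 2 * B / (real N * R)) * R * (3*pi/2 - pi/2)"
  proof (rule has_contour_integral_bound_part_circlepath_strong[where k=X])
    show "(H has_contour_integral contour_integral l H) (part_circlepath 0 R (pi/2) (3*pi/2))"
      using cint has_contour_integral_integral unfolding l_def by blast
    fix z assume z: "z \<in> path_image (part_circlepath 0 R (pi/2) (3*pi/2)) - X"
    hence zz: "Re z < 0" "norm z = R" using Re_part_circle_left[OF R(1), of z] onax[of z] by auto
    define y where "y = - Re z"
    have y: "y > 0" "y \<le> R" using zz abs_Re_le_cmod[of z] by (auto simp: y_def)
    have yabs: "Re z = - y" "\<bar>- y\<bar> = y" using y by (auto simp: y_def)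
    have "norm (gN z) \<le> (\<Sum>n=1..N. B * real n powr (y - 1))"
      unfolding gN_def
    proof (rule sum_norm_le)
      fix n assume n: "n \<in> {1..N}"
      have "norm (npow n (1 + z)) = real n powr - Re (1 + z)" using n by (intro norm_npow) auto
      also have "\<dots> = real n powr (y - 1)"
        by (rule arg_cong[where f="\<lambda>t. real n powr t"]) (simp add: y_def)
      finally show "norm (of_real (a n) * npow n (1 + z)) \<le> B * real n powr (y - 1)"
        using a[of n] by (simp add: norm_mult mult_right_mono)
    qed
    also have "\<dots> \<le> B * (real N powr y / y + real N powr (y - 1))"
      unfolding sum_distrib_left[symmetric] by (intro mult_left_mono sum_powr_le y N B)
    finally have "norm (gN z) * norm (newman_kernel N R z / z) \<le>
        (B * (real N powr y / y + real N powr (y - 1))) * (real N powr - y * (2 * y / R\<^sup>2))"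
      unfolding norm_newman_kernel_circle[OF zz(2) R(1) Npos] yabs by (intro mult_right_mono) (use y in auto)
    also have "\<dots> = 2 * B / R\<^sup>2 * (real N powr y * real N powr - y) + 2 * B * y / R\<^sup>2 * (real N powr (y - 1) * real N powr - y)"
      using y by (simp add: field_simps)
    also have "\<dots> = 2 * B / R\<^sup>2 + 2 * B / R\<^sup>2 * y / real N"
    proof -
      have "real N powr y * real N powr - y = 1" using N by (simp add: powr_add[symmetric])
      moreover have "real N powr (y - 1) * real N powr - y = 1 / real N"
        unfolding powr_add[symmetric] using N by (simp add: powr_minus_divide)
      ultimately show ?thesis by (simp only:) simp
    qed
    also have "2 * B / R\<^sup>2 * y / real N \<le> 2 * B / R\<^sup>2 * R / real N"
      using y B by (intro divide_right_mono mult_left_mono) auto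
    also have "2 * B / R\<^sup>2 * R / real N = 2 * B / (real N * R)" using R by (simp add: power2_eq_square)
    finally show "norm (H z) \<le> 2 * B / R\<^sup>2 + 2 * B / (real N * R)"
      by (simp add: H_def norm_mult norm_divide)
  qed (use R B in \<open>auto simp: X_def\<close>)
  have Gp: "G contour_integrable_on linepath p1 p2" "G contour_integrable_on linepath p2 p3" "G contour_integrable_on linepath p3 p4"
    using cint(3) unfolding p_def by (auto simp: contour_integrable_joinI)
  have horiz: "norm (G z) \<le> M * (3 * d / R\<^sup>2)" if z: "\<bar>Im z\<bar> = R" "- d \<le> Re z" "Re z \<le> 0" for z
  proof -
    have z0: "norm z \<ge> R" using abs_Im_le_cmod[of z] z by simp
    have "(Im z)\<^sup>2 = R\<^sup>2" using z(1) by (metis power2_abs)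
    hence "1 + z\<^sup>2 / of_real (R\<^sup>2) = (of_real ((Re z)\<^sup>2) + \<i> * of_real (2 * Re z * Im z)) / of_real (R\<^sup>2)"
      using R by (simp add: complex_eq_iff power2_eq_square field_simps)
    hence "norm (1 + z\<^sup>2 / of_real (R\<^sup>2)) = norm (of_real ((Re z)\<^sup>2) + \<i> * of_real (2 * Re z * Im z)) / R\<^sup>2"
      by (simp add: norm_divide norm_power)
    also have "\<dots> \<le> (norm (complex_of_real ((Re z)\<^sup>2)) + norm (\<i> * of_real (2 * Re z * Im z))) / R\<^sup>2"
      by (intro divide_right_mono norm_triangle_ineq) auto
    also have "\<dots> = (\<bar>Re z\<bar> * \<bar>Re z\<bar> + 2 * \<bar>Re z\<bar> * R) / R\<^sup>2"
      using z(1) by (simp add: norm_mult power2_eq_square)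
    also have "\<dots> \<le> (d * R + 2 * d * R) / R\<^sup>2"
      using z d R by (intro divide_right_mono add_mono mult_mono) auto
    also have "\<dots> = 3 * d / R" using R by (simp add: power2_eq_square)
    finally have 1: "norm (1 + z\<^sup>2 / of_real (R\<^sup>2)) \<le> 3 * d / R" .
    have 2: "norm (npow N (- z)) \<le> 1"
      using N z powr_mono[of "Re z" 0 "real N"] by (simp add: norm_npow)
    have "norm (G z) = norm (g z) * (norm (npow N (- z)) * norm (1 + z\<^sup>2 / of_real (R\<^sup>2))) / norm z"
      by (simp add: G_def newman_kernel_def norm_mult norm_divide)
    also have "\<dots> \<le> M * (1 * (3 * d / R)) / R"
      using z 1 2 z0 R d M0 by (intro frac_le mult_mono mult_nonneg_nonneg M) auto
    finally show ?thesis by (simp add: power2_eq_square)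
  qed
  have b3: "norm (contour_integral (linepath p1 p2) G) \<le> M * (3 * d / R\<^sup>2) * norm (p2 - p1)"
    by (rule contour_integral_bound_linepath[OF Gp(1)]) (use M0 d R seg1 horiz in \<open>auto intro!: mult_nonneg_nonneg\<close>)
  have b5: "norm (contour_integral (linepath p3 p4) G) \<le> M * (3 * d / R\<^sup>2) * norm (p4 - p3)"
    by (rule contour_integral_bound_linepath[OF Gp(3)]) (use M0 d R seg3 horiz in \<open>auto intro!: mult_nonneg_nonneg\<close>)
  have b4: "norm (contour_integral (linepath p2 p3) G) \<le> M * (3 * real N powr - d / d) * norm (p3 - p2)"
  proof (rule contour_integral_bound_linepath[OF Gp(2)])
    fix z assume "z \<in> closed_segment p2 p3"
    hence z: "Re z = - d" "\<bar>Im z\<bar> \<le> R" using seg2 by auto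
    have "(norm z)\<^sup>2 \<le> d\<^sup>2 + R\<^sup>2"
      using z power_mono[of "\<bar>Im z\<bar>" R 2] by (simp add: cmod_power2)
    also have "d\<^sup>2 \<le> R\<^sup>2" using d by (intro power_mono) auto
    finally have z2: "(norm z)\<^sup>2 / R\<^sup>2 \<le> 2" using R by (simp add: field_simps)
    have "norm (1 + z\<^sup>2 / of_real (R\<^sup>2)) \<le> 1 + (norm z)\<^sup>2 / R\<^sup>2"
      using norm_triangle_ineq[of 1 "z\<^sup>2 / of_real (R\<^sup>2)"] by (simp add: norm_divide norm_power)
    with z2 have 1: "norm (1 + z\<^sup>2 / of_real (R\<^sup>2)) \<le> 3" by simp
    have 2: "norm z \<ge> d" using abs_Re_le_cmod[of z] z d by simp
    have "norm (G z) = norm (g z) * (norm (npow N (- z)) * norm (1 + z\<^sup>2 / of_real (R\<^sup>2))) / norm z"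
      by (simp add: G_def newman_kernel_def norm_mult norm_divide)
    also have "\<dots> \<le> M * (real N powr - d * 3) / d"
      using z 1 2 R d M0 N by (intro frac_le mult_mono mult_nonneg_nonneg M) (auto simp: norm_npow)
    finally show "norm (G z) \<le> M * (3 * real N powr - d / d)" by (simp add: mult_ac)
  qed (use M0 d in auto)
  have "p3 - p2 = (- 2 * R) *\<^sub>R \<i>" by (simp add: p2_def p3_def complex_eq_iff)
  hence "norm (p3 - p2) = 2 * R" using R by (simp only: norm_scaleR) simp
  moreover have "norm (p2 - p1) = d" "norm (p4 - p3) = d"
    using d R by (simp_all add: p1_def p2_def p3_def p4_def cmod_def)
  ultimately have len: "norm (p2 - p1) = d" "norm (p3 - p2) = 2 * R" "norm (p4 - p3) = d" by auto
  have pint: "contour_integral p G = contour_integral (linepath p1 p2) G + contour_integral (linepath p2 p3) G + contour_integral (linepath p3 p4) G"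
    unfolding p_def using Gp by (simp add: contour_integrable_joinI)
  define T where "T = 2 * B / R\<^sup>2 * R * pi + (2 * B / R\<^sup>2 + 2 * B / (real N * R)) * R * pi
      + 6 * (M * d\<^sup>2 / R\<^sup>2) + 6 * (M * R * real N powr - d / d)"
  have "2 * of_real pi * \<i> * (g 0 - gN 0) = (contour_integral c G - contour_integral c H)
     + contour_integral p G - contour_integral l H"
    using I1 I2 by (simp add: algebra_simps)
  hence "2 * pi * norm (g 0 - gN 0) = norm ((contour_integral c G - contour_integral c H)
     + contour_integral p G - contour_integral l H)"
    by (metis (no_types, opaque_lifting) norm_mult norm_ii norm_of_real norm_numeral mult.right_neutral abs_of_pos pi_gt_zero)
  also have "\<dots> \<le> norm (contour_integral c G - contour_integral c H) +
      (norm (contour_integral (linepath p1 p2) G) + norm (contour_integral (linepath p2 p3) G) + norm (contour_integral (linepath p3 p4) G))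
      + norm (contour_integral l H)"
  proof -
    have "norm (A + (x + y + z) - L) \<le> norm A + (norm x + norm y + norm z) + norm L" for A x y z L :: complex
      by norm
    thus ?thesis unfolding pint by blast
  qed
  also have "\<dots> \<le> T"
  proof -
    have "pi/2 - (-(pi/2)) = pi" "3*pi/2 - pi/2 = pi" by simp_all
    note b12 = b1[unfolded this] b2[unfolded this]
    have e3: "M * (3 * d / R\<^sup>2) * d = 3 * (M * d\<^sup>2 / R\<^sup>2)" by (simp add: power2_eq_square)
    have e4: "M * (3 * real N powr - d / d) * (2 * R) = 6 * (M * R * real N powr - d / d)" by simp
    show ?thesis using b12 b3[unfolded len e3] b5[unfolded len e3] b4[unfolded len e4] unfolding T_def by linarith
  qed
  finally have fin: "2 * pi * norm (g 0 - gN 0) \<le> T" .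
  have "T = 2 * pi * (2 * B / R + B / real N) + 6 * (M * d\<^sup>2 / R\<^sup>2 + M * R * real N powr - d / d)"
    using R N by (simp add: T_def power2_eq_square field_simps)
  also have "\<dots> \<le> 2 * pi * (2 * B / R + B / real N) + 2 * pi * (M * d\<^sup>2 / R\<^sup>2 + M * R * real N powr - d / d)"
    using pi_gt3 M0 R d by (intro add_left_mono mult_right_mono) auto
  finally have "T \<le> 2 * pi * (2 * B / R + B / real N + M * d\<^sup>2 / R\<^sup>2 + M * R * real N powr - d / d)"
    by (simp add: algebra_simps)
  with fin have "2 * pi * norm (g 0 - gN 0) \<le> 2 * pi * (2 * B / R + B / real N + M * d\<^sup>2 / R\<^sup>2 + M * R * real N powr - d / d)"
    by linarith
  hence "norm (g 0 - gN 0) \<le> 2 * B / R + B / real N + M * d\<^sup>2 / R\<^sup>2 + M * R * real N powr - d / d"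
    using pi_gt_zero by (subst (asm) mult_le_cancel_left_pos) auto
  moreover have "gN 0 = of_real (\<Sum>n=1..N. a n / real n)"
  proof -
    have "npow n 1 = of_real (1 / real n)" if "n \<ge> 1" for n
      using npow_of_real[of n 1] that by (simp add: powr_minus field_simps)
    thus ?thesis unfolding gN_def by (auto simp: intro!: sum.cong)
  qed
  ultimately show ?thesis by simp
qed

section \<open>The prime number theorem with a rate\<close>

text \<open>
  For the contour of radius \<open>R\<close> the width \<open>d\<close> is a multiple of \<open>1 / R ^ 12\<close>; as soon as
  \<open>ln N\<close> exceeds a multiple of \<open>R ^ 13\<close>, the factor \<open>N powr (-d)\<close> is smaller than the needed power
  of \<open>1 / R\<close>.
\<close>

lemma psi_excess_sum_rate:
  "\<exists>C\<ge>1. \<forall>R\<ge>1. \<forall>N::nat. ln (real N) \<ge> C * R ^ 13 \<longrightarrow>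
     norm (excess_series 1 - of_real (\<Sum>n=1..N. psi_excess n / real n)) \<le> C / R"
proof -
  obtain c M where c: "0 < c" "c \<le> 1/4" and M: "M > 0"
    and nz: "\<And>R s. R \<ge> 1 \<Longrightarrow> 1 - c / R ^ 12 \<le> Re s \<Longrightarrow> Re s \<le> 1 \<Longrightarrow> \<bar>Im s\<bar> \<le> R \<Longrightarrow> zeta_reg s \<noteq> 0"
    and gM: "\<And>R s. R \<ge> 1 \<Longrightarrow> 1 - c / R ^ 12 \<le> Re s \<Longrightarrow> Re s \<le> 1 \<Longrightarrow> \<bar>Im s\<bar> \<le> R \<Longrightarrow> norm (excess_series s) \<le> M * R ^ 12"
    using excess_series_bound by metis
  define c2 where "c2 = c / 2 ^ 13"
  have c2: "c2 > 0" "c2 \<le> 1" using c by (auto simp: c2_def)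
  define C where "C = 12 + M * c2\<^sup>2 + M / c2 + 26 / c2"
  have C: "C \<ge> 1" "C \<ge> 26 / c2" using M c2 by (auto simp: C_def add_nonneg_nonneg)
  have "norm (excess_series 1 - of_real (\<Sum>n=1..N. psi_excess n / real n)) \<le> C / R"
    if R: "R \<ge> 1" and lnN: "ln (real N) \<ge> C * R ^ 13" for R N
  proof -
    have N0: "N \<ge> 1"
    proof (rule ccontr)
      assume "\<not> N \<ge> 1"
      hence "N = 0" by simp
      hence "ln (real N) = 0" by simp
      moreover have "C * R ^ 13 > 0" using C R by simp
      ultimately show False using lnN by simp
    qed
    (* the zero-free region of height 2 * R contains the contour of radius R in its interior *)
    define d' where "d' = c / (2 * R) ^ 12"
    define d where "d = c2 / R ^ 12"
    have dd: "d' = 2 * d" by (simp add: d'_def d_def c2_def power_mult_distrib)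
    have R12: "R ^ 12 \<ge> 1" using R by (rule one_le_power)
    have d: "0 < d" "d \<le> 1" using c2 R12 by (auto simp: d_def divide_simps)
    have d'4: "d' \<le> 1/4"
    proof -
      have "c / (2 * R) ^ 12 \<le> c / 1" using c R by (intro divide_left_mono one_le_power) auto
      thus ?thesis using c by (simp add: d'_def)
    qed
    define U where "U = {z. Re z > - d' \<and> \<bar>Im z\<bar> < 2 * R}"
    define V where "V = {s. Re s > 1 - d' \<and> \<bar>Im s\<bar> < 2 * R}"
    have Vo: "open V"
    proof -
      have "V = {z. Re z > 1 - d'} \<inter> {z. Im z < 2 * R} \<inter> {z. Im z > - (2 * R)}" unfolding V_def by auto
      thus ?thesis by (auto intro!: open_Int open_halfspace_Re_gt open_halfspace_Im_lt open_halfspace_Im_gt)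
    qed
    have gV: "excess_series holomorphic_on V"
    proof (rule excess_series_holo[OF Vo])
      fix s assume s: "s \<in> V"
      have "zeta_reg s \<noteq> 0"
      proof (cases "Re s > 1")
        case True thus ?thesis by (rule zeta_reg_nonzero_right)
      next
        case False thus ?thesis using s R nz[of "2 * R" s] by (auto simp: V_def d'_def)
      qed
      thus "Re s > 1/2 \<and> zeta_reg s \<noteq> 0" using s d'4 by (auto simp: V_def)
    qed
    have gU: "(\<lambda>z. excess_series (1 + z)) holomorphic_on U"
    proof -
      have "(excess_series \<circ> (\<lambda>z. 1 + z)) holomorphic_on U"
        by (rule holomorphic_on_compose_gen[OF _ gV]) (auto intro!: holomorphic_intros simp: U_def V_def)
      thus ?thesis by (simp add: o_def)
    qed
    have nb: "norm (excess_series (1 + 0) - of_real (\<Sum>n=1..N. psi_excess n / real n)) \<le>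
      2 * 4 / R + 4 / real N + (M * R ^ 12) * d\<^sup>2 / R\<^sup>2 + (M * R ^ 12) * R * real N powr - d / d"
    proof (rule newman_bound[OF psi_excess_bound _ _ d(1) _ _ U_def gU])
      show "0 < R" "R < 2 * R" "d < d'" "d \<le> R" "1 \<le> N" using R d dd N0 by auto
      show "(\<lambda>n. of_real (psi_excess (Suc n)) * npow (Suc n) (1 + z)) sums excess_series (1 + z)" if "0 < Re z" for z
        by (rule excess_series_sums) (use that in simp)
      show "norm (excess_series (1 + z)) \<le> M * R ^ 12" if "- d \<le> Re z" "Re z \<le> 0" "\<bar>Im z\<bar> \<le> R" for z
      proof (rule gM[OF R])
        have "d \<le> c / R ^ 12" using c R12 by (simp add: d_def c2_def divide_simps)
        thus "1 - c / R ^ 12 \<le> Re (1 + z)" using that by simp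
      qed (use that in auto)
    qed
    have lnR: "ln R \<le> R" using ln_bound[of R] R by simp
    have "R \<le> real N"
    proof -
      have "R ^ 1 \<le> R ^ 13" using R by (intro power_increasing) auto
      also have "\<dots> \<le> C * R ^ 13" using C R by simp
      finally have "ln R \<le> ln (real N)" using lnR lnN by simp
      thus ?thesis using R N0 by simp
    qed
    hence t2: "4 / real N \<le> 4 / R" using R by (intro divide_left_mono) auto
    have R14: "R ^ 1 \<le> R ^ 14" using R by (intro power_increasing) auto
    have R14e: "R ^ 14 = R ^ 12 * R\<^sup>2" and R13e: "R ^ 13 = R ^ 12 * R" and R26e: "R ^ 26 = R ^ 12 * R ^ 12 * R * R"
      by (simp_all flip: power_add power_Suc2)
    have Rp: "R ^ 12 > 0" using R by simp
    have "(M * R ^ 12) * d\<^sup>2 / R\<^sup>2 = M * c2\<^sup>2 / R ^ 14"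
    proof -
      have "(M * r) * (c2 / r)\<^sup>2 / R\<^sup>2 = M * c2\<^sup>2 / (r * R\<^sup>2)" if "r > 0" for r
        using that by (simp add: power2_eq_square)
      thus ?thesis unfolding R14e d_def using Rp by blast
    qed
    also have "\<dots> \<le> M * c2\<^sup>2 / R" using R14 R M by (intro divide_left_mono) auto
    finally have t3: "(M * R ^ 12) * d\<^sup>2 / R\<^sup>2 \<le> M * c2\<^sup>2 / R" .
    have "real N powr - d \<le> 1 / R ^ 26"
    proof -
      have "26 * ln R \<le> 26 * R" using lnR by simp
      also have "\<dots> = (c2 / R ^ 12) * (26 / c2 * R ^ 13)" unfolding R13e using R c2 Rp by simp
      also have "\<dots> \<le> (c2 / R ^ 12) * (C * R ^ 13)" using C c2 R by (intro mult_left_mono mult_right_mono) auto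
      also have "\<dots> \<le> d * ln (real N)" unfolding d_def using lnN c2 R by (intro mult_left_mono) auto
      finally have "exp (- (d * ln (real N))) \<le> exp (- (26 * ln R))" by simp
      also have "exp (- (26 * ln R)) = 1 / R ^ 26"
        using R by (simp add: exp_minus divide_inverse exp_of_nat_mult[of 26, simplified])
      finally show ?thesis using N0 by (simp add: powr_def)
    qed
    hence "(M * R ^ 12) * R * real N powr - d / d \<le> (M * R ^ 12) * R * (1 / R ^ 26) / d"
      using d M R by (intro divide_right_mono mult_left_mono) auto
    also have "\<dots> = M / c2 / R"
    proof -
      have "(M * r) * R * (1 / (r * r * R * R)) / (c2 / r) = M / c2 / R" if "r > 0" for r
        using that R c2 by (simp add: field_simps)
      thus ?thesis unfolding R26e d_def using Rp by blast
    qed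
    finally have t4: "(M * R ^ 12) * R * real N powr - d / d \<le> M / c2 / R" .
    have "norm (excess_series 1 - of_real (\<Sum>n=1..N. psi_excess n / real n)) \<le> 2 * 4 / R + 4 / R + M * c2\<^sup>2 / R + M / c2 / R"
      using nb t2 t3 t4 by simp
    also have "\<dots> = (12 + M * c2\<^sup>2 + M / c2) / R" by (simp add: add_divide_distrib)
    also have "\<dots> \<le> C / R" using R c2 by (intro divide_right_mono) (auto simp: C_def)
    finally show ?thesis .
  qed
  thus ?thesis using C by blast
qed

text \<open>
  If \<open>psi n\<close> differed from \<open>n\<close> by more than \<open>\<eta> * n\<close>, then, \<open>psi\<close> being monotone, the
  summands \<open>(psi k - k) / k\<^sup>2\<close> would have one sign and size at least a multiple of \<open>\<eta> / n\<close>
  for about \<open>\<eta> * n / 2\<close> values of \<open>k\<close> next to \<open>n\<close>. Their sum would exceed what the convergence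
  rate of the series allows.
\<close>

lemma psi_rate:
  "\<exists>C\<ge>1. \<forall>\<eta> n. 0 < \<eta> \<longrightarrow> \<eta> \<le> 1 \<longrightarrow> ln (real n) \<ge> C / \<eta> ^ 26 \<longrightarrow> \<bar>psi n - real n\<bar> \<le> \<eta> * real n"
proof -
  obtain C1 where C1: "C1 \<ge> 1" and rate: "\<And>R N. R \<ge> 1 \<Longrightarrow> ln (real N) \<ge> C1 * R ^ 13 \<Longrightarrow>
     norm (excess_series 1 - of_real (\<Sum>n=1..N. psi_excess n / real n)) \<le> C1 / R"
    using psi_excess_sum_rate by auto
  define C where "C = C1 * (65 * C1) ^ 13 + 4"
  have C: "C \<ge> 1" using C1 by (simp add: C_def)
  have "\<bar>psi n - real n\<bar> \<le> \<eta> * real n" if eta: "0 < \<eta>" "\<eta> \<le> 1" and ln: "ln (real n) \<ge> C / \<eta> ^ 26" for \<eta> n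
  proof -
    (* 65 > 64, so that 2 * C1 / R stays below \<eta>\<^sup>2 / 32 *)
    define R where "R = 65 * C1 / \<eta>\<^sup>2"
    have e2: "\<eta>\<^sup>2 \<le> 1" using eta by (simp add: power_le_one)
    have R: "R \<ge> 1" unfolding R_def using e2 C1 eta by (simp add: le_divide_eq)
    have CR: "C1 * R ^ 13 + 4 / \<eta> ^ 26 = C / \<eta> ^ 26"
      by (simp add: R_def C_def power_divide add_divide_distrib flip: power_mult)
    have e26: "4 / \<eta> \<le> 4 / \<eta> ^ 26"
      using eta power_decreasing[of 1 26 \<eta>] by (intro divide_left_mono) auto
    have four: "4 \<le> 4 / \<eta>" using eta by (simp add: le_divide_eq)
    have n0: "n > 0"
    proof (rule ccontr)
      assume "\<not> n > 0"
      hence "n = 0" by simp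
      hence "ln (real n) = 0" by simp
      moreover have "C / \<eta> ^ 26 > 0" using C eta by simp
      ultimately show False using ln by simp
    qed
    have "ln (real n) \<le> real n" using ln_bound[of "real n"] n0 by simp
    moreover have CRp: "C1 * R ^ 13 \<ge> 0" using C1 R by simp
    ultimately have "4 / \<eta> \<le> real n" using ln CR e26 by linarith
    hence n4: "\<eta> * real n \<ge> 4" using eta by (simp add: pos_divide_le_eq mult.commute)
    define S where "S = (\<lambda>N::nat. \<Sum>n=1..N. psi_excess n / real n)"
    have SR: "\<bar>S N - S m\<bar> \<le> 2 * \<eta>\<^sup>2 / 65" if "real m \<ge> real n / 2" "real N \<ge> real n / 2" for m N
    proof -
      have lnk: "ln (real k) \<ge> C1 * R ^ 13" if "real k \<ge> real n / 2" for k
      proof -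
        have "ln (real n / 2) \<le> ln (real k)" using that n0 by (subst ln_le_cancel_iff) auto
        moreover have "ln (real n / 2) = ln (real n) - ln 2" using n0 by (simp add: ln_div)
        moreover have "ln (2::real) \<le> 1" using ln2_le_25_over_36 by simp
        ultimately show ?thesis using ln CR e26 four by linarith
      qed
      have "\<bar>S N - S m\<bar> = norm (complex_of_real (S N) - of_real (S m))" by (simp flip: of_real_diff)
      also have "\<dots> \<le> norm (excess_series 1 - of_real (S m)) + norm (excess_series 1 - of_real (S N))"
        using norm_triangle_ineq4[of "excess_series 1 - of_real (S m)" "excess_series 1 - of_real (S N)"] by simp
      also have "\<dots> \<le> C1 / R + C1 / R"
        unfolding S_def by (intro add_mono rate R lnk that)
      also have "\<dots> = 2 * \<eta>\<^sup>2 / 65" using C1 eta by (simp add: R_def field_simps)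
      finally show ?thesis .
    qed
    have Sdiff: "S N - S m = (\<Sum>k\<in>{m<..N}. psi_excess k / real k)" if "m \<le> N" for m N
    proof -
      have "{1..N} - {1..m} = {m<..N}" using that by auto
      thus ?thesis unfolding S_def using that by (subst sum_diff[symmetric]) auto
    qed
    have e20: "\<eta>\<^sup>2 > 0" using eta by simp
    have low: "psi n \<ge> (1 - \<eta>) * real n"
    proof (rule ccontr)
      assume "\<not> psi n \<ge> (1 - \<eta>) * real n"
      hence lt: "psi n < (1 - \<eta>) * real n" by simp
      define m where "m = nat \<lceil>(1 - \<eta> / 2) * real n\<rceil>"
      have "(1 - \<eta> / 2) * real n \<ge> 0" using eta by simp
      hence m: "real m \<ge> (1 - \<eta> / 2) * real n" "real m \<le> (1 - \<eta> / 2) * real n + 1" unfolding m_def by linarith+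
      have mn: "real n - real m \<ge> \<eta> * real n / 4" using m n4 by (simp add: algebra_simps)
      hence "real m \<le> real n" using n4 by linarith
      hence mle: "m \<le> n" by simp
      have "\<eta> * real n \<le> 1 * real n" using eta by (intro mult_right_mono) auto
      hence m2: "real m \<ge> real n / 2" using m by (simp add: algebra_simps)
      have "(\<Sum>k\<in>{m<..n}. psi_excess k / real k) \<le> (\<Sum>k\<in>{m<..n}. - (\<eta> / (2 * real n)))"
      proof (rule sum_mono)
        fix k assume k: "k \<in> {m<..n}"
        hence k0: "k > 0" "real k \<le> real n" "real k \<ge> real m" by auto
        have "psi k \<le> (1 - \<eta>) * real n" using psi_mono[of k n] k lt by simp
        hence v: "real k - psi k \<ge> \<eta> * real n / 2" using m k0 by (simp add: algebra_simps)
        have "(\<eta> * real n / 2) / (real n * real n) \<le> (real k - psi k) / (real k * real k)"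
          using v k0 n4 by (intro frac_le mult_mono) auto
        moreover have "(\<eta> * real n / 2) / (real n * real n) = \<eta> / (2 * real n)" using n0 by simp
        moreover have "psi_excess k / real k = - ((real k - psi k) / (real k * real k))"
          unfolding minus_divide_left minus_diff_eq by (simp add: psi_excess_def)
        ultimately show "psi_excess k / real k \<le> - (\<eta> / (2 * real n))" by linarith
      qed
      also have "\<dots> = - ((real n - real m) * (\<eta> / (2 * real n)))" using mle by (simp add: of_nat_diff)
      finally have "S n - S m \<le> - ((real n - real m) * (\<eta> / (2 * real n)))" using Sdiff[OF mle] by simp
      moreover have "(real n - real m) * (\<eta> / (2 * real n)) \<ge> (\<eta> * real n / 4) * (\<eta> / (2 * real n))"
        using mn eta by (intro mult_right_mono) auto
      moreover have "(\<eta> * real n / 4) * (\<eta> / (2 * real n)) = \<eta>\<^sup>2 / 8" using n0 by (simp add: power2_eq_square)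
      ultimately have "S n - S m \<le> - (\<eta>\<^sup>2 / 8)" by linarith
      moreover have "\<bar>S n - S m\<bar> \<le> 2 * \<eta>\<^sup>2 / 65" by (rule SR) (use m2 in auto)
      ultimately show False using e20 by linarith
    qed
    have up: "psi n \<le> (1 + \<eta>) * real n"
    proof (rule ccontr)
      assume "\<not> psi n \<le> (1 + \<eta>) * real n"
      hence gt: "psi n > (1 + \<eta>) * real n" by simp
      define m where "m = nat \<lfloor>(1 + \<eta> / 2) * real n\<rfloor>"
      have "(1 + \<eta> / 2) * real n \<ge> 0" using eta by simp
      hence m: "real m \<le> (1 + \<eta> / 2) * real n" "real m \<ge> (1 + \<eta> / 2) * real n - 1" unfolding m_def by linarith+
      have mn: "real m - real n \<ge> \<eta> * real n / 4" using m n4 by (simp add: algebra_simps)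
      hence "real n \<le> real m" using n4 by linarith
      hence mle: "n \<le> m" by simp
      have "\<eta> * real n \<le> 1 * real n" using eta by (intro mult_right_mono) auto
      hence m2: "real m \<le> 2 * real n" using m by (simp add: algebra_simps)
      have "(\<Sum>k\<in>{n<..m}. psi_excess k / real k) \<ge> (\<Sum>k\<in>{n<..m}. \<eta> / (8 * real n))"
      proof (rule sum_mono)
        fix k assume k: "k \<in> {n<..m}"
        hence k0: "k > 0" "real k \<le> real m" "real k \<ge> real n" by auto
        have "psi k \<ge> (1 + \<eta>) * real n" using psi_mono[of n k] k gt by simp
        hence v: "psi k - real k \<ge> \<eta> * real n / 2" using m k0 by (simp add: algebra_simps)
        have "(\<eta> * real n / 2) / ((2 * real n) * (2 * real n)) \<le> (psi k - real k) / (real k * real k)"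
          using v k0 n4 m2 by (intro frac_le mult_mono) auto
        moreover have "(\<eta> * real n / 2) / ((2 * real n) * (2 * real n)) = \<eta> / (8 * real n)" using n0 by simp
        moreover have "psi_excess k / real k = (psi k - real k) / (real k * real k)"
          by (simp add: psi_excess_def)
        ultimately show "\<eta> / (8 * real n) \<le> psi_excess k / real k" by linarith
      qed
      moreover have "(\<Sum>k\<in>{n<..m}. \<eta> / (8 * real n)) = (real m - real n) * (\<eta> / (8 * real n))"
        using mle by (simp add: of_nat_diff)
      moreover have "(real m - real n) * (\<eta> / (8 * real n)) \<ge> (\<eta> * real n / 4) * (\<eta> / (8 * real n))"
        using mn eta by (intro mult_right_mono) auto
      moreover have "(\<eta> * real n / 4) * (\<eta> / (8 * real n)) = \<eta>\<^sup>2 / 32" using n0 by (simp add: power2_eq_square)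
      ultimately have "S m - S n \<ge> \<eta>\<^sup>2 / 32" using Sdiff[OF mle] by linarith
      moreover have "\<bar>S m - S n\<bar> \<le> 2 * \<eta>\<^sup>2 / 65" by (rule SR) (use mle in auto)
      ultimately show False using e20 by linarith
    qed
    show ?thesis using low up by (simp add: abs_le_iff algebra_simps)
  qed
  thus ?thesis using C by blast
qed

theorem theta_rate:
  "\<exists>C\<ge>1. \<forall>\<eta> n. 0 < \<eta> \<longrightarrow> \<eta> \<le> 1 \<longrightarrow> ln (real n) \<ge> C / \<eta> ^ 26 \<longrightarrow> \<bar>theta n - real n\<bar> \<le> \<eta> * real n"
proof -
  obtain C where C: "C \<ge> 1" and psi: "\<And>\<eta> n. 0 < \<eta> \<Longrightarrow> \<eta> \<le> 1 \<Longrightarrow> ln (real n) \<ge> C / \<eta> ^ 26 \<Longrightarrow> \<bar>psi n - real n\<bar> \<le> \<eta> * real n"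
    using psi_rate by auto
  define C' where "C' = C * 2 ^ 26 + 4096"
  have C': "C' \<ge> 1" using C by (simp add: C'_def)
  have "\<bar>theta n - real n\<bar> \<le> \<eta> * real n" if eta: "0 < \<eta>" "\<eta> \<le> 1" and ln: "ln (real n) \<ge> C' / \<eta> ^ 26" for \<eta> n
  proof -
    have sp: "C' / \<eta> ^ 26 = C / (\<eta> / 2) ^ 26 + 4096 / \<eta> ^ 26" by (simp add: C'_def power_divide add_divide_distrib)
    have p: "C / (\<eta> / 2) ^ 26 \<ge> 0" "4096 / \<eta> ^ 26 > 0" using C eta by auto
    have n0: "n > 0"
    proof (rule ccontr)
      assume "\<not> n > 0"
      hence "n = 0" by simp
      hence "ln (real n) = 0" by simp
      thus False using ln sp p by simp
    qed
    have a: "\<bar>psi n - real n\<bar> \<le> \<eta> / 2 * real n"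
    proof (rule psi)
      show "C / (\<eta> / 2) ^ 26 \<le> ln (real n)" using ln sp p by linarith
    qed (use eta in auto)
    have "4096 / \<eta> \<le> 4096 / \<eta> ^ 26"
      using eta power_decreasing[of 1 26 \<eta>] by (intro divide_left_mono) auto
    hence "4096 / \<eta> \<le> ln (real n)" using ln sp p by linarith
    moreover have "ln (real n) \<le> real n powr (1/4) / (1/4)" using n0 by (intro ln_powr_bound) auto
    ultimately have "1024 / \<eta> \<le> real n powr (1/4)" by simp
    hence "1024 \<le> \<eta> * real n powr (1/4)" using eta by (simp add: field_simps)
    hence "1024 * real n powr (3/4) \<le> \<eta> * real n powr (1/4) * real n powr (3/4)"
      by (intro mult_right_mono) auto
    also have "\<dots> = \<eta> * real n" using n0 by (simp add: mult.assoc powr_add[symmetric])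
    finally have "512 * real n powr (3/4) \<le> \<eta> / 2 * real n" by simp
    moreover have "psi n - theta n \<le> 512 * real n powr (3/4)" using n0 by (intro psi_minus_theta_le) simp
    ultimately show ?thesis using a theta_le_psi[of n] by linarith
  qed
  thus ?thesis using C' by blast
qed

section \<open>Recurrences from the pigeonhole principle\<close>

definition primorial :: "nat \<Rightarrow> nat" where "primorial n = \<Prod>{p. prime p \<and> p \<le> n}"

lemma finite_primes_le: "finite {p::nat. prime p \<and> p \<le> n}"
  by (rule finite_subset[of _ "{..n}"]) auto

lemma primorial_pos: "primorial n > 0"
  unfolding primorial_def by (intro prod_pos) (auto dest: prime_gt_0_nat)

lemma ln_primorial: "ln (real (primorial n)) = theta n"
proof -
  have "ln (real (primorial n)) = ln (\<Prod>p | prime p \<and> p \<le> n. real p)" by (simp add: primorial_def)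
  also have "\<dots> = theta n" unfolding theta_def
    using finite_primes_le by (subst ln_prod) (auto dest: prime_gt_0_nat)
  finally show ?thesis .
qed

lemma primorial_eq_exp: "real (primorial n) = exp (theta n)"
  using ln_primorial[of n] primorial_pos[of n] by (metis exp_ln of_nat_0_less_iff)

lemma primorial_dvd:
  assumes "\<And>p. prime p \<Longrightarrow> p \<le> n \<Longrightarrow> int p dvd x"
  shows "int (primorial n) dvd x"
proof -
  have "int (\<Prod>A) dvd x" if "finite A" "A \<subseteq> {p. prime p \<and> p \<le> n}" for A
    using that
  proof (induction A rule: finite_induct)
    case (insert p A)
    have "coprime p (\<Prod>A)"
      using insert by (intro prod_coprime_right) (auto intro!: primes_coprime)
    hence "coprime (int p) (int (\<Prod>A))" by (simp only: coprime_int_iff)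
    thus ?case using insert assms[of p] by (auto intro: divides_mult)
  qed auto
  thus ?thesis unfolding primorial_def using finite_primes_le by blast
qed

definition linear_form :: "(nat \<Rightarrow> int) \<Rightarrow> nat \<Rightarrow> nat \<Rightarrow> (nat \<times> nat \<Rightarrow> int) \<Rightarrow> nat \<Rightarrow> int" where
  "linear_form a S d q n = (\<Sum>j\<le>S. \<Sum>i<d. q (j, i) * int n ^ i * a (n + j))"

lemma linear_form_cong:
  assumes "primary_pseudo_polynomial a" "prime p"
  shows "[linear_form a S d q (n + p) = linear_form a S d q n] (mod int p)"
  unfolding linear_form_def
proof (intro cong_sum cong_mult cong_pow cong_refl)
  fix j
  show "[int (n + p) = int n] (mod int p)" by (simp add: Cong.cong_def)
  have "[a ((n + j) + p) = a (n + j)] (mod int p)"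
    using assms unfolding primary_pseudo_polynomial_def by blast
  thus "[a (n + p + j) = a (n + j)] (mod int p)" by (simp add: add_ac)
qed

lemma linear_form_diff: "linear_form a S d (\<lambda>x. q x - r x) n = linear_form a S d q n - linear_form a S d r n"
  by (simp add: linear_form_def sum_subtractf algebra_simps)

text \<open>
  A linear form inherits the congruences of \<open>a\<close>, so its value at \<open>n\<close> is congruent to its value
  at \<open>n - p\<close>, which is \<open>0\<close>, for every prime \<open>p \<le> n\<close>.
\<close>

lemma linear_form_dvd:
  assumes a: "primary_pseudo_polynomial a" and z: "\<And>m. m < n \<Longrightarrow> linear_form a S d q m = 0"
  shows "int (primorial n) dvd linear_form a S d q n"
proof (rule primorial_dvd)
  fix p :: nat assume p: "prime p" "p \<le> n"
  have "[linear_form a S d q ((n - p) + p) = linear_form a S d q (n - p)] (mod int p)"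
    by (rule linear_form_cong[OF a p(1)])
  moreover have "linear_form a S d q (n - p) = 0" using p prime_gt_0_nat[OF p(1)] by (intro z) auto
  ultimately show "int p dvd linear_form a S d q n" using p by (simp add: cong_0_iff)
qed

lemma linear_form_bound:
  assumes a: "\<And>n. \<bar>real_of_int (a n)\<bar> \<le> c * exp (u * real n)" and u: "u \<ge> 0" and c: "c \<ge> 0"
    and q: "\<And>j i. j \<le> S \<Longrightarrow> i < d \<Longrightarrow> \<bar>real_of_int (q (j, i))\<bar> \<le> X" and X: "X \<ge> 0"
  shows "\<bar>real_of_int (linear_form a S d q n)\<bar> \<le> X * (real (S + 1) * real d * c * real (n + 1) ^ (d - 1) * exp (u * real (n + S)))"
proof -
  have "\<bar>real_of_int (linear_form a S d q n)\<bar> \<le> (\<Sum>j\<le>S. \<Sum>i<d. \<bar>real_of_int (q (j, i)) * real n ^ i * real_of_int (a (n + j))\<bar>)"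
    unfolding linear_form_def of_int_sum of_int_mult of_int_power of_int_of_nat_eq
    by (intro order_trans[OF sum_abs] sum_mono order_refl)
  also have "\<dots> \<le> (\<Sum>j\<le>S. \<Sum>i<d. X * real (n + 1) ^ (d - 1) * (c * exp (u * real (n + S))))"
  proof (intro sum_mono)
    fix j i assume ji: "j \<in> {..S}" "i \<in> {..<d}"
    have 1: "real n ^ i \<le> real (n + 1) ^ (d - 1)"
    proof -
      have "real n ^ i \<le> real (n + 1) ^ i" by (intro power_mono) auto
      also have "\<dots> \<le> real (n + 1) ^ (d - 1)" using ji by (intro power_increasing) auto
      finally show ?thesis .
    qed
    have "\<bar>real_of_int (a (n + j))\<bar> \<le> c * exp (u * real (n + j))" by (rule a)
    also have "\<dots> \<le> c * exp (u * real (n + S))"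
      using ji u c by (intro mult_left_mono exp_le_cancel_iff[THEN iffD2]) auto
    finally have 2: "\<bar>real_of_int (a (n + j))\<bar> \<le> c * exp (u * real (n + S))" .
    show "\<bar>real_of_int (q (j, i)) * real n ^ i * real_of_int (a (n + j))\<bar> \<le> X * real (n + 1) ^ (d - 1) * (c * exp (u * real (n + S)))"
      unfolding abs_mult using ji q[of j i] 1 2 X by (intro mult_mono) auto
  qed
  also have "\<dots> = X * (real (S + 1) * real d * c * real (n + 1) ^ (d - 1) * exp (u * real (n + S)))"
    by (simp add: algebra_simps)
  finally show ?thesis .
qed

lemma card_congruent_le:
  fixes V :: "int set"
  assumes V: "finite V" "V \<noteq> {}" and m: "m > 0" and cg: "\<And>v w. v \<in> V \<Longrightarrow> w \<in> V \<Longrightarrow> m dvd v - w"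
    and L: "\<And>v. v \<in> V \<Longrightarrow> \<bar>real_of_int v\<bar> \<le> L"
  shows "real (card V) \<le> 1 + 2 * L / real_of_int m"
proof -
  define v0 where "v0 = Min V"
  have v0: "v0 \<in> V" "\<And>v. v \<in> V \<Longrightarrow> v0 \<le> v" using V by (auto simp: v0_def)
  define K where "K = nat \<lfloor>2 * L / real_of_int m\<rfloor>"
  have L0: "L \<ge> 0" using L[OF v0(1)] by linarith
  have "inj_on (\<lambda>v. nat ((v - v0) div m)) V"
  proof (rule inj_onI)
    fix v w assume vw: "v \<in> V" "w \<in> V" "nat ((v - v0) div m) = nat ((w - v0) div m)"
    have "(v - v0) div m \<ge> 0" "(w - v0) div m \<ge> 0" using v0 vw m by (auto simp: pos_imp_zdiv_nonneg_iff)
    with vw have "(v - v0) div m = (w - v0) div m" by simp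
    moreover have "((v - v0) div m) * m = v - v0" "((w - v0) div m) * m = w - v0"
      by (rule dvd_div_mult_self[OF cg[OF vw(1) v0(1)]], rule dvd_div_mult_self[OF cg[OF vw(2) v0(1)]])
    ultimately have "v - v0 = w - v0" by metis
    thus "v = w" by simp
  qed
  moreover have "(\<lambda>v. nat ((v - v0) div m)) ` V \<subseteq> {..K}"
  proof safe
    fix v assume v: "v \<in> V"
    have "real_of_int (v - v0) \<le> 2 * L" unfolding of_int_diff using L[OF v] L[OF v0(1)] by linarith
    moreover have "((v - v0) div m) * m = v - v0" by (rule dvd_div_mult_self[OF cg[OF v v0(1)]])
    hence "real_of_int (v - v0) = real_of_int ((v - v0) div m) * real_of_int m" by (metis of_int_mult)
    ultimately have "real_of_int ((v - v0) div m) \<le> 2 * L / real_of_int m"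
      using m by (simp add: pos_le_divide_eq)
    hence "(v - v0) div m \<le> \<lfloor>2 * L / real_of_int m\<rfloor>" by (simp add: le_floor_iff)
    thus "nat ((v - v0) div m) \<le> K" unfolding K_def by (rule nat_mono)
  qed
  ultimately have "card V \<le> card {..K}" by (meson card_inj_on_le finite_atMost)
  hence "real (card V) \<le> real K + 1" by simp
  also have "real K \<le> 2 * L / real_of_int m" unfolding K_def using L0 m by (simp add: zero_le_floor)
  finally show ?thesis by simp
qed

lemma max_fibre:
  assumes "finite T" "T \<noteq> {}"
  shows "\<exists>v\<in>f ` T. card T \<le> card (f ` T) * card {x\<in>T. f x = v}"
proof (rule ccontr)
  assume "\<not> ?thesis"
  hence lt: "card (f ` T) * card {x\<in>T. f x = v} < card T" if "v \<in> f ` T" for v using that by (meson not_le)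
  have cp: "card (f ` T) > 0" using assms by (simp add: card_gt_0_iff)
  have "T = (\<Union>v\<in>f ` T. {x\<in>T. f x = v})" by auto
  hence "card T = card (\<Union>v\<in>f ` T. {x\<in>T. f x = v})" by simp
  also have "\<dots> = (\<Sum>v\<in>f ` T. card {x\<in>T. f x = v})"
    using assms by (intro card_UN_disjoint) auto
  finally have "card (f ` T) * card T = (\<Sum>v\<in>f ` T. card (f ` T) * card {x\<in>T. f x = v})"
    by (simp add: sum_distrib_left)
  also have "\<dots> < (\<Sum>v\<in>f ` T. card T)"
    using assms lt by (intro sum_strict_mono) auto
  finally show False by simp
qed

text \<open>
  One coordinate is fixed at a time. Among vectors that agree on the coordinates below \<open>n\<close>, the
  \<open>n\<close>-th coordinates lie in one residue class modulo \<open>m n\<close>, so keeping the most frequent value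
  loses at most the factor \<open>1 + 2 * L n / m n\<close>.
\<close>

lemma successive_pigeonhole:
  fixes f :: "'a \<Rightarrow> nat \<Rightarrow> int"
  assumes T: "finite T" "T \<noteq> {}" and m: "\<And>n. m n > 0"
    and cg: "\<And>q r n. q \<in> T \<Longrightarrow> r \<in> T \<Longrightarrow> (\<And>k. k < n \<Longrightarrow> f q k = f r k) \<Longrightarrow> m n dvd f q n - f r n"
    and L: "\<And>q n. q \<in> T \<Longrightarrow> \<bar>real_of_int (f q n)\<bar> \<le> L n"
  shows "\<exists>T'\<subseteq>T. T' \<noteq> {} \<and> real (card T) \<le> real (card T') * (\<Prod>n<N. 1 + 2 * L n / real_of_int (m n))
     \<and> (\<forall>q\<in>T'. \<forall>r\<in>T'. \<forall>n<N. f q n = f r n)"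
proof (induction N)
  case 0
  show ?case by (rule exI[of _ T]) (use T in auto)
next
  case (Suc N)
  then obtain T' where T': "T' \<subseteq> T" "T' \<noteq> {}" "real (card T) \<le> real (card T') * (\<Prod>n<N. 1 + 2 * L n / real_of_int (m n))"
    "\<And>q r n. q \<in> T' \<Longrightarrow> r \<in> T' \<Longrightarrow> n < N \<Longrightarrow> f q n = f r n" by blast
  have fin: "finite T'" using T'(1) T(1) by (rule finite_subset)
  have P0: "(\<Prod>n<N. 1 + 2 * L n / real_of_int (m n)) \<ge> 0"
  proof (rule prod_nonneg)
    fix n
    obtain q where "q \<in> T" using T by auto
    hence "L n \<ge> 0" using L[of q n] by linarith
    thus "1 + 2 * L n / real_of_int (m n) \<ge> 0" using m[of n] by simp
  qed
  obtain v where v: "v \<in> (\<lambda>q. f q N) ` T'" "card T' \<le> card ((\<lambda>q. f q N) ` T') * card {x\<in>T'. f x N = v}"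
    using max_fibre[OF fin T'(2), of "\<lambda>q. f q N"] by auto
  define T2 where "T2 = {x\<in>T'. f x N = v}"
  have "real (card ((\<lambda>q. f q N) ` T')) \<le> 1 + 2 * L N / real_of_int (m N)"
  proof (rule card_congruent_le)
    show "m N dvd x - y" if "x \<in> (\<lambda>q. f q N) ` T'" "y \<in> (\<lambda>q. f q N) ` T'" for x y
    proof -
      from that obtain q r where "q \<in> T'" "r \<in> T'" "x = f q N" "y = f r N" by blast
      thus ?thesis using cg[of q r N] T'(1,4) by blast
    qed
    show "\<bar>real_of_int x\<bar> \<le> L N" if "x \<in> (\<lambda>q. f q N) ` T'" for x
      using that T'(1) L by blast
    show "finite ((\<lambda>q. f q N) ` T')" "(\<lambda>q. f q N) ` T' \<noteq> {}" "m N > 0" using fin T'(2) m by auto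
  qed
  then have "real (card T') \<le> (1 + 2 * L N / real_of_int (m N)) * real (card T2)"
  proof -
    assume le: "real (card ((\<lambda>q. f q N) ` T')) \<le> 1 + 2 * L N / real_of_int (m N)"
    have "real (card T') \<le> real (card ((\<lambda>q. f q N) ` T')) * real (card T2)"
      using of_nat_mono[OF v(2), where 'a=real] unfolding T2_def[symmetric] by (simp only: of_nat_mult)
    also have "\<dots> \<le> (1 + 2 * L N / real_of_int (m N)) * real (card T2)"
      using le by (intro mult_right_mono) auto
    finally show "real (card T') \<le> (1 + 2 * L N / real_of_int (m N)) * real (card T2)" .
  qed
  from mult_right_mono[OF this P0]
  have "real (card T') * (\<Prod>n<N. 1 + 2 * L n / real_of_int (m n))
     \<le> real (card T2) * (\<Prod>n<Suc N. 1 + 2 * L n / real_of_int (m n))"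
    unfolding prod.lessThan_Suc by (simp only: mult_ac)
  with T'(3) have c1: "real (card T) \<le> real (card T2) * (\<Prod>n<Suc N. 1 + 2 * L n / real_of_int (m n))"
    by (rule order_trans)
  have c2: "T2 \<subseteq> T" using T'(1) unfolding T2_def by blast
  have c3: "T2 \<noteq> {}" using v(1) unfolding T2_def by blast
  have c4: "\<forall>q\<in>T2. \<forall>r\<in>T2. \<forall>n<Suc N. f q n = f r n"
  proof (intro ballI allI impI)
    fix q r n assume q: "q \<in> T2" "r \<in> T2" "n < Suc N"
    show "f q n = f r n"
    proof (cases "n < N")
      case True thus ?thesis using T'(4)[of q r n] q by (simp add: T2_def)
    next
      case False hence "n = N" using q by simp
      thus ?thesis using q by (simp add: T2_def)
    qed
  qed
  show ?case using c1 c2 c3 c4 by (intro exI[of _ T2] conjI)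
qed

text \<open>
  The sum over the positive part of a decreasing arithmetic progression.
\<close>

lemma sum_max_linear:
  fixes \<mu> Y :: real
  assumes "\<mu> > 0"
  shows "(\<Sum>n<N. max (Y - \<mu> * real n) 0) \<le> max Y 0 + (max Y 0)\<^sup>2 / (2 * \<mu>)"
proof (induction N arbitrary: Y)
  case (Suc N)
  have "(\<Sum>n<Suc N. max (Y - \<mu> * real n) 0) = max Y 0 + (\<Sum>n<N. max ((Y - \<mu>) - \<mu> * real n) 0)"
  proof -
    have "Y - \<mu> * real (Suc n) = (Y - \<mu>) - \<mu> * real n" for n by (simp add: distrib_left)
    thus ?thesis by (subst sum.lessThan_Suc_shift) (simp only: of_nat_0 mult_zero_right diff_zero)
  qed
  also have "\<dots> \<le> max Y 0 + (max (Y - \<mu>) 0 + (max (Y - \<mu>) 0)\<^sup>2 / (2 * \<mu>))"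
    using Suc.IH[of "Y - \<mu>"] by simp
  also have "max (Y - \<mu>) 0 + (max (Y - \<mu>) 0)\<^sup>2 / (2 * \<mu>) \<le> (max Y 0)\<^sup>2 / (2 * \<mu>)"
  proof (cases "Y \<ge> \<mu>")
    case True
    define q where "q = Y\<^sup>2 / (2 * \<mu>)"
    have "Y\<^sup>2 = q * (2 * \<mu>)" using assms by (simp add: q_def)
    moreover have "(q - Y + \<mu> / 2) * (2 * \<mu>) = q * (2 * \<mu>) - 2 * (Y * \<mu>) + \<mu> * \<mu>"
      by (simp add: left_diff_distrib distrib_right)
    moreover have "(Y - \<mu>)\<^sup>2 = Y\<^sup>2 - 2 * (Y * \<mu>) + \<mu> * \<mu>" by (simp add: power2_eq_square algebra_simps)
    ultimately have "(Y - \<mu>)\<^sup>2 = (q - Y + \<mu> / 2) * (2 * \<mu>)" by linarith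
    hence "(Y - \<mu>)\<^sup>2 / (2 * \<mu>) = Y\<^sup>2 / (2 * \<mu>) - Y + \<mu> / 2"
      using assms unfolding q_def[symmetric] by simp
    moreover have "max (Y - \<mu>) 0 = Y - \<mu>" "max Y 0 = Y" using True assms by auto
    ultimately show ?thesis using assms by simp
  next
    case False
    hence "max (Y - \<mu>) 0 = 0" by simp
    thus ?thesis using assms by simp
  qed
  finally show ?case by simp
qed (use assms in simp)

lemma recurrence_of_linear_form:
  assumes nz: "\<exists>j\<le>S. \<exists>i<d. q (j, i) \<noteq> 0" and z: "\<And>n. linear_form a S d q n = 0"
  defines "p \<equiv> (\<lambda>j. \<Sum>i<d. monom (q (j, i)) i)"
  shows "satisfies_recurrence a S p" "degree (p j) \<le> d - 1" "coeff (p j) i = (if i < d then q (j, i) else 0)"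
proof -
  have co: "coeff (p j) i = (if i < d then q (j, i) else 0)" for j i
    by (simp add: p_def coeff_sum)
  show "coeff (p j) i = (if i < d then q (j, i) else 0)" by (rule co)
  show "degree (p j) \<le> d - 1" by (rule degree_le) (auto simp: co)
  obtain j i where ji: "j \<le> S" "i < d" "q (j, i) \<noteq> 0" using nz by blast
  hence "p j \<noteq> 0" using co[of j i] by auto
  moreover have "(\<Sum>j\<le>S. poly (p j) (int n) * a (n + j)) = linear_form a S d q n" for n
    by (simp add: linear_form_def p_def poly_sum poly_monom sum_distrib_right)
  ultimately show "satisfies_recurrence a S p" unfolding satisfies_recurrence_def using ji z by auto
qed

lemma ln_le_tangent: "t > 0 \<Longrightarrow> x > 0 \<Longrightarrow> ln x \<le> x / t + ln t - (1::real)"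
  using ln_le_minus_one[of "x / t"] by (simp add: ln_div)

text \<open>
  In the proof, \<open>\<mu>\<close> is \<open>1 - u\<close> diminished by what the error in \<open>theta\<close> and the polynomial
  factors in \<open>n\<close> cost, and \<open>Y - \<mu> * n\<close> bounds \<open>ln (A n / primorial n)\<close>. So the values
  matter only for \<open>n\<close> up to about \<open>Y / \<mu>\<close>, and the logarithm of the number of possible value
  vectors is about \<open>Y\<^sup>2 / (2 * \<mu>)\<close>. The assumption on \<open>S\<close> makes \<open>Y\<close> nearly
  \<open>2 * u * S\<close>; since \<open>u / \<mu> = d / 3\<close>, this is about \<open>2 / 3\<close> of \<open>d * u * S\<^sup>2\<close>.
\<close>

theorem recurrence_exists:
  fixes a :: "nat \<Rightarrow> int" and d S :: nat and c N0 :: real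
  assumes a: "primary_pseudo_polynomial a" and d: "d \<ge> 1" and c: "c \<ge> 1" and N0: "N0 \<ge> 0"
  defines "u \<equiv> real d / (real d + 4)"
  assumes ab: "\<And>n. \<bar>real_of_int (a n)\<bar> \<le> c * exp (u * real n)"
    and th: "\<And>n. theta n \<ge> (1 - 1 / (2 * (real d + 4))) * real n - N0"
    and S: "real S \<ge> 200000 + 200 * (real d + c + (1 + 2 * (real d)\<^sup>2 * (real d + 4)) + N0)"
  shows "\<exists>p. satisfies_recurrence a S p \<and> (\<forall>j. degree (p j) \<le> d - 1) \<and> (\<forall>j\<le>S. \<forall>i. \<bar>real_of_int (coeff (p j) i)\<bar> \<le> exp (real S))"
proof -
  define \<kappa> where "\<kappa> = 1 / (2 * (real d + 4))"
  define \<mu> where "\<mu> = 3 / (real d + 4)"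
  define C1 where "C1 = 1 + 2 * (real d)\<^sup>2 * (real d + 4)"
  define C2 where "C2 = real d + c + C1 + N0"
  have d1: "real d \<ge> 1" using d by simp
  have u: "u \<ge> 1/5" "u \<le> 1" "u > 0" using d1 by (auto simp: u_def divide_simps)
  have ud: "u * (real d + 4) = real d" using d1 by (simp add: u_def)
  have mu: "\<mu> > 0" using d1 by (simp add: \<mu>_def)
  have k: "\<kappa> > 0" "\<kappa> \<le> 1" using d1 by (auto simp: \<kappa>_def divide_simps)
  have ukm: "1 - u - 2 * \<kappa> = \<mu>"
  proof -
    have "1 - x / (x + 4) - 2 * (1 / (2 * (x + 4))) = 3 / (x + 4)" if "x \<ge> 1" for x :: real
    proof -
      have "((x + 4) - x - 1) / (x + 4) = (x + 4) / (x + 4) - x / (x + 4) - 1 / (x + 4)" by (simp only: diff_divide_distrib)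
      moreover have "2 * (1 / (2 * y)) = 1 / y" for y :: real by simp
      moreover have "(x + 4) / (x + 4) = 1" "(x + 4) - x - 1 = 3" using that by simp_all
      ultimately show ?thesis by metis
    qed
    from this[OF d1] show ?thesis by (simp only: u_def \<kappa>_def \<mu>_def)
  qed
  have C1: "C1 \<ge> 0" using d1 by (simp add: C1_def)
  have C20: "C2 \<ge> 0" using d1 c C1 N0 by (simp add: C2_def)
  have S2: "real S \<ge> 200000 + 200 * C2" using S by (simp add: C2_def C1_def)
  hence S0: "real S \<ge> 200000" using C20 by simp
  have lnS: "ln (real (S + 1)) \<le> real S / 200"
  proof -
    have "ln (real (S + 1)) = 2 * ln (sqrt (real (S + 1)))" by (subst ln_sqrt) simp_all
    also have "ln (sqrt (real (S + 1))) \<le> sqrt (real (S + 1))" by (intro ln_bound) simp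
    also have "sqrt (real (S + 1)) \<le> real S / 400"
    proof (rule real_le_lsqrt)
      define q where "q = real S * real S"
      have "200000 * real S \<le> q" unfolding q_def using S0 by (intro mult_right_mono) auto
      moreover have "real (S + 1) * 160000 \<le> 200000 * real S" using S0 by simp
      ultimately have "real (S + 1) * 160000 \<le> q" by (rule order_trans[rotated])
      hence "real (S + 1) \<le> q / 160000" by (rule mult_imp_le_div_pos[rotated]) simp
      also have "q / 160000 = (real S / 400)\<^sup>2" by (simp add: q_def power2_eq_square)
      finally show "real (S + 1) \<le> (real S / 400)\<^sup>2" .
    qed auto
    finally show ?thesis by simp
  qed
  (* C2 and the logarithm are at most S / 200 each, hence at most u * S / 20 together, as u \<ge> 1 / 5 *)
  define Y where "Y = 2 * u * real S + C2 + ln (real (S + 1))"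
  have Y0: "Y \<ge> 0" using u C20 by (simp add: Y_def)
  have Yle: "Y \<le> 41/20 * (u * real S)"
  proof -
    have "1/5 * real S \<le> u * real S" using u by (intro mult_right_mono) auto
    moreover have "Y = 2 * (u * real S) + C2 + ln (real (S + 1))" by (simp add: Y_def)
    ultimately show ?thesis using S2 lnS C20 by linarith
  qed
  define X where "X = nat \<lfloor>exp (u * real S)\<rfloor>"
  have X: "real X \<le> exp (u * real S)" "exp (u * real S) \<le> real X + 1" unfolding X_def by (simp, linarith)
  have logpart: "real (d - 1) * ln (real (n + 1)) \<le> \<kappa> * real n + C1" for n
  proof (cases "d = 1")
    case True thus ?thesis using k C1 by simp
  next
    case False
    define t where "t = real (d - 1) / \<kappa>"
    have d2: "real (d - 1) > 0" using False d by simp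
    have t: "t > 0" using d2 k by (simp add: t_def)
    have te: "t = 2 * real (d - 1) * (real d + 4)" by (simp add: t_def \<kappa>_def)
    have "ln t \<le> t" using t by (rule ln_bound)
    also have "t \<le> 2 * real d * (real d + 4)" unfolding te using d1 by (intro mult_mono) auto
    finally have lt: "ln t \<le> 2 * real d * (real d + 4)" .
    have "ln (real (n + 1)) \<le> real (n + 1) / t + ln t - 1" by (rule ln_le_tangent[OF t]) simp
    hence "real (d - 1) * ln (real (n + 1)) \<le> real (d - 1) * (real (n + 1) / t + ln t - 1)"
      using d2 by (intro mult_left_mono) auto
    also have "\<dots> = \<kappa> * real (n + 1) + real (d - 1) * (ln t - 1)"
      using d2 k by (simp add: t_def field_simps)
    also have "real (d - 1) * (ln t - 1) \<le> real d * (2 * real d * (real d + 4))"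
    proof -
      have "real (d - 1) * (ln t - 1) \<le> real (d - 1) * (2 * real d * (real d + 4))"
        using lt d2 by (intro mult_left_mono) auto
      also have "\<dots> \<le> real d * (2 * real d * (real d + 4))" by (intro mult_right_mono) auto
      finally show ?thesis .
    qed
    finally show ?thesis using k by (simp add: C1_def power2_eq_square algebra_simps)
  qed
  define A where "A = (\<lambda>n. exp (u * real S) * (real (S + 1) * real d * c * real (n + 1) ^ (d - 1) * exp (u * real (n + S))))"
  have Ale: "A n / real (primorial n) \<le> exp (Y - \<mu> * real n)" for n
  proof -
    have "A n = exp (u * real S + (ln (real (S + 1)) + ln (real d) + ln c + real (d - 1) * ln (real (n + 1)) + u * real (n + S)))"
    proof -
      have "exp (real (d - 1) * ln (real (n + 1))) = exp (ln (real (n + 1))) ^ (d - 1)" by (rule exp_of_nat_mult)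
      also have "exp (ln (real (n + 1))) = real (n + 1)" by (rule exp_ln) simp
      finally have pw: "exp (real (d - 1) * ln (real (n + 1))) = real (n + 1) ^ (d - 1)" .
      have "exp (ln (real (S + 1))) = real (S + 1)" by (rule exp_ln) simp
      moreover have "exp (ln (real d)) = real d" "exp (ln c) = c" using d1 c by simp_all
      ultimately show ?thesis by (simp only: A_def pw exp_add)
    qed
    hence e: "A n / real (primorial n) = exp (u * real S + (ln (real (S + 1)) + ln (real d) + ln c + real (d - 1) * ln (real (n + 1)) + u * real (n + S)) - theta n)"
      by (simp add: primorial_eq_exp exp_diff)
    have "ln (real d) \<le> real d" "ln c \<le> c" using d1 c by (auto intro!: ln_bound)
    moreover have "theta n \<ge> (1 - \<kappa>) * real n - N0" using th[of n] by (simp add: \<kappa>_def)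
    ultimately have "u * real S + (ln (real (S + 1)) + ln (real d) + ln c + real (d - 1) * ln (real (n + 1)) + u * real (n + S)) - theta n
      \<le> Y - (1 - u - 2 * \<kappa>) * real n"
      using logpart[of n] by (simp add: Y_def C2_def algebra_simps)
    thus ?thesis unfolding e ukm by simp
  qed
  define N where "N = nat \<lceil>Y / \<mu>\<rceil> + 1"
  have Nle: "real N \<le> Y / \<mu> + 2"
  proof -
    have "Y / \<mu> \<ge> 0" using Y0 mu by simp
    thus ?thesis unfolding N_def by linarith
  qed
  have small: "A n < real (primorial n)" if "n \<ge> N" for n
  proof -
    have "Y / \<mu> < real N" unfolding N_def by linarith
    also have "\<dots> \<le> real n" using that by simp
    finally have "Y - \<mu> * real n < 0" using mu by (simp add: field_simps)
    hence "exp (Y - \<mu> * real n) < 1" by simp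
    with Ale[of n] have "A n / real (primorial n) < 1" by linarith
    thus ?thesis using primorial_pos[of n] by (simp add: field_simps)
  qed
  define I where "I = {..S} \<times> {..<d}"
  define T where "T = PiE I (\<lambda>_. {0..int X})"
  have cardT: "real (card T) = (real X + 1) ^ ((S + 1) * d)"
    unfolding T_def by (subst card_PiE) (auto simp: I_def card_cartesian_product)
  have Tb: "\<bar>real_of_int (q (j, i))\<bar> \<le> exp (u * real S)" if "q \<in> T" "j \<le> S" "i < d" for q j i
  proof -
    have "q (j, i) \<in> {0..int X}" using that unfolding T_def I_def by (auto simp: PiE_iff)
    thus ?thesis using X(1) by simp
  qed
  have finT: "finite T" unfolding T_def I_def by (intro finite_PiE) auto
  have neT: "T \<noteq> {}" unfolding T_def by (auto simp: PiE_eq_empty_iff)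
  obtain T' where T': "T' \<subseteq> T" "T' \<noteq> {}" "real (card T) \<le> real (card T') * (\<Prod>n<N. 1 + 2 * A n / real_of_int (int (primorial n)))"
     "\<And>q r n. q \<in> T' \<Longrightarrow> r \<in> T' \<Longrightarrow> n < N \<Longrightarrow> linear_form a S d q n = linear_form a S d r n"
  proof -
    have "\<exists>T'\<subseteq>T. T' \<noteq> {} \<and> real (card T) \<le> real (card T') * (\<Prod>n<N. 1 + 2 * A n / real_of_int (int (primorial n)))
     \<and> (\<forall>q\<in>T'. \<forall>r\<in>T'. \<forall>n<N. linear_form a S d q n = linear_form a S d r n)"
    proof (rule successive_pigeonhole[OF finT neT])
      show "int (primorial n) > 0" for n using primorial_pos by simp
      show "int (primorial n) dvd linear_form a S d q n - linear_form a S d r n"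
        if "\<And>k. k < n \<Longrightarrow> linear_form a S d q k = linear_form a S d r k" for q r n
        using linear_form_dvd[OF a, of n S d "\<lambda>x. q x - r x"] that by (simp add: linear_form_diff)
      show "\<bar>real_of_int (linear_form a S d q n)\<bar> \<le> A n" if "q \<in> T" for q n
        unfolding A_def using u c Tb[OF that] by (intro linear_form_bound ab) auto
    qed
    thus ?thesis using that by blast
  qed
  have "(\<Prod>n<N. 1 + 2 * A n / real (primorial n)) \<le> (\<Prod>n<N. exp (ln 3 + max (Y - \<mu> * real n) 0))"
  proof (rule prod_mono)
    fix n
    have "A n \<ge> 0" using c by (simp add: A_def)
    have "1 + 2 * (A n / real (primorial n)) \<le> 1 + 2 * exp (Y - \<mu> * real n)" using Ale[of n] by simp
    also have "\<dots> \<le> 3 * exp (max (Y - \<mu> * real n) 0)"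
    proof -
      have "exp (Y - \<mu> * real n) \<le> exp (max (Y - \<mu> * real n) 0)" "1 \<le> exp (max (Y - \<mu> * real n) 0)" by simp_all
      thus ?thesis by linarith
    qed
    also have "\<dots> = exp (ln 3 + max (Y - \<mu> * real n) 0)" by (simp add: exp_add)
    finally show "0 \<le> 1 + 2 * A n / real (primorial n) \<and> 1 + 2 * A n / real (primorial n) \<le> exp (ln 3 + max (Y - \<mu> * real n) 0)"
      using \<open>A n \<ge> 0\<close> by simp
  qed
  also have "\<dots> = exp (real N * ln 3 + (\<Sum>n<N. max (Y - \<mu> * real n) 0))"
    by (simp add: exp_sum[symmetric] sum.distrib)
  also have "\<dots> < exp (u * real S * real ((S + 1) * d))"
  proof -
    define Z P where "Z = real d * real S" and "P = real d * (real S)\<^sup>2"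
    have "(\<Sum>n<N. max (Y - \<mu> * real n) 0) \<le> Y + Y\<^sup>2 / (2 * \<mu>)"
      using sum_max_linear[OF mu, where Y=Y and N=N] Y0 by simp
    moreover have "Y\<^sup>2 / (2 * \<mu>) \<le> 1681/2400 * (u * P)"
    proof -
      have "Y\<^sup>2 \<le> (41/20 * (u * real S))\<^sup>2" using Yle Y0 by (intro power_mono) auto
      hence "Y\<^sup>2 / (2 * \<mu>) \<le> (41/20 * (u * real S))\<^sup>2 / (2 * \<mu>)" using mu by (intro divide_right_mono) auto
      also have "\<dots> = 1681/2400 * ((u * (real d + 4)) * (u * (real S)\<^sup>2))"
        using d1 by (simp add: \<mu>_def power2_eq_square)
      finally show ?thesis unfolding ud P_def by (simp add: mult_ac)
    qed
    moreover have "real N * ln 3 \<le> 41/30 * Z + 4"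
    proof -
      have "Y / \<mu> \<le> 41/20 * (u * real S) / \<mu>" using Yle mu by (intro divide_right_mono) auto
      also have "\<dots> = 41/60 * ((u * (real d + 4)) * real S)" using d1 by (simp add: \<mu>_def)
      finally have "real N \<le> 41/60 * Z + 2" using Nle unfolding ud Z_def by linarith
      moreover have "real N * ln 3 \<le> real N * 2" using ln_le_minus_one[of 3] by (intro mult_left_mono) auto
      ultimately show ?thesis by linarith
    qed
    moreover have "Y \<le> 41/20 * Z"
    proof -
      have "u * real S \<le> real d * real S" using u d1 by (intro mult_right_mono) auto
      thus ?thesis using Yle unfolding Z_def by linarith
    qed
    moreover have "Z * 200000 \<le> Z * real S" using S0 d1 by (intro mult_left_mono) (auto simp: Z_def)
    moreover have "Z * real S = P" by (simp add: Z_def P_def power2_eq_square)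
    moreover have "1/5 * P \<le> u * P" using u d1 by (intro mult_right_mono) (auto simp: P_def)
    moreover have "1 * 200000 \<le> Z" unfolding Z_def using S0 d1 by (intro mult_mono) auto
    moreover have "u * real S * real ((S + 1) * d) \<ge> u * P"
    proof -
      have "u * real S * real ((S + 1) * d) = u * P + u * real S * real d" by (simp add: P_def algebra_simps power2_eq_square)
      thus ?thesis using u by simp
    qed
    ultimately have "real N * ln 3 + (\<Sum>n<N. max (Y - \<mu> * real n) 0) < u * real S * real ((S + 1) * d)"
      by linarith
    thus ?thesis by simp
  qed
  also have "\<dots> = exp (u * real S) ^ ((S + 1) * d)" by (simp add: exp_of_nat_mult[symmetric] mult_ac)
  also have "\<dots> \<le> real (card T)" unfolding cardT using X(2) by (intro power_mono) auto
  finally have less: "(\<Prod>n<N. 1 + 2 * A n / real (primorial n)) < real (card T)" .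
  have "card T' \<noteq> 1"
  proof
    assume "card T' = 1"
    thus False using T'(3) less by simp
  qed
  hence "\<not> is_singleton T'" by (simp add: is_singleton_altdef)
  then obtain q r where qr: "q \<in> T'" "r \<in> T'" "q \<noteq> r" using T'(2)
    by (metis is_singletonI')
  define w where "w = (\<lambda>x. q x - r x)"
  have wb: "\<bar>real_of_int (w (j, i))\<bar> \<le> exp (u * real S)" if "j \<le> S" "i < d" for j i
  proof -
    have "q (j, i) \<in> {0..int X}" "r (j, i) \<in> {0..int X}" using that qr T'(1) unfolding T_def I_def by (auto simp: PiE_iff)
    hence "\<bar>w (j, i)\<bar> \<le> int X" by (auto simp: w_def)
    hence "\<bar>real_of_int (w (j, i))\<bar> \<le> real X" by linarith
    thus ?thesis using X(1) by linarith
  qed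
  have wz: "linear_form a S d w n = 0" for n
  proof (induction n rule: less_induct)
    case (less n)
    show ?case
    proof (cases "n < N")
      case True
      thus ?thesis using T'(4)[OF qr(1,2) True] by (simp add: w_def linear_form_diff)
    next
      case False
      have dv: "int (primorial n) dvd linear_form a S d w n" by (rule linear_form_dvd[OF a less.IH])
      have "\<bar>real_of_int (linear_form a S d w n)\<bar> \<le> A n"
        unfolding A_def using u c wb by (intro linear_form_bound ab) auto
      also have "\<dots> < real (primorial n)" using small False by simp
      finally have "\<bar>linear_form a S d w n\<bar> < int (primorial n)" by linarith
      thus ?thesis using dvd_imp_le_int[OF _ dv] by fastforce
    qed
  qed
  have nz: "\<exists>j\<le>S. \<exists>i<d. w (j, i) \<noteq> 0"
  proof (rule ccontr)
    assume "\<not> ?thesis"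
    hence "q x = r x" if "x \<in> I" for x using that by (auto simp: I_def w_def)
    moreover have "q \<in> T" "r \<in> T" using qr T' by auto
    ultimately have "q = r" unfolding T_def by (intro PiE_ext) auto
    thus False using qr by simp
  qed
  note rec = recurrence_of_linear_form[OF nz wz]
  have "u * real S \<le> 1 * real S" using u by (intro mult_right_mono) auto
  hence es: "exp (u * real S) \<le> exp (real S)" by simp
  show ?thesis
  proof (intro exI[of _ "\<lambda>j. \<Sum>i<d. monom (w (j, i)) i"] conjI allI impI)
    fix j i assume "j \<le> S"
    show "\<bar>real_of_int (coeff (\<Sum>i<d. monom (w (j, i)) i) i)\<bar> \<le> exp (real S)"
    proof (cases "i < d")
      case True
      have "\<bar>real_of_int (w (j, i))\<bar> \<le> exp (real S)" by (rule order_trans[OF wb[OF \<open>j \<le> S\<close> True] es])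
      thus ?thesis unfolding rec(3) using True by simp
    next
      case False
      thus ?thesis unfolding rec(3) by simp
    qed
  qed (rule rec(1), rule rec(2))
qed

section \<open>Programs with oracles\<close>

text \<open>
  A functional of two oracles and \<open>k\<close> numbers is computed by one program, for all oracles in
  \<open>Q\<close>. The lemmas below have the form in which the introduction rules can synthesise a program from
  an arithmetic expression; arguments are passed as lists, as for \<open>runs\<close>.
\<close>

definition computable :: "((nat \<Rightarrow> nat) \<times> (nat \<Rightarrow> nat)) set \<Rightarrow> nat \<Rightarrow> ((nat \<Rightarrow> nat) \<Rightarrow> (nat \<Rightarrow> nat) \<Rightarrow> nat list \<Rightarrow> nat) \<Rightarrow> bool" where
  "computable Q k F \<longleftrightarrow> (\<exists>P. \<forall>\<phi> \<psi> xs. (\<phi>, \<psi>) \<in> Q \<longrightarrow> length xs = k \<longrightarrow> runs \<phi> \<psi> P xs (F \<phi> \<psi> xs))"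

lemma computable_cong:
  assumes "computable Q k F" "\<And>\<phi> \<psi> xs. (\<phi>, \<psi>) \<in> Q \<Longrightarrow> length xs = k \<Longrightarrow> F \<phi> \<psi> xs = F' \<phi> \<psi> xs"
  shows "computable Q k F'"
  using assms unfolding computable_def by metis

lemma computable_comp:
  assumes F: "computable Q (length Gs) F" and G: "\<And>G. G \<in> set Gs \<Longrightarrow> computable Q k G"
  shows "computable Q k (\<lambda>\<phi> \<psi> xs. F \<phi> \<psi> (map (\<lambda>G. G \<phi> \<psi> xs) Gs))"
proof -
  obtain P where P: "\<And>\<phi> \<psi> xs. (\<phi>, \<psi>) \<in> Q \<Longrightarrow> length xs = length Gs \<Longrightarrow> runs \<phi> \<psi> P xs (F \<phi> \<psi> xs)"
    using F unfolding computable_def by blast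
  have "\<forall>G\<in>set Gs. \<exists>p. \<forall>\<phi> \<psi> xs. (\<phi>, \<psi>) \<in> Q \<longrightarrow> length xs = k \<longrightarrow> runs \<phi> \<psi> p xs (G \<phi> \<psi> xs)"
    using G unfolding computable_def by blast
  then obtain pr where pr: "\<And>G \<phi> \<psi> xs. G \<in> set Gs \<Longrightarrow> (\<phi>, \<psi>) \<in> Q \<Longrightarrow> length xs = k \<Longrightarrow> runs \<phi> \<psi> (pr G) xs (G \<phi> \<psi> xs)"
    by metis
  have "runs \<phi> \<psi> (Comp_fun P (map pr Gs)) xs (F \<phi> \<psi> (map (\<lambda>G. G \<phi> \<psi> xs) Gs))"
    if "(\<phi>, \<psi>) \<in> Q" "length xs = k" for \<phi> \<psi> xs
  proof (rule runs_Comp)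
    show "list_all2 (\<lambda>g y. runs \<phi> \<psi> g xs y) (map pr Gs) (map (\<lambda>G. G \<phi> \<psi> xs) Gs)"
      using pr[OF _ that] by (simp add: list_all2_conv_all_nth)
  qed (use P that in auto)
  thus ?thesis unfolding computable_def by blast
qed

lemma computable_proj: "i < k \<Longrightarrow> computable Q k (\<lambda>_ _ xs. xs ! i)"
  unfolding computable_def using runs_Proj by metis

lemma computable_zero: "computable Q k (\<lambda>_ _ _. 0)"
  unfolding computable_def using runs_Zero by metis

lemma computable_comp1: "computable Q 1 F \<Longrightarrow> computable Q k G \<Longrightarrow> computable Q k (\<lambda>\<phi> \<psi> xs. F \<phi> \<psi> [G \<phi> \<psi> xs])"
  using computable_comp[of Q "[G]" F k] by simp

lemma computable_Suc: "computable Q k G \<Longrightarrow> computable Q k (\<lambda>\<phi> \<psi> xs. Suc (G \<phi> \<psi> xs))"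
proof -
  assume G: "computable Q k G"
  have "computable Q 1 (\<lambda>\<phi> \<psi> xs. Suc (hd xs))"
    unfolding computable_def by (rule exI[of _ Succ_fun]) (auto simp: length_Suc_conv intro: runs_Succ)
  from computable_comp1[OF this G] show ?thesis by simp
qed

lemma computable_const: "computable Q k (\<lambda>_ _ _. c)"
  by (induction c) (auto intro: computable_zero computable_Suc)

lemma computable_query1: "computable Q k G \<Longrightarrow> computable Q k (\<lambda>\<phi> \<psi> xs. \<phi> (G \<phi> \<psi> xs))"
proof -
  assume G: "computable Q k G"
  have "computable Q 1 (\<lambda>\<phi> \<psi> xs. \<phi> (hd xs))"
    unfolding computable_def by (rule exI[of _ Query1]) (auto simp: length_Suc_conv intro: runs_Query1)
  from computable_comp1[OF this G] show ?thesis by simp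
qed

lemma computable_query2: "computable Q k G \<Longrightarrow> computable Q k (\<lambda>\<phi> \<psi> xs. \<psi> (G \<phi> \<psi> xs))"
proof -
  assume G: "computable Q k G"
  have "computable Q 1 (\<lambda>\<phi> \<psi> xs. \<psi> (hd xs))"
    unfolding computable_def by (rule exI[of _ Query2]) (auto simp: length_Suc_conv intro: runs_Query2)
  from computable_comp1[OF this G] show ?thesis by simp
qed

lemma computable_reindex:
  assumes F: "computable Q l F" and l: "length is = l" and i: "\<And>i. i \<in> set is \<Longrightarrow> i < k"
  shows "computable Q k (\<lambda>\<phi> \<psi> xs. F \<phi> \<psi> (map ((!) xs) is))"
proof -
  have "computable Q k (\<lambda>\<phi> \<psi> xs. F \<phi> \<psi> (map (\<lambda>G. G \<phi> \<psi> xs) (map (\<lambda>i _ _ xs. xs ! i) is)))"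
    by (rule computable_comp) (use F l i in \<open>auto intro: computable_proj\<close>)
  thus ?thesis by (simp add: o_def)
qed

lemma computable_hd: "computable Q (Suc k) (\<lambda>_ _ ys. hd ys)"
  by (rule computable_cong[OF computable_proj[of 0]]) (auto simp: length_Suc_conv)

lemma computable_hd_tl: "computable Q (Suc (Suc k)) (\<lambda>_ _ ys. hd (tl ys))"
  by (rule computable_cong[OF computable_proj[of 1]]) (auto simp: length_Suc_conv)

lemma computable_tl: assumes "computable Q k F" shows "computable Q (Suc k) (\<lambda>\<phi> \<psi> ys. F \<phi> \<psi> (tl ys))"
proof (rule computable_cong[OF computable_reindex[OF assms, of "map Suc [0..<k]"]])
  fix \<phi> \<psi> and xs :: "nat list" assume l: "length xs = Suc k"
  have "map ((!) xs) (map Suc [0..<k]) = tl xs"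
    by (rule nth_equalityI) (use l in \<open>auto simp: nth_tl\<close>)
  thus "F \<phi> \<psi> (map ((!) xs) (map Suc [0..<k])) = F \<phi> \<psi> (tl xs)" by simp
qed auto

lemma computable_skip: assumes "computable Q (Suc k) (\<lambda>\<phi> \<psi> ys. F \<phi> \<psi> (hd ys) (tl ys))"
  shows "computable Q (Suc (Suc k)) (\<lambda>\<phi> \<psi> ys. F \<phi> \<psi> (hd ys) (tl (tl ys)))"
proof (rule computable_cong[OF computable_reindex[OF assms, of "0 # map (\<lambda>i. Suc (Suc i)) [0..<k]"]])
  fix \<phi> \<psi> and xs :: "nat list" assume l: "length xs = Suc (Suc k)"
  from l obtain a b zs where zs: "xs = a # b # zs" "length zs = k" by (auto simp: length_Suc_conv)
  have "map ((!) xs) (0 # map (\<lambda>i. Suc (Suc i)) [0..<k]) = hd xs # tl (tl xs)"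
    by (rule nth_equalityI) (auto simp: zs nth_Cons split: nat.split)
  thus "F \<phi> \<psi> (hd (map ((!) xs) (0 # map (\<lambda>i. Suc (Suc i)) [0..<k]))) (tl (map ((!) xs) (0 # map (\<lambda>i. Suc (Suc i)) [0..<k])))
     = F \<phi> \<psi> (hd xs) (tl (tl xs))" by simp
qed auto

lemma computable_prim:
  assumes F: "computable Q k F" and G: "computable Q (Suc (Suc k)) G"
  shows "computable Q (Suc k) (\<lambda>\<phi> \<psi> ys. rec_nat (F \<phi> \<psi> (tl ys)) (\<lambda>n r. G \<phi> \<psi> (n # r # tl ys)) (hd ys))"
proof -
  obtain f where f: "\<And>\<phi> \<psi> xs. (\<phi>, \<psi>) \<in> Q \<Longrightarrow> length xs = k \<Longrightarrow> runs \<phi> \<psi> f xs (F \<phi> \<psi> xs)"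
    using F unfolding computable_def by blast
  obtain g where g: "\<And>\<phi> \<psi> xs. (\<phi>, \<psi>) \<in> Q \<Longrightarrow> length xs = Suc (Suc k) \<Longrightarrow> runs \<phi> \<psi> g xs (G \<phi> \<psi> xs)"
    using G unfolding computable_def by blast
  have "runs \<phi> \<psi> (Prim_rec f g) (n # xs) (rec_nat (F \<phi> \<psi> xs) (\<lambda>n r. G \<phi> \<psi> (n # r # xs)) n)"
    if "(\<phi>, \<psi>) \<in> Q" "length xs = k" for \<phi> \<psi> n xs
  proof (induction n)
    case 0
    show ?case using f[OF that] by (auto intro: runs_Prim_0)
  next
    case (Suc n)
    show ?case using runs_Prim_Suc[OF Suc.IH g] that by simp
  qed
  hence "runs \<phi> \<psi> (Prim_rec f g) ys (rec_nat (F \<phi> \<psi> (tl ys)) (\<lambda>n r. G \<phi> \<psi> (n # r # tl ys)) (hd ys))"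
    if "(\<phi>, \<psi>) \<in> Q" "length ys = Suc k" for \<phi> \<psi> ys
    using that by (cases ys) auto
  thus ?thesis unfolding computable_def by blast
qed

text \<open>
  The step function receives the counter and the previous value in front of the parameters.
\<close>

lemma computable_rec:
  assumes F: "computable Q k F" and N: "computable Q k N" and G: "computable Q (Suc (Suc k)) (\<lambda>\<phi> \<psi> ys. G \<phi> \<psi> (hd ys) (hd (tl ys)) (tl (tl ys)))"
  shows "computable Q k (\<lambda>\<phi> \<psi> xs. rec_nat (F \<phi> \<psi> xs) (\<lambda>n r. G \<phi> \<psi> n r xs) (N \<phi> \<psi> xs))"
proof -
  let ?Gs = "N # map (\<lambda>i _ _ xs. xs ! i) [0..<k]"
  have "computable Q k (\<lambda>\<phi> \<psi> xs. (\<lambda>\<phi> \<psi> ys. rec_nat (F \<phi> \<psi> (tl ys)) (\<lambda>n r. G \<phi> \<psi> n r (tl ys)) (hd ys)) \<phi> \<psi> (map (\<lambda>G. G \<phi> \<psi> xs) ?Gs))"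
    by (rule computable_comp) (use computable_prim[OF F G] N in \<open>auto intro: computable_proj\<close>)
  moreover have "map ((!) xs) [0..<k] = xs" if "length xs = k" for xs :: "nat list"
    using that map_nth[of xs] by simp
  ultimately show ?thesis
    by (elim computable_cong) (simp add: o_def)
qed

lemma computable_add:
  assumes "computable Q k F" "computable Q k G" shows "computable Q k (\<lambda>\<phi> \<psi> xs. F \<phi> \<psi> xs + G \<phi> \<psi> xs)"
proof (rule computable_cong[OF computable_rec[OF assms, where G="\<lambda>_ _ _ r _. Suc r"]])
  have "rec_nat a (\<lambda>n r. Suc r) b = a + b" for a b :: nat by (induction b) auto
  thus "rec_nat (F \<phi> \<psi> xs) (\<lambda>n r. Suc r) (G \<phi> \<psi> xs) = F \<phi> \<psi> xs + G \<phi> \<psi> xs" for \<phi> \<psi> xs .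
qed (intro computable_Suc computable_hd_tl)

lemma computable_mult:
  assumes "computable Q k F" "computable Q k G" shows "computable Q k (\<lambda>\<phi> \<psi> xs. F \<phi> \<psi> xs * G \<phi> \<psi> xs)"
proof (rule computable_cong[OF computable_rec[OF computable_zero assms(2), where G="\<lambda>\<phi> \<psi> _ r xs. F \<phi> \<psi> xs + r"]])
  have "rec_nat 0 (\<lambda>n r. a + r) b = a * b" for a b :: nat by (induction b) auto
  thus "rec_nat 0 (\<lambda>n r. F \<phi> \<psi> xs + r) (G \<phi> \<psi> xs) = F \<phi> \<psi> xs * G \<phi> \<psi> xs" for \<phi> \<psi> xs .
qed (intro computable_add computable_hd_tl computable_tl assms)

lemma computable_pred:
  assumes "computable Q k F" shows "computable Q k (\<lambda>\<phi> \<psi> xs. F \<phi> \<psi> xs - 1)"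
proof (rule computable_cong[OF computable_rec[OF computable_zero assms, where G="\<lambda>_ _ n _ _. n"]])
  show "rec_nat 0 (\<lambda>n r. n) (F \<phi> \<psi> xs) = F \<phi> \<psi> xs - 1" for \<phi> \<psi> xs
    by (cases "F \<phi> \<psi> xs") auto
qed (intro computable_hd)

lemma computable_monus:
  assumes "computable Q k F" "computable Q k G" shows "computable Q k (\<lambda>\<phi> \<psi> xs. F \<phi> \<psi> xs - G \<phi> \<psi> xs)"
proof (rule computable_cong[OF computable_rec[OF assms, where G="\<lambda>_ _ _ r _. r - 1"]])
  have "rec_nat a (\<lambda>n r. r - 1) b = a - b" for a b :: nat by (induction b) auto
  thus "rec_nat (F \<phi> \<psi> xs) (\<lambda>n r. r - 1) (G \<phi> \<psi> xs) = F \<phi> \<psi> xs - G \<phi> \<psi> xs" for \<phi> \<psi> xs .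
qed (intro computable_pred computable_hd_tl)

lemma computable_power:
  assumes "computable Q k F" "computable Q k G" shows "computable Q k (\<lambda>\<phi> \<psi> xs. F \<phi> \<psi> xs ^ G \<phi> \<psi> xs)"
proof (rule computable_cong[OF computable_rec[OF computable_const[of _ _ 1] assms(2), where G="\<lambda>\<phi> \<psi> _ r xs. F \<phi> \<psi> xs * r"]])
  have "rec_nat 1 (\<lambda>n r. a * r) b = a ^ b" for a b :: nat by (induction b) auto
  thus "rec_nat 1 (\<lambda>n r. F \<phi> \<psi> xs * r) (G \<phi> \<psi> xs) = F \<phi> \<psi> xs ^ G \<phi> \<psi> xs" for \<phi> \<psi> xs .
qed (intro computable_mult computable_hd_tl computable_tl assms)

lemma computable_fact:
  assumes "computable Q k F" shows "computable Q k (\<lambda>\<phi> \<psi> xs. fact (F \<phi> \<psi> xs))"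
proof (rule computable_cong[OF computable_rec[OF computable_const[of _ _ 1] assms, where G="\<lambda>_ _ n r _. Suc n * r"]])
  have "rec_nat 1 (\<lambda>n r. Suc n * r) b = fact b" for b :: nat by (induction b) auto
  thus "rec_nat 1 (\<lambda>n r. Suc n * r) (F \<phi> \<psi> xs) = fact (F \<phi> \<psi> xs)" for \<phi> \<psi> xs .
qed (intro computable_mult computable_Suc computable_hd computable_hd_tl)

lemma computable_sum:
  assumes N: "computable Q k N" and G: "computable Q (Suc k) (\<lambda>\<phi> \<psi> ys. G \<phi> \<psi> (hd ys) (tl ys))"
  shows "computable Q k (\<lambda>\<phi> \<psi> xs. \<Sum>m<N \<phi> \<psi> xs. G \<phi> \<psi> m xs)"
proof (rule computable_cong[OF computable_rec[OF computable_zero N, where G="\<lambda>\<phi> \<psi> n r xs. r + G \<phi> \<psi> n xs"]])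
  have "rec_nat 0 (\<lambda>n r. r + f n) b = (\<Sum>m<b. f m)" for f and b :: nat by (induction b) auto
  thus "rec_nat 0 (\<lambda>n r. r + G \<phi> \<psi> n xs) (N \<phi> \<psi> xs) = (\<Sum>m<N \<phi> \<psi> xs. G \<phi> \<psi> m xs)" for \<phi> \<psi> xs .
qed (intro computable_add computable_hd_tl computable_skip G)

lemma computable_Least:
  assumes F: "computable Q (Suc k) (\<lambda>\<phi> \<psi> ys. F \<phi> \<psi> (hd ys) (tl ys))"
    and ex: "\<And>\<phi> \<psi> xs. (\<phi>, \<psi>) \<in> Q \<Longrightarrow> length xs = k \<Longrightarrow> \<exists>n. F \<phi> \<psi> n xs = 0"
  shows "computable Q k (\<lambda>\<phi> \<psi> xs. LEAST n. F \<phi> \<psi> n xs = 0)"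
proof -
  obtain f where f: "\<And>\<phi> \<psi> ys. (\<phi>, \<psi>) \<in> Q \<Longrightarrow> length ys = Suc k \<Longrightarrow> runs \<phi> \<psi> f ys (F \<phi> \<psi> (hd ys) (tl ys))"
    using F unfolding computable_def by blast
  have "runs \<phi> \<psi> (Mu f) xs (LEAST n. F \<phi> \<psi> n xs = 0)" if q: "(\<phi>, \<psi>) \<in> Q" "length xs = k" for \<phi> \<psi> xs
  proof (rule runs_Mu)
    have fr: "runs \<phi> \<psi> f (n # xs) (F \<phi> \<psi> n xs)" for n using f[OF q(1), of "n # xs"] q(2) by simp
    have "F \<phi> \<psi> (LEAST n. F \<phi> \<psi> n xs = 0) xs = 0" using ex[OF q] by (rule LeastI_ex)
    thus "runs \<phi> \<psi> f ((LEAST n. F \<phi> \<psi> n xs = 0) # xs) 0" using fr by metis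
    show "\<forall>m<(LEAST n. F \<phi> \<psi> n xs = 0). \<exists>r. runs \<phi> \<psi> f (m # xs) (Suc r)"
    proof (intro allI impI)
      fix m assume "m < (LEAST n. F \<phi> \<psi> n xs = 0)"
      hence "F \<phi> \<psi> m xs \<noteq> 0" by (rule not_less_Least)
      then obtain r where "F \<phi> \<psi> m xs = Suc r" by (auto simp: gr0_conv_Suc)
      thus "\<exists>r. runs \<phi> \<psi> f (m # xs) (Suc r)" using fr by metis
    qed
  qed
  thus ?thesis unfolding computable_def by blast
qed

text \<open>
  The quotient is the least \<open>q\<close> with \<open>a < (q + 1) * b\<close>.
\<close>

lemma computable_div:
  assumes F: "computable Q k F" and G: "computable Q k G" and pos: "\<And>\<phi> \<psi> xs. (\<phi>, \<psi>) \<in> Q \<Longrightarrow> length xs = k \<Longrightarrow> G \<phi> \<psi> xs > 0"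
  shows "computable Q k (\<lambda>\<phi> \<psi> xs. F \<phi> \<psi> xs div G \<phi> \<psi> xs)"
proof -
  have eq: "(LEAST q. Suc a - Suc q * b = 0) = a div b" if "b > 0" for a b :: nat
  proof (rule Least_equality)
    have "a < Suc (a div b) * b" using that dividend_less_div_times[of b a] by (simp add: mult.commute)
    thus "Suc a - Suc (a div b) * b = 0" by simp
    fix q assume "Suc a - Suc q * b = 0"
    hence "a < Suc q * b" by simp
    hence "a div b < Suc q" using that by (simp add: less_mult_imp_div_less)
    thus "a div b \<le> q" by simp
  qed
  have "computable Q k (\<lambda>\<phi> \<psi> xs. LEAST q. Suc (F \<phi> \<psi> xs) - Suc q * G \<phi> \<psi> xs = 0)"
  proof (rule computable_Least[where F="\<lambda>\<phi> \<psi> q xs. Suc (F \<phi> \<psi> xs) - Suc q * G \<phi> \<psi> xs"])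
    show "computable Q (Suc k) (\<lambda>\<phi> \<psi> ys. Suc (F \<phi> \<psi> (tl ys)) - Suc (hd ys) * G \<phi> \<psi> (tl ys))"
      by (intro computable_monus computable_Suc computable_mult computable_hd computable_tl F G)
    fix \<phi> \<psi> and xs :: "nat list" assume "(\<phi>, \<psi>) \<in> Q" "length xs = k"
    hence g: "G \<phi> \<psi> xs > 0" by (rule pos)
    have "Suc (F \<phi> \<psi> xs) - Suc (F \<phi> \<psi> xs) * G \<phi> \<psi> xs = 0" using g by (cases "G \<phi> \<psi> xs") auto
    thus "\<exists>n. Suc (F \<phi> \<psi> xs) - Suc n * G \<phi> \<psi> xs = 0" by blast
  qed
  thus ?thesis by (rule computable_cong) (rule eq, rule pos)
qed

section \<open>A computable function dominating given bounds\<close>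

text \<open>
  The integer \<open>m! * (\<Sum>k\<le>m. 1 / k!)\<close>.
\<close>

primrec scaled_exp_sum :: "nat \<Rightarrow> nat" where
  "scaled_exp_sum 0 = 1"
| "scaled_exp_sum (Suc m) = Suc m * scaled_exp_sum m + 1"

lemma computable_scaled_exp_sum:
  assumes "computable Q k F" shows "computable Q k (\<lambda>\<phi> \<psi> xs. scaled_exp_sum (F \<phi> \<psi> xs))"
proof (rule computable_cong[OF computable_rec[OF computable_const[of _ _ 1] assms, where G="\<lambda>_ _ n r _. Suc n * r + 1"]])
  have "rec_nat 1 (\<lambda>n r. Suc n * r + 1) b = scaled_exp_sum b" for b :: nat by (induction b) auto
  thus "rec_nat 1 (\<lambda>n r. Suc n * r + 1) (F \<phi> \<psi> xs) = scaled_exp_sum (F \<phi> \<psi> xs)" for \<phi> \<psi> xs .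
qed (intro computable_add computable_mult computable_Suc computable_hd computable_hd_tl computable_const)

lemma scaled_exp_sum_eq: "real (scaled_exp_sum m) = fact m * (\<Sum>k\<le>m. 1 / fact k)"
proof (induction m)
  case (Suc m)
  have "real (scaled_exp_sum (Suc m)) = real (Suc m) * real (scaled_exp_sum m) + 1" by (simp add: distrib_right)
  also have "\<dots> = fact (Suc m) * (\<Sum>k\<le>m. 1 / fact k) + 1" unfolding Suc fact_Suc by (simp add: mult.assoc)
  also have "\<dots> = fact (Suc m) * (\<Sum>k\<le>Suc m. 1 / fact k)" by (simp add: distrib_left)
  finally show ?case .
qed simp

definition exp_sum :: "nat \<Rightarrow> real" where "exp_sum m = (\<Sum>k\<le>m. 1 / fact k)"

lemma exp_sum_mono: "m \<le> n \<Longrightarrow> exp_sum m \<le> exp_sum n"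
  unfolding exp_sum_def by (rule sum_mono2) auto

lemma exp_sum_sums: "(\<lambda>k. 1 / fact k :: real) sums exp 1"
  using exp_converges[of "1::real"] by (simp add: divide_inverse)

lemma exp_sum_tendsto: "exp_sum \<longlonglongrightarrow> exp 1"
  unfolding exp_sum_def using exp_sum_sums by (simp add: sums_def_le)

lemma exp_sum_le_exp: "exp_sum m \<le> exp 1"
  using exp_sum_mono exp_sum_tendsto by (intro incseq_le) (auto simp: incseq_def)

lemma exp_sum_Suc: "exp_sum (Suc m) = exp_sum m + 1 / fact (Suc m)" by (simp add: exp_sum_def)

definition param_domain :: "(real \<times> real) set" where "param_domain = {(c, \<delta>). 0 < c \<and> 1 < \<delta> \<and> \<delta> < exp 1}"

text \<open>
  A term vanishes if \<open>c \<le> m\<close> and \<open>\<delta>\<close> is at most the \<open>m\<close>-th partial sum of the series of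
  \<open>e\<close>. Scaling \<open>\<delta>\<close> by \<open>m!\<close> keeps all coefficients integral.
\<close>

definition height_term :: "(nat \<Rightarrow> nat) \<Rightarrow> real \<Rightarrow> real \<Rightarrow> nat \<Rightarrow> real" where
  "height_term g c \<delta> m = real (g m) * (max 0 (fact m * \<delta> - real (scaled_exp_sum m)) + max 0 (c - real m))"

definition height_cutoff :: "real \<Rightarrow> real \<Rightarrow> nat" where
  "height_cutoff c \<delta> = (LEAST M. \<delta> \<le> exp_sum M \<and> c \<le> real M)"

definition height_fun :: "(nat \<Rightarrow> nat) \<Rightarrow> nat \<Rightarrow> real \<Rightarrow> real \<Rightarrow> real" where
  "height_fun g g0 c \<delta> = real g0 + (\<Sum>m<height_cutoff c \<delta>. height_term g c \<delta> m)"

lemma height_term_nonneg: "height_term g c \<delta> m \<ge> 0" by (simp add: height_term_def)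

lemma height_term_zero:
  assumes "\<delta> \<le> exp_sum M" "c \<le> real M" "M \<le> m" shows "height_term g c \<delta> m = 0"
proof -
  have "\<delta> \<le> exp_sum m" using assms exp_sum_mono[of M m] by simp
  hence "fact m * \<delta> \<le> real (scaled_exp_sum m)" unfolding scaled_exp_sum_eq exp_sum_def[symmetric] by (intro mult_left_mono) auto
  thus ?thesis using assms by (simp add: height_term_def)
qed

lemma height_cutoff_ex: "(c, \<delta>) \<in> param_domain \<Longrightarrow> \<exists>M. \<delta> \<le> exp_sum M \<and> c \<le> real M"
proof -
  assume "(c, \<delta>) \<in> param_domain"
  hence "\<forall>\<^sub>F M in sequentially. \<delta> < exp_sum M"
    using order_tendstoD(1)[OF exp_sum_tendsto] by (auto simp: param_domain_def)
  moreover have "\<forall>\<^sub>F M in sequentially. c \<le> real M"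
    using filterlim_real_sequentially by (simp add: filterlim_at_top)
  ultimately have "\<forall>\<^sub>F M in sequentially. \<delta> \<le> exp_sum M \<and> c \<le> real M" by eventually_elim auto
  thus ?thesis by (rule eventually_happens'[rotated]) simp
qed

text \<open>
  The cutoff may be replaced by any larger number. So a program need not find the least one, which
  would require deciding inequalities between real numbers.
\<close>

lemma height_fun_eq:
  assumes "\<delta> \<le> exp_sum M" "c \<le> real M"
  shows "height_fun g g0 c \<delta> = real g0 + (\<Sum>m<M. height_term g c \<delta> m)"
proof -
  have "\<delta> \<le> exp_sum (height_cutoff c \<delta>) \<and> c \<le> real (height_cutoff c \<delta>)" unfolding height_cutoff_def by (rule LeastI[of _ M]) (use assms in auto)
  hence z: "height_term g c \<delta> m = 0" if "m \<ge> height_cutoff c \<delta>" for m using height_term_zero that by blast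
  have "height_cutoff c \<delta> \<le> M" unfolding height_cutoff_def by (rule Least_le) (use assms in auto)
  hence "(\<Sum>m<M. height_term g c \<delta> m) = (\<Sum>m<height_cutoff c \<delta>. height_term g c \<delta> m)"
    by (intro sum.mono_neutral_right) (auto intro: z)
  thus ?thesis by (simp add: height_fun_def)
qed

text \<open>
  For the least \<open>M\<close> with the first two properties, one of them fails for \<open>M - 1\<close>. Then the term
  of index \<open>M - 1\<close> has a factor at least \<open>1 / M\<close>, as consecutive partial sums of the series of
  \<open>e\<close> differ by \<open>1 / M!\<close>.
\<close>

lemma height_fun_ge:
  assumes D: "(c, \<delta>) \<in> param_domain" and g: "\<And>m. real (g m) \<ge> real (Suc m) * B (Suc m)" and g0: "real g0 \<ge> B 0"
    and B0: "\<And>m. B m \<ge> 0"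
  shows "\<exists>M. \<delta> \<le> exp_sum (Suc M) \<and> c \<le> real (Suc M) \<and> height_fun g g0 c \<delta> \<ge> B M"
proof -
  define P where "P = (\<lambda>M. \<delta> \<le> exp_sum (Suc M) \<and> c \<le> real (Suc M))"
  have "\<exists>M. P M"
  proof -
    obtain M where "\<delta> \<le> exp_sum M" "c \<le> real M" using height_cutoff_ex[OF D] by blast
    hence "P M" unfolding P_def using exp_sum_mono[of M "Suc M"] by auto
    thus ?thesis ..
  qed
  define M where "M = (LEAST M. P M)"
  have PM: "P M" unfolding M_def using \<open>\<exists>M. P M\<close> by (rule LeastI_ex)
  hence H: "height_fun g g0 c \<delta> = real g0 + (\<Sum>m<Suc M. height_term g c \<delta> m)" unfolding P_def by (intro height_fun_eq) auto
  have S0: "(\<Sum>m<Suc M. height_term g c \<delta> m) \<ge> 0" by (intro sum_nonneg height_term_nonneg)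
  have "height_fun g g0 c \<delta> \<ge> B M"
  proof (cases M)
    case 0
    thus ?thesis using H S0 g0 by simp
  next
    case (Suc m)
    have "\<not> P m" using not_less_Least[of m P] Suc by (simp add: M_def)
    hence "\<delta> > exp_sum (Suc m) \<or> c > real (Suc m)" by (auto simp: P_def)
    hence "max 0 (fact m * \<delta> - real (scaled_exp_sum m)) + max 0 (c - real m) \<ge> 1 / real (Suc m)"
    proof
      assume "\<delta> > exp_sum (Suc m)"
      hence "fact m * \<delta> \<ge> fact m * (exp_sum m + 1 / fact (Suc m))" by (intro mult_left_mono) (auto simp: exp_sum_Suc)
      also have "fact m * (exp_sum m + 1 / fact (Suc m)) = real (scaled_exp_sum m) + 1 / real (Suc m)"
        by (simp add: scaled_exp_sum_eq exp_sum_def distrib_left)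
      finally show ?thesis by simp
    next
      assume "c > real (Suc m)"
      moreover have "1 / real (Suc m) \<le> 1" by simp
      ultimately have "c - real m \<ge> 1 / real (Suc m)" by linarith
      thus ?thesis by linarith
    qed
    hence "height_term g c \<delta> m \<ge> real (g m) * (1 / real (Suc m))" unfolding height_term_def by (intro mult_left_mono) auto
    moreover have "real (g m) * (1 / real (Suc m)) \<ge> (real (Suc m) * B (Suc m)) * (1 / real (Suc m))"
      by (intro mult_right_mono g) auto
    ultimately have "height_term g c \<delta> m \<ge> B M" using Suc by simp
    moreover have "height_term g c \<delta> m \<le> (\<Sum>m<Suc M. height_term g c \<delta> m)"
      using Suc by (intro member_le_sum) (auto simp: height_term_nonneg)
    ultimately show ?thesis using H by simp
  qed
  thus ?thesis using PM unfolding P_def by blast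
qed

text \<open>
  A number past the cutoff, found by unbounded search. The condition for \<open>M\<close> uses the
  \<open>M\<close>-th approximations of both arguments together with their error bounds.
\<close>

definition cutoff_search :: "(nat \<Rightarrow> nat) \<Rightarrow> (nat \<Rightarrow> nat) \<Rightarrow> nat" where
  "cutoff_search \<phi> \<psi> = (LEAST M. (fact M * Suc (\<psi> M) - scaled_exp_sum M * 2 ^ M) + (Suc (\<phi> M) - M * 2 ^ M) = 0)"

definition weight_total :: "(nat \<Rightarrow> nat) \<Rightarrow> (nat \<Rightarrow> nat) \<Rightarrow> (nat \<Rightarrow> nat) \<Rightarrow> nat" where
  "weight_total g \<phi> \<psi> = (\<Sum>m<cutoff_search \<phi> \<psi>. g m * (fact m + 1))"

definition height_approx :: "(nat \<Rightarrow> nat) \<Rightarrow> nat \<Rightarrow> (nat \<Rightarrow> nat) \<Rightarrow> (nat \<Rightarrow> nat) \<Rightarrow> nat \<Rightarrow> nat" where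
  "height_approx g g0 \<phi> \<psi> j = g0 * 2 ^ j + (\<Sum>m<cutoff_search \<phi> \<psi>. g m * ((fact m * \<psi> j - scaled_exp_sum m * 2 ^ j) + (\<phi> j - m * 2 ^ j)))"

text \<open>
  The approximations of the arguments used for the \<open>k\<close>-th output are so precise that their effect on
  the value is at most half of the allowed error. The other half is spent on rounding to a multiple of
  \<open>1 / 2 ^ k\<close>, which is why half of the divisor is added before the division.
\<close>

definition height_name :: "(nat \<Rightarrow> nat) \<Rightarrow> nat \<Rightarrow> (nat \<Rightarrow> nat) \<Rightarrow> (nat \<Rightarrow> nat) \<Rightarrow> nat \<Rightarrow> nat" where
  "height_name g g0 \<phi> \<psi> k = (height_approx g g0 \<phi> \<psi> (k + weight_total g \<phi> \<psi> + 1) + 2 ^ weight_total g \<phi> \<psi>) div 2 ^ (weight_total g \<phi> \<psi> + 1)"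

definition param_names :: "((nat \<Rightarrow> nat) \<times> (nat \<Rightarrow> nat)) set" where
  "param_names = {(\<phi>, \<psi>). \<exists>c \<delta>. (c, \<delta>) \<in> param_domain \<and> dyadic_name \<phi> c \<and> dyadic_name \<psi> \<delta>}"

lemma dyadic_name_abs: "dyadic_name \<phi> x \<Longrightarrow> \<bar>real (\<phi> k) - 2 ^ k * x\<bar> \<le> 1"
proof -
  assume "dyadic_name \<phi> x"
  hence "\<bar>real (\<phi> k) / 2 ^ k - x\<bar> * 2 ^ k \<le> 1 / 2 ^ k * 2 ^ k" unfolding dyadic_name_def by (intro mult_right_mono) auto
  moreover have "\<bar>real (\<phi> k) / 2 ^ k - x\<bar> * 2 ^ k = \<bar>(real (\<phi> k) / 2 ^ k - x) * 2 ^ k\<bar>" by (simp add: abs_mult)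
  moreover have "(real (\<phi> k) / 2 ^ k - x) * 2 ^ k = real (\<phi> k) - 2 ^ k * x" by (simp add: left_diff_distrib)
  ultimately show ?thesis by simp
qed

lemma cutoff_search_pred:
  "(fact M * Suc (\<psi> M) - scaled_exp_sum M * 2 ^ M) + (Suc (\<phi> M) - M * 2 ^ M) = 0 \<longleftrightarrow>
    (real (\<psi> M) + 1) / 2 ^ M \<le> exp_sum M \<and> (real (\<phi> M) + 1) / 2 ^ M \<le> real M"
proof -
  have "(fact M * Suc (\<psi> M) - scaled_exp_sum M * 2 ^ M) + (Suc (\<phi> M) - M * 2 ^ M) = 0 \<longleftrightarrow>
     fact M * Suc (\<psi> M) \<le> scaled_exp_sum M * 2 ^ M \<and> Suc (\<phi> M) \<le> M * 2 ^ M" by auto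
  also have "fact M * Suc (\<psi> M) \<le> scaled_exp_sum M * 2 ^ M \<longleftrightarrow> fact M * (real (\<psi> M) + 1) \<le> real (scaled_exp_sum M) * 2 ^ M"
    by (subst of_nat_le_iff[where ?'a=real, symmetric]) (simp add: distrib_left add.commute)
  also have "\<dots> \<longleftrightarrow> (real (\<psi> M) + 1) / 2 ^ M \<le> exp_sum M"
    unfolding scaled_exp_sum_eq exp_sum_def[symmetric] by (simp add: pos_divide_le_eq mult.assoc)
  also have "Suc (\<phi> M) \<le> M * 2 ^ M \<longleftrightarrow> real (\<phi> M) + 1 \<le> real M * 2 ^ M"
    by (subst of_nat_le_iff[where ?'a=real, symmetric]) (simp add: add.commute)
  also have "\<dots> \<longleftrightarrow> (real (\<phi> M) + 1) / 2 ^ M \<le> real M" by (simp add: field_simps)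
  finally show ?thesis .
qed

lemma cutoff_search_ex:
  assumes D: "(c, \<delta>) \<in> param_domain" and n: "dyadic_name \<phi> c" "dyadic_name \<psi> \<delta>"
  shows "\<exists>M. (fact M * Suc (\<psi> M) - scaled_exp_sum M * 2 ^ M) + (Suc (\<phi> M) - M * 2 ^ M) = 0"
proof -
  have t: "(\<lambda>M. x + 2 * (1 / 2) ^ M) \<longlonglongrightarrow> x + 2 * 0" for x :: real
    by (intro tendsto_intros LIMSEQ_realpow_zero) auto
  have "(\<lambda>M. exp_sum M - (\<delta> + 2 * (1 / 2) ^ M)) \<longlonglongrightarrow> exp 1 - (\<delta> + 2 * 0)"
    by (intro tendsto_diff exp_sum_tendsto t)
  hence "\<forall>\<^sub>F M in sequentially. 0 < exp_sum M - (\<delta> + 2 * (1 / 2) ^ M)"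
    by (rule order_tendstoD(1)) (use D in \<open>auto simp: param_domain_def\<close>)
  moreover have "\<forall>\<^sub>F M in sequentially. c + 2 \<le> real M"
    using filterlim_real_sequentially by (simp add: filterlim_at_top)
  ultimately have "\<forall>\<^sub>F M in sequentially. (real (\<psi> M) + 1) / 2 ^ M \<le> exp_sum M \<and> (real (\<phi> M) + 1) / 2 ^ M \<le> real M"
  proof eventually_elim
    case (elim M)
    have b: "(real (\<omega> M) + 1) / 2 ^ M \<le> x + 2 * (1 / 2) ^ M" if "dyadic_name \<omega> x" for \<omega> x
    proof -
      have "real (\<omega> M) / 2 ^ M \<le> x + 1 / 2 ^ M" using that unfolding dyadic_name_def by (metis abs_diff_le_iff add.commute)
      thus ?thesis by (simp add: add_divide_distrib power_one_over)
    qed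
    have "(1 / 2 :: real) ^ M \<le> 1" by (intro power_le_one) auto
    thus ?case using b[OF n(1)] b[OF n(2)] elim by simp
  qed
  then obtain M where "(real (\<psi> M) + 1) / 2 ^ M \<le> exp_sum M \<and> (real (\<phi> M) + 1) / 2 ^ M \<le> real M"
    by (auto dest: eventually_happens'[rotated])
  thus ?thesis using cutoff_search_pred by blast
qed

lemma cutoff_search_correct:
  assumes D: "(c, \<delta>) \<in> param_domain" and n: "dyadic_name \<phi> c" "dyadic_name \<psi> \<delta>"
  shows "\<delta> \<le> exp_sum (cutoff_search \<phi> \<psi>) \<and> c \<le> real (cutoff_search \<phi> \<psi>)"
proof -
  define M where "M = cutoff_search \<phi> \<psi>"
  have "(fact M * Suc (\<psi> M) - scaled_exp_sum M * 2 ^ M) + (Suc (\<phi> M) - M * 2 ^ M) = 0"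
    unfolding M_def cutoff_search_def using cutoff_search_ex[OF assms] by (rule LeastI_ex)
  hence 1: "(real (\<psi> M) + 1) / 2 ^ M \<le> exp_sum M \<and> (real (\<phi> M) + 1) / 2 ^ M \<le> real M" by (simp only: cutoff_search_pred)
  have b: "x \<le> (real (\<omega> M) + 1) / 2 ^ M" if "dyadic_name \<omega> x" for \<omega> x
  proof -
    have "x \<le> real (\<omega> M) / 2 ^ M + 1 / 2 ^ M" using that unfolding dyadic_name_def by (metis abs_diff_le_iff diff_le_eq)
    thus ?thesis by (simp add: add_divide_distrib)
  qed
  show ?thesis using 1 b[OF n(1)] b[OF n(2)] unfolding M_def by linarith
qed

lemma height_name_correct:
  assumes D: "(c, \<delta>) \<in> param_domain" and n: "dyadic_name \<phi> c" "dyadic_name \<psi> \<delta>"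
  shows "dyadic_name (height_name g g0 \<phi> \<psi>) (height_fun g g0 c \<delta>)"
  unfolding dyadic_name_def
proof
  fix k
  define L where "L = weight_total g \<phi> \<psi>"
  define j where "j = k + L + 1"
  define M where "M = cutoff_search \<phi> \<psi>"
  define V where "V = height_approx g g0 \<phi> \<psi> j"
  define H where "H = height_fun g g0 c \<delta>"
  have H: "H = real g0 + (\<Sum>m<M. height_term g c \<delta> m)"
    unfolding H_def M_def by (intro height_fun_eq) (use cutoff_search_correct[OF assms] in auto)
  have mon: "real (a - b) = max 0 (real a - real b)" for a b :: nat by (auto simp: max_def of_nat_diff)
  have Vr: "real V = real g0 * 2 ^ j + (\<Sum>m<M. real (g m) * (max 0 (fact m * real (\<psi> j) - real (scaled_exp_sum m) * 2 ^ j) + max 0 (real (\<phi> j) - real m * 2 ^ j)))"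
    by (simp add: V_def height_approx_def M_def mon)
  have Hr: "2 ^ j * H = real g0 * 2 ^ j + (\<Sum>m<M. real (g m) * (max 0 (fact m * (2 ^ j * \<delta>) - real (scaled_exp_sum m) * 2 ^ j) + max 0 (2 ^ j * c - real m * 2 ^ j)))"
  proof -
    have "2 ^ j * height_term g c \<delta> m = real (g m) * (max 0 (fact m * (2 ^ j * \<delta>) - real (scaled_exp_sum m) * 2 ^ j) + max 0 (2 ^ j * c - real m * 2 ^ j))" for m
    proof -
      have mx: "2 ^ j * max 0 x = max 0 (2 ^ j * x)" for x :: real by (auto simp: max_def zero_le_mult_iff not_le)
      have "2 ^ j * height_term g c \<delta> m = real (g m) * (2 ^ j * max 0 (fact m * \<delta> - real (scaled_exp_sum m)) + 2 ^ j * max 0 (c - real m))"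
        by (simp add: height_term_def distrib_left mult.left_commute)
      also have "2 ^ j * max 0 (fact m * \<delta> - real (scaled_exp_sum m)) = max 0 (fact m * (2 ^ j * \<delta>) - real (scaled_exp_sum m) * 2 ^ j)"
        unfolding mx by (simp add: right_diff_distrib mult_ac)
      also have "2 ^ j * max 0 (c - real m) = max 0 (2 ^ j * c - real m * 2 ^ j)"
        unfolding mx by (simp add: left_diff_distrib right_diff_distrib mult_ac)
      finally show ?thesis .
    qed
    thus ?thesis unfolding H by (simp add: distrib_left sum_distrib_left mult.commute)
  qed
  have "\<bar>real V - 2 ^ j * H\<bar> \<le> (\<Sum>m<M. real (g m) * (fact m + 1))"
  proof -
    have lip: "\<bar>max 0 x - max 0 y\<bar> \<le> \<bar>x - y\<bar>" for x y :: real by (auto simp: max_def)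
    have "\<bar>real V - 2 ^ j * H\<bar> \<le> (\<Sum>m<M. \<bar>real (g m) * (max 0 (fact m * real (\<psi> j) - real (scaled_exp_sum m) * 2 ^ j) + max 0 (real (\<phi> j) - real m * 2 ^ j))
       - real (g m) * (max 0 (fact m * (2 ^ j * \<delta>) - real (scaled_exp_sum m) * 2 ^ j) + max 0 (2 ^ j * c - real m * 2 ^ j))\<bar>)"
      unfolding Vr Hr by (simp add: sum_subtractf[symmetric] sum_abs)
    also have "\<dots> \<le> (\<Sum>m<M. real (g m) * (fact m + 1))"
    proof (rule sum_mono)
      fix m
      define p q r s where "p = fact m * real (\<psi> j) - real (scaled_exp_sum m) * 2 ^ j" and "q = real (\<phi> j) - real m * 2 ^ j"
        and "r = fact m * (2 ^ j * \<delta>) - real (scaled_exp_sum m) * 2 ^ j" and "s = 2 ^ j * c - real m * 2 ^ j"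
      have "\<bar>p - r\<bar> = fact m * \<bar>real (\<psi> j) - 2 ^ j * \<delta>\<bar>"
        by (simp add: p_def r_def abs_mult flip: right_diff_distrib)
      also have "\<dots> \<le> fact m * 1" using dyadic_name_abs[OF n(2)] by (intro mult_left_mono) auto
      finally have pr: "\<bar>p - r\<bar> \<le> fact m" by simp
      have qs: "\<bar>q - s\<bar> \<le> 1" using dyadic_name_abs[OF n(1), of j] by (simp add: q_def s_def)
      have "\<bar>(max 0 p + max 0 q) - (max 0 r + max 0 s)\<bar> \<le> fact m + 1"
      proof -
        have "\<bar>(A + B) - (C + E)\<bar> \<le> \<bar>A - C\<bar> + \<bar>B - E\<bar>" for A B C E :: real by linarith
        hence "\<bar>(max 0 p + max 0 q) - (max 0 r + max 0 s)\<bar> \<le> \<bar>max 0 p - max 0 r\<bar> + \<bar>max 0 q - max 0 s\<bar>" .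
        also have "\<dots> \<le> fact m + 1" by (intro add_mono order_trans[OF lip] pr qs)
        finally show ?thesis .
      qed
      hence "real (g m) * \<bar>(max 0 p + max 0 q) - (max 0 r + max 0 s)\<bar> \<le> real (g m) * (fact m + 1)"
        by (rule mult_left_mono) (rule of_nat_0_le_iff)
      moreover have "\<bar>real (g m) * (max 0 p + max 0 q) - real (g m) * (max 0 r + max 0 s)\<bar>
          = real (g m) * \<bar>(max 0 p + max 0 q) - (max 0 r + max 0 s)\<bar>"
        by (simp only: abs_mult abs_of_nat flip: right_diff_distrib)
      ultimately show "\<bar>real (g m) * (max 0 p + max 0 q) - real (g m) * (max 0 r + max 0 s)\<bar> \<le> real (g m) * (fact m + 1)"
        by (simp only:)
    qed
    finally show ?thesis .
  qed
  also have "(\<Sum>m<M. real (g m) * (fact m + 1)) = real L" by (simp add: L_def weight_total_def M_def distrib_left add.commute)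
  finally have e1: "\<bar>real V - 2 ^ j * H\<bar> \<le> real L" .
  have "L < 2 ^ L" by (rule less_exp)
  hence "real L < 2 ^ L" by (metis of_nat_less_iff of_nat_power of_nat_numeral)
  hence e2: "\<bar>real V - 2 ^ j * H\<bar> \<le> 2 ^ L" using e1 by linarith
  define D2 where "D2 = (2::nat) ^ (L + 1)"
  define W where "W = (V + 2 ^ L) div D2"
  have "V + 2 ^ L = D2 * W + (V + 2 ^ L) mod D2" unfolding W_def by simp
  hence "real V + 2 ^ L = real D2 * real W + real ((V + 2 ^ L) mod D2)"
    by (metis of_nat_add of_nat_mult of_nat_power of_nat_numeral)
  moreover have "(V + 2 ^ L) mod D2 < D2" by (simp add: D2_def)
  hence "real ((V + 2 ^ L) mod D2) \<le> real D2" by simp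
  moreover have D2r: "real D2 = 2 * 2 ^ L" by (simp add: D2_def)
  ultimately have e3: "\<bar>real D2 * real W - real V\<bar> \<le> 2 ^ L" by (simp add: abs_le_iff)
  have j: "(2::real) ^ j = real D2 * 2 ^ k" by (simp add: j_def D2r power_add)
  have "\<bar>real D2 * (real W - 2 ^ k * H)\<bar> \<le> \<bar>real D2 * real W - real V\<bar> + \<bar>real V - 2 ^ j * H\<bar>"
    unfolding j by (simp add: algebra_simps)
  also have "\<dots> \<le> real D2" using e2 e3 D2r by simp
  finally have "real D2 * \<bar>real W - 2 ^ k * H\<bar> \<le> real D2 * 1" by (simp add: abs_mult)
  hence "\<bar>real W - 2 ^ k * H\<bar> \<le> 1" by (simp add: D2r)
  hence "\<bar>real W - 2 ^ k * H\<bar> / 2 ^ k \<le> 1 / 2 ^ k" by (intro divide_right_mono) auto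
  moreover have "\<bar>real W - 2 ^ k * H\<bar> / 2 ^ k = \<bar>real W / 2 ^ k - H\<bar>"
  proof -
    have "\<bar>x\<bar> / 2 ^ k = \<bar>x / 2 ^ k\<bar>" for x :: real by (simp add: abs_divide)
    moreover have "(real W - 2 ^ k * H) / 2 ^ k = real W / 2 ^ k - H" by (simp add: diff_divide_distrib)
    ultimately show ?thesis by (simp only:)
  qed
  moreover have "W = height_name g g0 \<phi> \<psi> k" by (simp add: W_def V_def D2_def j_def L_def height_name_def)
  ultimately show "\<bar>real (height_name g g0 \<phi> \<psi> k) / 2 ^ k - height_fun g g0 c \<delta>\<bar> \<le> 1 / 2 ^ k" by (simp add: H_def)
qed

lemma computable_cutoff_search: "computable param_names k (\<lambda>\<phi> \<psi> _. cutoff_search \<phi> \<psi>)"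
  unfolding cutoff_search_def
proof (rule computable_Least[where F="\<lambda>\<phi> \<psi> M _. (fact M * Suc (\<psi> M) - scaled_exp_sum M * 2 ^ M) + (Suc (\<phi> M) - M * 2 ^ M)"])
  show "computable param_names (Suc k) (\<lambda>\<phi> \<psi> ys. (fact (hd ys) * Suc (\<psi> (hd ys)) - scaled_exp_sum (hd ys) * 2 ^ hd ys) + (Suc (\<phi> (hd ys)) - hd ys * 2 ^ hd ys))"
    by (intro computable_add computable_monus computable_mult computable_Suc computable_power computable_const computable_scaled_exp_sum computable_fact computable_query1 computable_query2 computable_hd)
  fix \<phi> \<psi> :: "nat \<Rightarrow> nat" assume "(\<phi>, \<psi>) \<in> param_names"
  then obtain c \<delta> where "(c, \<delta>) \<in> param_domain" "dyadic_name \<phi> c" "dyadic_name \<psi> \<delta>" unfolding param_names_def by blast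
  thus "\<exists>M. (fact M * Suc (\<psi> M) - scaled_exp_sum M * 2 ^ M) + (Suc (\<phi> M) - M * 2 ^ M) = 0" by (rule cutoff_search_ex)
qed

theorem computable_height_fun:
  assumes g: "\<And>k F. computable param_names k F \<Longrightarrow> computable param_names k (\<lambda>\<phi> \<psi> xs. g (F \<phi> \<psi> xs))"
  shows "computable_real_fun2 {(c, \<delta>). 0 < c \<and> 1 < \<delta> \<and> \<delta> < exp 1} (height_fun g g0)"
proof -
  have err: "computable param_names k (\<lambda>\<phi> \<psi> _. weight_total g \<phi> \<psi>)" for k
    unfolding weight_total_def
    by (rule computable_sum[OF computable_cutoff_search, where G="\<lambda>\<phi> \<psi> m _. g m * (fact m + 1)"])
       (intro computable_mult computable_add computable_const computable_fact g computable_hd)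
  have val: "computable param_names k (\<lambda>\<phi> \<psi> xs. height_approx g g0 \<phi> \<psi> (J \<phi> \<psi> xs))" if J: "computable param_names k J" for k J
    unfolding height_approx_def
    by (intro computable_add computable_mult computable_const computable_power J
          computable_sum[OF computable_cutoff_search, where G="\<lambda>\<phi> \<psi> m xs. g m * ((fact m * \<psi> (J \<phi> \<psi> xs) - scaled_exp_sum m * 2 ^ J \<phi> \<psi> xs) + (\<phi> (J \<phi> \<psi> xs) - m * 2 ^ J \<phi> \<psi> xs))"])
       (intro computable_add computable_monus computable_mult computable_power computable_const computable_scaled_exp_sum computable_fact computable_query1 computable_query2 g computable_hd computable_tl J)+
  have "computable param_names 1 (\<lambda>\<phi> \<psi> xs. height_name g g0 \<phi> \<psi> (xs ! 0))"
    unfolding height_name_def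
    by (intro computable_div computable_add val err computable_power computable_const computable_proj) auto
  then obtain P where P: "\<And>\<phi> \<psi> k. (\<phi>, \<psi>) \<in> param_names \<Longrightarrow> runs \<phi> \<psi> P [k] (height_name g g0 \<phi> \<psi> k)"
    unfolding computable_def by (metis One_nat_def length_Cons list.size(3) nth_Cons_0)
  show ?thesis unfolding computable_real_fun2_def
  proof (intro exI[of _ P] ballI, clarify)
    fix c \<delta> :: real and \<phi> \<psi>
    assume as: "0 < c" "1 < \<delta>" "\<delta> < exp 1" "dyadic_name \<phi> c" "dyadic_name \<psi> \<delta>"
    hence D: "(c, \<delta>) \<in> param_domain" by (simp add: param_domain_def)
    hence "(\<phi>, \<psi>) \<in> param_names" using as unfolding param_names_def by blast
    thus "\<exists>\<omega>. (\<forall>k. runs \<phi> \<psi> P [k] (\<omega> k)) \<and> dyadic_name \<omega> (height_fun g g0 c \<delta>)"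
      using P height_name_correct[OF D as(4,5), of g g0] by blast
  qed
qed

section \<open>Pseudo-polynomials without recurrence\<close>

lemma primes_crt:
  fixes b :: "nat \<Rightarrow> int"
  shows "\<exists>r\<ge>0. r < int (primorial n) \<and> (\<forall>p. prime p \<longrightarrow> p \<le> n \<longrightarrow> [r = b p] (mod int p))"
proof -
  have "\<exists>x. \<forall>i\<in>{p. prime p \<and> p \<le> n}. [x = nat (b i mod int i)] (mod i)"
    by (rule chinese_remainder_nat[OF finite_primes_le]) (auto intro: primes_coprime)
  then obtain x where x: "\<And>p. prime p \<Longrightarrow> p \<le> n \<Longrightarrow> [x = nat (b p mod int p)] (mod p)" by blast
  define r where "r = int (x mod primorial n)"
  have "[r = b p] (mod int p)" if p: "prime p" "p \<le> n" for p
  proof -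
    have p0: "p > 0" using p by (simp add: prime_gt_0_nat)
    have "p dvd primorial n" unfolding primorial_def using p finite_primes_le by (intro dvd_prodI) auto
    hence "[x mod primorial n = x] (mod p)" by (simp add: Cong.cong_def mod_mod_cancel)
    from Cong.cong_trans[OF this x[OF p]] have "[int (x mod primorial n) = int (nat (b p mod int p))] (mod int p)"
      by (simp only: cong_int_iff)
    also have "int (nat (b p mod int p)) = b p mod int p" using p0 by simp
    finally show ?thesis by (simp add: r_def Cong.cong_def)
  qed
  moreover have "r \<ge> 0" "r < int (primorial n)" using primorial_pos[of n] by (auto simp: r_def)
  ultimately show ?thesis by blast
qed

definition crt_value :: "(nat \<Rightarrow> int) \<Rightarrow> nat \<Rightarrow> int" where
  "crt_value b n = (SOME r. 0 \<le> r \<and> r < int (primorial n) \<and> (\<forall>p. prime p \<longrightarrow> p \<le> n \<longrightarrow> [r = b (n - p)] (mod int p)))"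

lemma crt_value:
  "0 \<le> crt_value b n" "crt_value b n < int (primorial n)"
  "prime p \<Longrightarrow> p \<le> n \<Longrightarrow> [crt_value b n = b (n - p)] (mod int p)"
proof -
  have "\<exists>r. 0 \<le> r \<and> r < int (primorial n) \<and> (\<forall>p. prime p \<longrightarrow> p \<le> n \<longrightarrow> [r = b (n - p)] (mod int p))"
    using primes_crt[of n "\<lambda>p. b (n - p)"] by blast
  from someI_ex[OF this] show "0 \<le> crt_value b n" "crt_value b n < int (primorial n)"
  "prime p \<Longrightarrow> p \<le> n \<Longrightarrow> [crt_value b n = b (n - p)] (mod int p)" unfolding crt_value_def by blast+
qed

text \<open>
  The first \<open>n\<close> values of the sequence with choices \<open>\<beta>\<close>: each new value has the residues forced
  by the earlier ones, and \<open>\<beta>\<close> decides between the two representatives below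
  \<open>2 * primorial n\<close>.
\<close>

primrec branch_upto :: "(nat \<Rightarrow> bool) \<Rightarrow> nat \<Rightarrow> nat \<Rightarrow> int" where
  "branch_upto \<beta> 0 = (\<lambda>_. 0)"
| "branch_upto \<beta> (Suc n) = (branch_upto \<beta> n)(n := crt_value (branch_upto \<beta> n) n + (if \<beta> n then int (primorial n) else 0))"

definition branch :: "(nat \<Rightarrow> bool) \<Rightarrow> nat \<Rightarrow> int" where "branch \<beta> n = branch_upto \<beta> (Suc n) n"

lemma branch_upto_eq: "branch_upto \<beta> m k = (if k < m then branch \<beta> k else 0)"
  by (induction m) (auto simp: branch_def less_Suc_eq)

lemma branch_eq: "branch \<beta> n = crt_value (branch_upto \<beta> n) n + (if \<beta> n then int (primorial n) else 0)"
  by (simp add: branch_def)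

lemma branch_bound: "0 \<le> branch \<beta> n \<and> branch \<beta> n \<le> 2 * int (primorial n)"
  using crt_value(1,2)[of "branch_upto \<beta> n" n] primorial_pos[of n] by (auto simp: branch_eq)

lemma branch_pseudo: "primary_pseudo_polynomial (branch \<beta>)"
  unfolding primary_pseudo_polynomial_def
proof (intro allI impI)
  fix n p :: nat assume p: "prime p"
  hence p0: "p > 0" by (rule prime_gt_0_nat)
  define N where "N = n + p"
  have "[crt_value (branch_upto \<beta> N) N = branch_upto \<beta> N (N - p)] (mod int p)"
    by (rule crt_value) (use p in \<open>auto simp: N_def\<close>)
  moreover have "branch_upto \<beta> N (N - p) = branch \<beta> n" using p0 by (simp add: N_def branch_upto_eq)
  moreover have "p dvd primorial N" unfolding primorial_def using p finite_primes_le by (intro dvd_prodI) (auto simp: N_def)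
  hence "[(if \<beta> N then int (primorial N) else 0) = 0] (mod int p)" by (auto simp: Cong.cong_def)
  ultimately have "[branch \<beta> N = branch \<beta> n + 0] (mod int p)"
    unfolding branch_eq[of \<beta> N] by (metis Cong.cong_add)
  thus "[branch \<beta> (n + p) = branch \<beta> n] (mod int p)" by (simp add: N_def)
qed

lemma inj_branch: "inj branch"
proof (rule injI, rule ext)
  fix \<beta> \<gamma> n assume eq: "branch \<beta> = branch \<gamma>"
  have "branch_upto \<beta> n = branch_upto \<gamma> n" by (rule ext) (simp add: branch_upto_eq eq)
  hence "(if \<beta> n then int (primorial n) else 0) = (if \<gamma> n then int (primorial n) else 0)"
    using branch_eq[of \<beta> n] branch_eq[of \<gamma> n] eq by simp
  thus "\<beta> n = \<gamma> n" using primorial_pos[of n] by (auto split: if_splits)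
qed

text \<open>
  The recurrence with coefficient lists \<open>ps\<close> and initial values \<open>as\<close>, long enough that the
  leading coefficient does not vanish at any later step. Lists of integers are used because there are
  only countably many of them.
\<close>

definition determined :: "int list list \<Rightarrow> int list \<Rightarrow> (nat \<Rightarrow> int) \<Rightarrow> bool" where
  "determined ps as a \<longleftrightarrow> ps \<noteq> [] \<and> (\<forall>n. (\<Sum>j<length ps. poly (Poly (ps ! j)) (int n) * a (n + j)) = 0) \<and>
     as = map a [0..<length as] \<and> length ps \<le> Suc (length as) \<and>
     (\<forall>n. n + length ps > length as \<longrightarrow> poly (Poly (last ps)) (int n) \<noteq> 0)"

lemma determined_unique:
  assumes a: "determined ps as a" and b: "determined ps as b"
  shows "a = b"
proof (rule ext)
  fix m show "a m = b m"
  proof (induction m rule: less_induct)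
    case (less m)
    show ?case
    proof (cases "m < length as")
      case True
      have "as = map a [0..<length as]" "as = map b [0..<length as]" using a b by (simp_all add: determined_def)
      hence "map a [0..<length as] ! m = map b [0..<length as] ! m" by metis
      thus ?thesis using True by simp
    next
      case False
      define S where "S = length ps - 1"
      have ps: "ps \<noteq> []" "length ps = Suc S" "last ps = ps ! S" "S \<le> length as"
        using a by (auto simp: determined_def S_def last_conv_nth)
      define n where "n = m - S"
      have m: "m = n + S" using False ps by (simp add: n_def)
      have "(\<Sum>j<Suc S. poly (Poly (ps ! j)) (int n) * a (n + j)) = 0" "(\<Sum>j<Suc S. poly (Poly (ps ! j)) (int n) * b (n + j)) = 0"
        using a b ps unfolding determined_def by metis+
      moreover have "(\<Sum>j<S. poly (Poly (ps ! j)) (int n) * a (n + j)) = (\<Sum>j<S. poly (Poly (ps ! j)) (int n) * b (n + j))"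
        by (intro sum.cong) (auto simp: m less.IH)
      ultimately have "poly (Poly (ps ! S)) (int n) * a m = poly (Poly (ps ! S)) (int n) * b m"
        unfolding m sum.lessThan_Suc by linarith
      moreover have "poly (Poly (ps ! S)) (int n) \<noteq> 0"
        using a ps m False unfolding determined_def by (metis add_Suc_right not_less_eq not_le_imp_less less_Suc_eq_le)
      ultimately show ?thesis by simp
    qed
  qed
qed

lemma recurrence_determined:
  assumes "satisfies_recurrence a S p"
  shows "\<exists>ps as. determined ps as a"
proof -
  define A where "A = {j. j \<le> S \<and> p j \<noteq> 0}"
  have A: "finite A" "A \<noteq> {}" using assms by (auto simp: A_def satisfies_recurrence_def)
  define T where "T = Max A"
  have T: "T \<le> S" "p T \<noteq> 0" using Max_in[OF A] by (auto simp: T_def A_def)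
  have z: "p j = 0" if "j \<le> S" "T < j" for j
  proof (rule ccontr)
    assume "p j \<noteq> 0"
    hence "j \<le> T" unfolding T_def using that A(1) by (intro Max_ge) (auto simp: A_def)
    thus False using that by simp
  qed
  have rec: "(\<Sum>j<Suc T. poly (p j) (int n) * a (n + j)) = 0" for n
  proof -
    have "(\<Sum>j<Suc T. poly (p j) (int n) * a (n + j)) = (\<Sum>j\<le>S. poly (p j) (int n) * a (n + j))"
      using T z by (intro sum.mono_neutral_left) auto
    thus ?thesis using assms by (simp add: satisfies_recurrence_def)
  qed
  have "finite {x. poly (p T) x = 0}" using T by (intro poly_roots_finite)
  then obtain K where K: "\<And>x. poly (p T) x = 0 \<Longrightarrow> x < int K"
  proof -
    obtain k where "\<And>x. x \<in> {x. poly (p T) x = 0} \<Longrightarrow> x \<le> k"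
      using \<open>finite {x. poly (p T) x = 0}\<close> by (meson bdd_above.E bdd_above_finite)
    thus ?thesis using that[of "nat (k + 1)"] by force
  qed
  define ps where "ps = map (\<lambda>j. coeffs (p j)) [0..<Suc T]"
  define as where "as = map a [0..<K + T]"
  have nth: "Poly (ps ! j) = p j" if "j < Suc T" for j using that unfolding ps_def by (subst nth_map) (simp_all del: upt_Suc)
  have len: "length ps = Suc T" by (simp add: ps_def)
  have "determined ps as a" unfolding determined_def
  proof (intro conjI allI impI)
    show "ps \<noteq> []" using len by auto
    show "(\<Sum>j<length ps. poly (Poly (ps ! j)) (int n) * a (n + j)) = 0" for n
      using rec[of n] unfolding len by (simp add: nth cong: sum.cong_simp)
    show "as = map a [0..<length as]" by (simp add: as_def)
    show "length ps \<le> Suc (length as)" by (simp add: len as_def)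
    fix n assume "length as < n + length ps"
    hence "n \<ge> K" by (simp add: as_def len)
    moreover have "Poly (last ps) = p T" using nth[of T] len by (metis Suc_length_conv diff_Suc_1 last_conv_nth lessI list.discI)
    ultimately show "poly (Poly (last ps)) (int n) \<noteq> 0" using K[of "int n"] by auto
  qed
  thus ?thesis by blast
qed

lemma countable_recurrent: "countable {a. \<exists>S p. satisfies_recurrence a S p}"
proof (rule countable_subset)
  show "{a. \<exists>S p. satisfies_recurrence a S p} \<subseteq> (\<lambda>(ps, as). SOME a. determined ps as a) ` (UNIV :: (int list list \<times> int list) set)"
  proof
    fix a assume "a \<in> {a. \<exists>S p. satisfies_recurrence a S p}"
    then obtain ps as where d: "determined ps as a" using recurrence_determined by blast
    hence "(SOME a. determined ps as a) = a" using determined_unique by (metis someI)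
    thus "a \<in> (\<lambda>(ps, as). SOME a. determined ps as a) ` UNIV" by (metis (mono_tags) case_prod_conv rangeI)
  qed
qed simp

lemma nonrecurrent_branch: "\<exists>\<beta>. \<not> (\<exists>S p. satisfies_recurrence (branch \<beta>) S p)"
proof (rule ccontr)
  assume "\<not> ?thesis"
  hence "range branch \<subseteq> {a. \<exists>S p. satisfies_recurrence a S p}" by blast
  hence "countable (range branch)" using countable_recurrent countable_subset by blast
  hence "countable (UNIV :: (nat \<Rightarrow> bool) set)" using inj_branch countable_image_inj_eq by blast
  hence "range (from_nat_into (UNIV :: (nat \<Rightarrow> bool) set)) = UNIV" by (intro range_from_nat_into) auto
  then obtain k where "from_nat_into (UNIV :: (nat \<Rightarrow> bool) set) k = (\<lambda>n. \<not> from_nat_into UNIV n n)"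
    by (metis UNIV_I imageE)
  thus False by metis
qed

section \<open>Uniform bounds and their sharpness\<close>

text \<open>
  A bound for the number \<open>d\<close> of coefficients of each polynomial when \<open>\<delta>\<close> is at most the
  \<open>(M + 1)\<close>-st partial sum of the series of \<open>e\<close>.
\<close>

definition deg_cap :: "nat \<Rightarrow> nat" where "deg_cap M = 12 * fact (M + 2) + 2"

text \<open>
  The lower bound for \<open>S\<close> in \<open>recurrence_exists\<close>, at the largest admissible parameters, with
  \<open>3\<close> in place of \<open>e\<close>; the last summand is the threshold of the prime number theorem.
\<close>

definition order_bound :: "nat \<Rightarrow> nat \<Rightarrow> nat" where
  "order_bound C M = 200000 + 200 * (deg_cap M + (M + 1) + (1 + 2 * (deg_cap M * deg_cap M) * (deg_cap M + 4))
     + 3 ^ (C * (2 * (deg_cap M + 4)) ^ 26))"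

text \<open>
  A power of \<open>3\<close> that exceeds \<open>exp S\<close>. It bounds the heights, and its logarithm bounds \<open>S\<close>.
\<close>

definition height_bound :: "nat \<Rightarrow> nat \<Rightarrow> nat" where "height_bound C M = 3 ^ order_bound C M"

text \<open>
  The factor \<open>Suc m\<close> makes up for the factor \<open>1 / M\<close> in \<open>height_fun_ge\<close>, where \<open>M = Suc m\<close>.
\<close>

definition height_weight :: "nat \<Rightarrow> nat \<Rightarrow> nat" where "height_weight C m = Suc m * height_bound C (Suc m)"

lemma exp_1_le_3: "exp 1 \<le> (3::real)"
  using exp_le by simp

text \<open>
  The degree bound \<open>D\<close> is the least natural number with \<open>ln \<delta> \<le> (D + 1) / (D + 5)\<close>. As
  \<open>e\<close> exceeds the partial sum by at least \<open>1 / (M + 2)!\<close>, the denominator \<open>1 - ln \<delta>\<close> cannot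
  be too small.
\<close>

lemma degree_parameter:
  fixes \<delta> :: real
  assumes \<delta>: "1 < \<delta>" "\<delta> < exp 1"
  defines "D \<equiv> nat (max 0 \<lceil>(5 * ln \<delta> - 1) / (1 - ln \<delta>)\<rceil>)"
  shows "ln \<delta> \<le> real (D + 1) / (real (D + 1) + 4)"
    and "\<delta> \<le> exp_sum (Suc M) \<Longrightarrow> D + 1 \<le> deg_cap M"
proof -
  define u where "u = ln \<delta>"
  have u: "0 < u" "u < 1"
  proof -
    show "0 < u" using \<delta> by (simp add: u_def)
    have "ln \<delta> < ln (exp 1)" using \<delta> by (subst ln_less_cancel_iff) auto
    thus "u < 1" by (simp add: u_def)
  qed
  define x where "x = (5 * u - 1) / (1 - u)"
  have xe: "x * (1 - u) = 5 * u - 1" using u by (simp add: x_def)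
  have D: "D = nat (max 0 \<lceil>x\<rceil>)" by (simp add: D_def x_def u_def)
  have "x \<le> real D" unfolding D by linarith
  hence "x * (1 - u) \<le> real D * (1 - u)" using u by (intro mult_right_mono) auto
  hence "u * (real (D + 1) + 4) \<le> real (D + 1)" unfolding xe by (simp add: algebra_simps)
  thus "ln \<delta> \<le> real (D + 1) / (real (D + 1) + 4)" unfolding u_def by (simp add: pos_le_divide_eq)
  assume le: "\<delta> \<le> exp_sum (Suc M)"
  have "exp_sum (Suc M) + 1 / fact (M + 2) \<le> exp 1"
    using exp_sum_le_exp[of "Suc (Suc M)"] by (simp add: exp_sum_Suc)
  hence gap: "exp 1 - \<delta> \<ge> 1 / fact (M + 2)" using le by linarith
  have "ln (\<delta> / exp 1) \<le> \<delta> / exp 1 - 1" using \<delta> by (intro ln_le_minus_one) auto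
  hence "1 - u \<ge> 1 - \<delta> / exp 1" using \<delta> by (simp add: u_def ln_div)
  also have "1 - \<delta> / exp 1 = (exp 1 - \<delta>) / exp 1" by (simp add: diff_divide_distrib)
  also have "(exp 1 - \<delta>) / exp 1 \<ge> (1 / fact (M + 2)) / 3"
    using gap exp_1_le_3 \<delta> by (intro frac_le) auto
  finally have g1: "1 - u \<ge> (1 / fact (M + 2)) / 3" .
  have "x \<le> 4 / (1 - u)" unfolding x_def using u by (intro divide_right_mono) auto
  also have "\<dots> \<le> 4 / ((1 / fact (M + 2)) / 3)"
    by (rule divide_left_mono[OF g1]) (use u in \<open>auto intro!: mult_pos_pos divide_pos_pos simp del: fact_Suc\<close>)
  also have "\<dots> = 12 * fact (M + 2)" by simp
  finally have "x \<le> real (12 * fact (M + 2))" by (simp only: of_nat_mult of_nat_fact of_nat_numeral)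
  hence "\<lceil>x\<rceil> \<le> int (12 * fact (M + 2))" by (simp only: ceiling_le_iff of_int_of_nat_eq)
  hence "D \<le> 12 * fact (M + 2)" unfolding D by linarith
  thus "D + 1 \<le> deg_cap M" by (simp add: deg_cap_def)
qed

lemma computable_height:
  "computable_real_fun2 {(c, \<delta>). 0 < c \<and> 1 < \<delta> \<and> \<delta> < exp 1} (height_fun (height_weight C) (height_bound C 0))"
  unfolding height_weight_def height_bound_def order_bound_def deg_cap_def
  by (intro computable_height_fun computable_add computable_mult computable_power computable_const computable_Suc computable_fact)

text \<open>
  Below the threshold of the prime number theorem the lower bound for \<open>theta\<close> is made trivial by
  subtracting the constant \<open>N0\<close>.
\<close>

lemma recurrence_bounded:
  assumes C: "C \<ge> 1" "\<And>\<eta> n. 0 < \<eta> \<Longrightarrow> \<eta> \<le> 1 \<Longrightarrow> ln (real n) \<ge> C / \<eta> ^ 26 \<Longrightarrow> \<bar>theta n - real n\<bar> \<le> \<eta> * real n"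
    and Cn: "C \<le> real Cn"
    and a: "primary_pseudo_polynomial a" and ab: "\<And>n. \<bar>real_of_int (a n)\<bar> \<le> c * \<delta> ^ n"
    and \<delta>: "1 < \<delta>" and d: "d \<ge> 1" "d \<le> deg_cap M" "ln \<delta> \<le> real d / (real d + 4)" and c: "c \<le> real (Suc M)"
  shows "\<exists>p. satisfies_recurrence a (order_bound Cn M) p \<and> (\<forall>j. degree (p j) \<le> d - 1) \<and>
     (\<forall>j\<le>order_bound Cn M. \<forall>i. \<bar>real_of_int (coeff (p j) i)\<bar> \<le> exp (real (order_bound Cn M)))"
proof -
  define \<eta> where "\<eta> = 1 / (2 * (real d + 4))"
  define N0 where "N0 = exp (C / \<eta> ^ 26)"
  have eta: "0 < \<eta>" "\<eta> \<le> 1" by (auto simp: \<eta>_def divide_simps)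
  have ce: "C / \<eta> ^ 26 = C * (2 * (real d + 4)) ^ 26" by (simp add: \<eta>_def power_divide)
  have th: "theta n \<ge> (1 - \<eta>) * real n - N0" for n
  proof (cases "ln (real n) \<ge> C / \<eta> ^ 26")
    case True
    have "\<bar>theta n - real n\<bar> \<le> \<eta> * real n" by (rule C(2)[OF eta True])
    moreover have "N0 \<ge> 0" by (simp add: N0_def)
    ultimately show ?thesis by (simp add: algebra_simps abs_le_iff)
  next
    case False
    have "real n \<le> N0"
    proof (cases "n = 0")
      case False
      hence "real n = exp (ln (real n))" by simp
      also have "\<dots> \<le> N0" unfolding N0_def using \<open>\<not> ln (real n) \<ge> C / \<eta> ^ 26\<close> by simp
      finally show ?thesis .
    qed (simp add: N0_def)
    moreover have "(1 - \<eta>) * real n \<le> 1 * real n" using eta by (intro mult_right_mono) auto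
    moreover have "theta n \<ge> 0" unfolding theta_def by (intro sum_nonneg) (auto dest: prime_ge_1_nat)
    ultimately show ?thesis by linarith
  qed
  define Z where "Z = (3::nat) ^ (Cn * (2 * (deg_cap M + 4)) ^ 26)"
  have N0: "N0 \<le> real Z"
  proof -
    have "C * (2 * (real d + 4)) ^ 26 \<le> real Cn * (2 * (real (deg_cap M) + 4)) ^ 26"
      using d Cn C(1) by (intro mult_mono power_mono) auto
    also have "\<dots> = real (Cn * (2 * (deg_cap M + 4)) ^ 26)" by simp
    finally have "N0 \<le> exp (real (Cn * (2 * (deg_cap M + 4)) ^ 26) * 1)" unfolding N0_def ce by simp
    also have "\<dots> = exp 1 ^ (Cn * (2 * (deg_cap M + 4)) ^ 26)" by (rule exp_of_nat_mult)
    also have "\<dots> \<le> 3 ^ (Cn * (2 * (deg_cap M + 4)) ^ 26)" using exp_1_le_3 by (intro power_mono) auto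
    finally show ?thesis unfolding Z_def of_nat_power of_nat_numeral .
  qed
  define S where "S = order_bound Cn M"
  define c' where "c' = real (Suc M)"
  have dd: "real d \<le> real (deg_cap M)" using d by simp
  define x y where "x = (real d)\<^sup>2 * (real d + 4)" and "y = (real (deg_cap M) * real (deg_cap M)) * (real (deg_cap M) + 4)"
  have "x \<le> y" unfolding x_def y_def power2_eq_square using dd by (intro mult_mono) auto
  moreover have "real S = 200000 + 200 * (real (deg_cap M) + (real M + 1) + (1 + 2 * y) + real Z)"
    unfolding S_def order_bound_def Z_def[symmetric] y_def mult.assoc
    by (simp only: of_nat_add of_nat_mult of_nat_numeral of_nat_1)
  moreover have "200000 + 200 * (d0 + (1 + m0) + (1 + 2 * x) + n0) \<le> s0"
    if "x \<le> y" "s0 = 200000 + 200 * (d1 + (m0 + 1) + (1 + 2 * y) + z0)" "d0 \<le> d1" "n0 \<le> z0"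
    for d0 d1 m0 n0 s0 z0 :: real
    using that by argo
  ultimately have "real S \<ge> 200000 + 200 * (real d + c' + (1 + 2 * x) + N0)"
    using dd N0 unfolding c'_def of_nat_Suc by blast
  hence S: "real S \<ge> 200000 + 200 * (real d + c' + (1 + 2 * (real d)\<^sup>2 * (real d + 4)) + N0)"
    unfolding x_def by (simp only: mult.assoc)
  have ab': "\<bar>real_of_int (a n)\<bar> \<le> c' * exp (real d / (real d + 4) * real n)" for n
  proof -
    have "\<delta> = exp (ln \<delta>)" using \<delta> by simp
    also have "\<dots> \<le> exp (real d / (real d + 4))" using d by simp
    finally have "\<delta> ^ n \<le> exp (real d / (real d + 4)) ^ n" using \<delta> by (intro power_mono) auto
    also have "\<dots> = exp (real d / (real d + 4) * real n)" by (metis exp_of_nat_mult mult.commute)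
    finally have e: "\<delta> ^ n \<le> exp (real d / (real d + 4) * real n)" .
    have "c * \<delta> ^ n \<le> c' * \<delta> ^ n" using c \<delta> unfolding c'_def by (intro mult_right_mono) auto
    also have "\<dots> \<le> c' * exp (real d / (real d + 4) * real n)" using e unfolding c'_def by (intro mult_left_mono) auto
    finally show ?thesis using ab[of n] by linarith
  qed
  have "\<exists>p. satisfies_recurrence a S p \<and> (\<forall>j. degree (p j) \<le> d - 1) \<and> (\<forall>j\<le>S. \<forall>i. \<bar>real_of_int (coeff (p j) i)\<bar> \<le> exp (real S))"
    by (rule recurrence_exists[OF a d(1) _ _ ab' _ S]) (use th in \<open>auto simp: c'_def N0_def \<eta>_def\<close>)
  thus ?thesis by (simp only: S_def)
qed

lemma poly_height_le:
  assumes "\<And>i. \<bar>real_of_int (coeff p i)\<bar> \<le> B"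
  shows "poly_height (map_poly of_int p) \<le> B"
  unfolding poly_height_def by (rule Max.boundedI) (use assms in \<open>auto simp: coeff_map_poly\<close>)

lemma computable_recurrence_bound:
  "\<exists>H :: real \<Rightarrow> real \<Rightarrow> real.
            computable_real_fun2 {(c, \<delta>). 0 < c \<and> 1 < \<delta> \<and> \<delta> < exp 1} H \<and>
            (\<forall>c \<delta>. 0 < c \<and> 1 < \<delta> \<and> \<delta> < exp 1 \<longrightarrow>
               1 \<le> H c \<delta> \<and>
               (\<forall>a :: nat \<Rightarrow> int.
                  primary_pseudo_polynomial a \<and> (\<forall>n. \<bar>real_of_int (a n)\<bar> \<le> c * \<delta> ^ n) \<longrightarrow>
                  (\<exists>(S :: nat) (p :: nat \<Rightarrow> int poly).
                     satisfies_recurrence a S p \<and>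
                     int (MAX j\<in>{..S}. degree (p j))
                       \<le> max 0 \<lceil>(5 * ln \<delta> - 1) / (1 - ln \<delta>)\<rceil> \<and>
                     (MAX j\<in>{..S}. poly_height (map_poly (of_int :: int \<Rightarrow> complex) (p j))) \<le> H c \<delta> \<and>
                     real S \<le> ln (H c \<delta>) / ln \<delta>)))"
proof -
  obtain C where C: "C \<ge> 1" "\<And>\<eta> n. 0 < \<eta> \<Longrightarrow> \<eta> \<le> 1 \<Longrightarrow> ln (real n) \<ge> C / \<eta> ^ 26 \<Longrightarrow> \<bar>theta n - real n\<bar> \<le> \<eta> * real n"
    using theta_rate by auto
  obtain Cn where Cn: "C \<le> real Cn" using real_arch_simple by blast
  define H where "H = height_fun (height_weight Cn) (height_bound Cn 0)"
  show ?thesis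
  proof (intro exI[of _ H] conjI allI impI; (elim conjE)?)
    show "computable_real_fun2 {(c, \<delta>). 0 < c \<and> 1 < \<delta> \<and> \<delta> < exp 1} H"
      unfolding H_def by (rule computable_height)
  next
    fix c \<delta> :: real
    have "real (height_bound Cn 0) \<ge> 1" by (simp add: height_bound_def)
    moreover have "(\<Sum>m<height_cutoff c \<delta>. height_term (height_weight Cn) c \<delta> m) \<ge> 0" by (intro sum_nonneg height_term_nonneg)
    ultimately show "1 \<le> H c \<delta>" unfolding H_def height_fun_def by linarith
  next
    fix c \<delta> :: real and a :: "nat \<Rightarrow> int"
    assume c: "0 < c" and \<delta>: "1 < \<delta>" "\<delta> < exp 1" and a: "primary_pseudo_polynomial a"
      and ab: "\<forall>n. \<bar>real_of_int (a n)\<bar> \<le> c * \<delta> ^ n"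
    have "(c, \<delta>) \<in> param_domain" using c \<delta> by (simp add: param_domain_def)
    hence "\<exists>M. \<delta> \<le> exp_sum (Suc M) \<and> c \<le> real (Suc M) \<and> H c \<delta> \<ge> real (height_bound Cn M)"
      unfolding H_def by (rule height_fun_ge) (simp_all add: height_weight_def distrib_right)
    then obtain M where M: "\<delta> \<le> exp_sum (Suc M)" "c \<le> real (Suc M)" "H c \<delta> \<ge> real (height_bound Cn M)" by blast
    define S where "S = order_bound Cn M"
    define D where "D = nat (max 0 \<lceil>(5 * ln \<delta> - 1) / (1 - ln \<delta>)\<rceil>)"
    have "\<exists>p. satisfies_recurrence a S p \<and> (\<forall>j. degree (p j) \<le> (D + 1) - 1) \<and>
     (\<forall>j\<le>S. \<forall>i. \<bar>real_of_int (coeff (p j) i)\<bar> \<le> exp (real S))"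
      unfolding S_def
    proof (rule recurrence_bounded[OF C Cn a _ \<delta>(1) _ _ _ M(2)])
      show "ln \<delta> \<le> real (D + 1) / (real (D + 1) + 4)" "D + 1 \<le> deg_cap M"
        unfolding D_def using degree_parameter[OF \<delta>] M(1) by blast+
    qed (use ab in auto)
    then obtain p where p: "satisfies_recurrence a S p" "\<And>j. degree (p j) \<le> D"
      "\<And>j i. j \<le> S \<Longrightarrow> \<bar>real_of_int (coeff (p j) i)\<bar> \<le> exp (real S)" by auto
    have "exp (real S) = exp 1 ^ S" by (metis exp_of_nat_mult mult.right_neutral)
    also have "\<dots> \<le> 3 ^ S" using exp_1_le_3 by (intro power_mono) auto
    also have "\<dots> = real (height_bound Cn M)" by (simp add: height_bound_def S_def)
    finally have SH: "exp (real S) \<le> H c \<delta>" using M(3) by linarith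
    have ln01: "0 < ln \<delta>" "ln \<delta> \<le> 1"
    proof -
      show "0 < ln \<delta>" using \<delta> by simp
      have "ln \<delta> \<le> ln (exp 1)" using \<delta> by (subst ln_le_cancel_iff) auto
      thus "ln \<delta> \<le> 1" by simp
    qed
    have "ln (exp (real S)) \<le> ln (H c \<delta>)" using SH exp_gt_zero[of "real S"] by (subst ln_le_cancel_iff) linarith+
    hence lS: "real S \<le> ln (H c \<delta>)" by simp
    have "real S * ln \<delta> \<le> real S * 1" using ln01 by (intro mult_left_mono) auto
    hence "real S \<le> ln (H c \<delta>) / ln \<delta>" using lS ln01 by (simp add: pos_le_divide_eq)
    moreover have "(MAX j\<in>{..S}. poly_height (map_poly (of_int :: int \<Rightarrow> complex) (p j))) \<le> H c \<delta>"
    proof (rule Max.boundedI)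
      fix h assume "h \<in> (\<lambda>j. poly_height (map_poly (of_int :: int \<Rightarrow> complex) (p j))) ` {..S}"
      then obtain j where j: "j \<le> S" "h = poly_height (map_poly (of_int :: int \<Rightarrow> complex) (p j))" by auto
      have "h \<le> exp (real S)" unfolding j(2) by (rule poly_height_le[OF p(3)[OF j(1)]])
      thus "h \<le> H c \<delta>" using SH by linarith
    qed auto
    moreover have "(MAX j\<in>{..S}. degree (p j)) \<le> D" by (rule Max.boundedI) (use p(2) in auto)
    hence "int (MAX j\<in>{..S}. degree (p j)) \<le> int D" by simp
    hence "int (MAX j\<in>{..S}. degree (p j)) \<le> max 0 \<lceil>(5 * ln \<delta> - 1) / (1 - ln \<delta>)\<rceil>" unfolding D_def by simp
    ultimately show "\<exists>S p. satisfies_recurrence a S p \<and>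
                     int (MAX j\<in>{..S}. degree (p j))
                       \<le> max 0 \<lceil>(5 * ln \<delta> - 1) / (1 - ln \<delta>)\<rceil> \<and>
                     (MAX j\<in>{..S}. poly_height (map_poly (of_int :: int \<Rightarrow> complex) (p j))) \<le> H c \<delta> \<and>
                     real S \<le> ln (H c \<delta>) / ln \<delta>"
      using p(1) by blast
  qed
qed

text \<open>
  All the sequences \<open>branch \<beta>\<close> are at most \<open>2 * primorial n\<close>, which the prime number theorem
  bounds by a multiple of \<open>exp ((1 + \<eta>) * n)\<close>; one of them satisfies no recurrence.
\<close>

lemma nonrecurrent_beyond_e:
  fixes e' :: real
  assumes e': "exp 1 < e'"
  shows "\<exists>(a :: nat \<Rightarrow> int) (c :: real) (\<delta> :: real).
               primary_pseudo_polynomial a \<and> 0 < c \<and> 1 < \<delta> \<and> \<delta> < e' \<and>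
               (\<forall>n. \<bar>real_of_int (a n)\<bar> \<le> c * \<delta> ^ n) \<and>
               \<not> (\<exists>(S :: nat) (p :: nat \<Rightarrow> int poly). satisfies_recurrence a S p)"
proof -
  obtain C where C: "C \<ge> 1" "\<And>\<eta> n. 0 < \<eta> \<Longrightarrow> \<eta> \<le> 1 \<Longrightarrow> ln (real n) \<ge> C / \<eta> ^ 26 \<Longrightarrow> \<bar>theta n - real n\<bar> \<le> \<eta> * real n"
    using theta_rate by auto
  obtain \<beta> where \<beta>: "\<not> (\<exists>S p. satisfies_recurrence (branch \<beta>) S p)" using nonrecurrent_branch by blast
  have e0: "e' > 0" using e' exp_gt_zero[of "1::real"] by linarith
  have "ln (exp 1) < ln e'" using e' e0 by (subst ln_less_cancel_iff) auto
  hence l1: "ln e' > 1" by simp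
  define \<eta> where "\<eta> = min 1 ((ln e' - 1) / 2)"
  have eta: "0 < \<eta>" "\<eta> \<le> 1" "1 + \<eta> < ln e'" using l1 by (auto simp: \<eta>_def min_def field_simps)
  define K where "K = 4 * exp (C / \<eta> ^ 26)"
  have th: "theta n \<le> (1 + \<eta>) * real n + K" for n
  proof (cases "ln (real n) \<ge> C / \<eta> ^ 26")
    case True
    have "\<bar>theta n - real n\<bar> \<le> \<eta> * real n" by (rule C(2)[OF eta(1,2) True])
    moreover have "K \<ge> 0" by (simp add: K_def)
    ultimately show ?thesis by (simp add: algebra_simps abs_le_iff)
  next
    case False
    have "4 * real n \<le> K"
    proof (cases "n = 0")
      case False
      hence "real n = exp (ln (real n))" by simp
      also have "\<dots> \<le> exp (C / \<eta> ^ 26)" using \<open>\<not> ln (real n) \<ge> C / \<eta> ^ 26\<close> by simp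
      finally show ?thesis by (simp add: K_def)
    qed (simp add: K_def)
    moreover have "theta n \<le> 4 * real n" using theta_le_psi[of n] psi_le[of n] by linarith
    moreover have "(1 + \<eta>) * real n \<ge> 0" using eta by simp
    ultimately show ?thesis by linarith
  qed
  define \<delta> where "\<delta> = exp (1 + \<eta>)"
  have "\<delta> < exp (ln e')" unfolding \<delta>_def using eta by simp
  hence d1: "\<delta> < e'" using e0 by simp
  have d2: "1 < \<delta>" using eta by (simp add: \<delta>_def)
  have "\<bar>real_of_int (branch \<beta> n)\<bar> \<le> (2 * exp K) * \<delta> ^ n" for n
  proof -
    have "\<bar>branch \<beta> n\<bar> \<le> 2 * int (primorial n)" using branch_bound[of \<beta> n] by simp
    hence "real_of_int \<bar>branch \<beta> n\<bar> \<le> real_of_int (2 * int (primorial n))" by (simp only: of_int_le_iff)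
    hence "\<bar>real_of_int (branch \<beta> n)\<bar> \<le> 2 * exp (theta n)" by (simp add: primorial_eq_exp)
    also have "\<dots> \<le> 2 * exp ((1 + \<eta>) * real n + K)" using th[of n] by simp
    also have "exp ((1 + \<eta>) * real n + K) = exp K * \<delta> ^ n"
    proof -
      have "exp ((1 + \<eta>) * real n) = \<delta> ^ n" unfolding \<delta>_def by (subst mult.commute) (rule exp_of_nat_mult)
      thus ?thesis by (simp only: exp_add mult.commute)
    qed
    also have "2 * (exp K * \<delta> ^ n) = (2 * exp K) * \<delta> ^ n" by simp
    finally show ?thesis .
  qed
  thus ?thesis using branch_pseudo[of \<beta>] \<beta> d1 d2
    by (intro exI[of _ "branch \<beta>"] exI[of _ "2 * exp K"] exI[of _ \<delta>]) auto
qed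

theorem theorem3:
  shows "(\<exists>H :: real \<Rightarrow> real \<Rightarrow> real.
            computable_real_fun2 {(c, \<delta>). 0 < c \<and> 1 < \<delta> \<and> \<delta> < exp 1} H \<and>
            (\<forall>c \<delta>. 0 < c \<and> 1 < \<delta> \<and> \<delta> < exp 1 \<longrightarrow>
               1 \<le> H c \<delta> \<and>
               (\<forall>a :: nat \<Rightarrow> int.
                  primary_pseudo_polynomial a \<and> (\<forall>n. \<bar>real_of_int (a n)\<bar> \<le> c * \<delta> ^ n) \<longrightarrow>
                  (\<exists>(S :: nat) (p :: nat \<Rightarrow> int poly).
                     satisfies_recurrence a S p \<and>
                     int (MAX j\<in>{..S}. degree (p j))
                       \<le> max 0 \<lceil>(5 * ln \<delta> - 1) / (1 - ln \<delta>)\<rceil> \<and>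
                     (MAX j\<in>{..S}. poly_height (map_poly (of_int :: int \<Rightarrow> complex) (p j))) \<le> H c \<delta> \<and>
                     real S \<le> ln (H c \<delta>) / ln \<delta>)))) \<and>
         (\<forall>e' :: real. exp 1 < e' \<longrightarrow>
            (\<exists>(a :: nat \<Rightarrow> int) (c :: real) (\<delta> :: real).
               primary_pseudo_polynomial a \<and> 0 < c \<and> 1 < \<delta> \<and> \<delta> < e' \<and>
               (\<forall>n. \<bar>real_of_int (a n)\<bar> \<le> c * \<delta> ^ n) \<and>
               \<not> (\<exists>(S :: nat) (p :: nat \<Rightarrow> int poly). satisfies_recurrence a S p)))"
  using computable_recurrence_bound nonrecurrent_beyond_e by blast

end
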